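(* Let $f_+,f_-:\mathbb R\to\mathbb R$ be of class $C^4$, let $u_1<u_0<u_2$ be real numbers and let $0\le\varepsilon_-<\varepsilon_0$. Assume that: (i) $D_+(u,-\varepsilon)>0$ and $D_-(u,-\varepsilon)>0$ for all $u\in[u_1,u_2]$ and all $\varepsilon\in(\varepsilon_-,\varepsilon_0)$; (ii) $\varepsilon_0$ is a simple root of the function $\varepsilon\mapsto D_-(u_0,-\varepsilon)$, and $D_-(u,-\varepsilon_0)>0$ for $u\in[u_1,u_2]\setminus\{u_0\}$; (iii) $D_+(u,-\varepsilon_0)>0$ for all $u\in[u_1,u_2]$; (iv) $u_0$ is a root of the second order of the function $u\mapsto D_-(u,-\varepsilon_0)$ (that is, the function and its first derivative vanish at $u_0$ and its second derivative does not). Then there exists $\varepsilon_+>\varepsilon_0$ such that for every $\varepsilon\in(\varepsilon_0,\varepsilon_+)$ there exist two roots $u^l<u^r$ in $(u_1,u_2)$ of the equation $D_-(u,-\varepsilon)=0$, and one can construct the foliation $$\Omega^{\mathrm L}_\varepsilon(u_1,u^l)\cup\Omega^{\mathrm{W}-}_\varepsilon(u^l,u^r)\cup\Omega^{\mathrm L}_\varepsilon(u^r,u_2),$$ where the foliation of the domain $\Omega^{\mathrm{W}-}_\varepsilon(u^l,u^r)=\{(x_1,x_2): u^l\le x_1+x_2\le u^r,\ -\varepsilon\le x_2\le\varepsilon\}$ is a left horizontal herringbone whose spine extends from the point $(u^l+\varepsilon,-\varepsilon)$ to the point $(u^r+\varepsilon,-\varepsilon)$. That is, there is a $C^1$-smooth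 diagonally concave function $B$ on $\{u_1\le x_1+x_2\le u_2,\ |x_2|\le\varepsilon\}$ with $B(x_1,\pm\varepsilon)=f_\pm(x_1)$ whose restrictions to $\Omega^{\mathrm L}_\varepsilon(u_1,u^l)$ and $\Omega^{\mathrm L}_\varepsilon(u^r,u_2)$ are left simple candidates and whose restriction to $\Omega^{\mathrm{W}-}_\varepsilon(u^l,u^r)$ is a left herringbone candidate with a spine as described, which does not meet the line $x_2=0$.
   Context: Notation. For $x=(x_1,x_2)$ with $x_2\ne0$, the functions $D_\pm$ are defined by $$2x_2D_+(x)=f_+'(x_1+x_2)-f_-'(x_1-x_2)-2x_2f_+''(x_1+x_2),$$ $$2x_2D_-(x)=f_+'(x_1+x_2)-f_-'(x_1-x_2)-2x_2f_-''(x_1-x_2).$$ For $\varepsilon>0$ the strip is $\Omega_\varepsilon=\{(x_1,x_2):|x_2|\le\varepsilon\}$. A function on a subset of the strip is diagonally concave if it is concave on every segment contained in the subset and parallel to $(1,1)$ or to $(1,-1)$. Left simple candidate. $\Omega^{\mathrm L}_\varepsilon(a,b)=\{(x_1,x_2):a\le x_1+x_2\le b,\ |x_2|\le\varepsilon\}$, foliated by the segments $x_1+x_2=u$; the left simple candidate on it is the function, affine on each of these segments, $$B(x_1,x_2)=\frac{\varepsilon+x_2}{2\varepsilon}f_+(x_1+x_2-\varepsilon)+\frac{\varepsilon-x_2}{2\varepsilon}f_-(x_1+x_2+\varepsilon),$$ provided it is diagonally concave. Left (horizontal) herringbone. Its spine is a graph $\{(u,T(u)):u\in[p,q]\}$ with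 $T$ continuous on $[p,q]$, and $C^1$ with $|T|<\varepsilon$, $|T'|<1$ on $(p,q)$. From each spine point $(u,T)$, $T=T(u)$, two segments (ribs) go to the left: one to the upper boundary point $(u+T-\varepsilon,\varepsilon)$, the other to the lower boundary point $(u-T-\varepsilon,-\varepsilon)$. The domain is the union of all ribs. The shifted curve $\{(u-\varepsilon,T(u))\}$ is an integral curve of the field $$\dot x_1=\varepsilon(f_+'-f_-')-x_2(\varepsilon-x_2)f_-''-x_2(\varepsilon+x_2)f_+'',\qquad \dot x_2=x_2(f_-'-f_+')-x_2(\varepsilon-x_2)f_-''+x_2(\varepsilon+x_2)f_+'',$$ where the derivatives of $f_+$ are taken at $x_1+x_2$ and those of $f_-$ at $x_1-x_2$. A left herringbone candidate is a $C^1$-smooth diagonally concave function $B$ on this domain with $B(x_1,\pm\varepsilon)=f_\pm(x_1)$, affine on each rib, whose value at the spine point $(u,T)$ is $$\frac{\varepsilon^2-T^2}{2\varepsilon T}\big[(\varepsilon+T)f_+'-(\varepsilon-T)f_-'\big]+\frac{(\varepsilon+T)f_++(\varepsilon-T)f_-}{2\varepsilon},$$ with $f_+,f_+'$ taken at $u+T-\varepsilon$ and $f_-,f_-'$ taken at $u-T-\varepsilon$ (by continuity where $T=0$). *)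

theory Defs
  imports "HOL-Analysis.Analysis"
begin

section \<open>Smoothness and roots\<close>

definition of_class_C :: "nat \<Rightarrow> (real \<Rightarrow> real) \<Rightarrow> bool" where
  "of_class_C k f \<longleftrightarrow>
     (\<forall>j<k. \<forall>x. (deriv ^^ j) f differentiable (at x)) \<and> continuous_on UNIV ((deriv ^^ k) f)"

text \<open>A root of order 1 is a simple root. The definition is meant for functions that are
  \<open>k\<close> times differentiable at \<open>x\<close>.\<close>

definition root_of_order :: "nat \<Rightarrow> (real \<Rightarrow> real) \<Rightarrow> real \<Rightarrow> bool" where
  "root_of_order k g x \<longleftrightarrow> (\<forall>j<k. (deriv ^^ j) g x = 0) \<and> (deriv ^^ k) g x \<noteq> 0"

text \<open>The sets \<open>S\<close> of interest are not open: \<open>C\<^sup>1\<close>-smoothness is understood up to the boundary,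
  through the derivative within \<open>S\<close>, given by a continuous gradient \<open>G\<close>.\<close>

definition C1_smooth_on :: "(real \<times> real) set \<Rightarrow> (real \<times> real \<Rightarrow> real) \<Rightarrow> bool" where
  "C1_smooth_on S B \<longleftrightarrow>
     (\<exists>G. (\<forall>x\<in>S. (B has_derivative (\<lambda>h. G x \<bullet> h)) (at x within S)) \<and> continuous_on S G)"


section \<open>Diagonal concavity\<close>

definition diagonally_concave_on :: "(real \<times> real) set \<Rightarrow> (real \<times> real \<Rightarrow> real) \<Rightarrow> bool" where
  "diagonally_concave_on S B \<longleftrightarrow>
     (\<forall>x y. closed_segment x y \<subseteq> S \<longrightarrow>
        (\<exists>t. y - x = t *\<^sub>R (1, 1) \<or> y - x = t *\<^sub>R (1, -1)) \<longrightarrow>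
        concave_on (closed_segment x y) B)"

definition affine_on_segment ::
  "(real \<times> real \<Rightarrow> real) \<Rightarrow> real \<times> real \<Rightarrow> real \<times> real \<Rightarrow> bool" where
  "affine_on_segment B x y \<longleftrightarrow>
     (\<forall>t\<in>{0..1}. B ((1 - t) *\<^sub>R x + t *\<^sub>R y) = (1 - t) * B x + t * B y)"

definition boundary_values ::
  "real \<Rightarrow> (real \<Rightarrow> real) \<Rightarrow> (real \<Rightarrow> real) \<Rightarrow> (real \<times> real) set \<Rightarrow> (real \<times> real \<Rightarrow> real) \<Rightarrow> bool" where
  "boundary_values \<epsilon> f\<^sub>p f\<^sub>m S B \<longleftrightarrow>
     (\<forall>x\<^sub>1. ((x\<^sub>1, \<epsilon>) \<in> S \<longrightarrow> B (x\<^sub>1, \<epsilon>) = f\<^sub>p x\<^sub>1) \<and>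
           ((x\<^sub>1, -\<epsilon>) \<in> S \<longrightarrow> B (x\<^sub>1, -\<epsilon>) = f\<^sub>m x\<^sub>1))"


section \<open>The functions $D_\pm$ and simple candidates\<close>

text \<open>Throughout, \<open>f\<^sub>p\<close> and \<open>f\<^sub>m\<close> stand for $f_+$ and $f_-$.
  \<open>D_plus\<close> and \<open>D_minus\<close> are only meaningful off the line $x_2 = 0$.\<close>

definition D_plus :: "(real \<Rightarrow> real) \<Rightarrow> (real \<Rightarrow> real) \<Rightarrow> real \<times> real \<Rightarrow> real" where
  "D_plus f\<^sub>p f\<^sub>m = (\<lambda>(x\<^sub>1, x\<^sub>2).
     (deriv f\<^sub>p (x\<^sub>1 + x\<^sub>2) - deriv f\<^sub>m (x\<^sub>1 - x\<^sub>2) - 2 * x\<^sub>2 * deriv (deriv f\<^sub>p) (x\<^sub>1 + x\<^sub>2)) / (2 * x\<^sub>2))"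

definition D_minus :: "(real \<Rightarrow> real) \<Rightarrow> (real \<Rightarrow> real) \<Rightarrow> real \<times> real \<Rightarrow> real" where
  "D_minus f\<^sub>p f\<^sub>m = (\<lambda>(x\<^sub>1, x\<^sub>2).
     (deriv f\<^sub>p (x\<^sub>1 + x\<^sub>2) - deriv f\<^sub>m (x\<^sub>1 - x\<^sub>2) - 2 * x\<^sub>2 * deriv (deriv f\<^sub>m) (x\<^sub>1 - x\<^sub>2)) / (2 * x\<^sub>2))"

text \<open>Both $\Omega^{\mathrm L}_\varepsilon(a,b)$ and $\Omega^{\mathrm{W}-}_\varepsilon(a,b)$ are
  this parallelogram; they differ only in the foliation.\<close>

definition left_parallelogram :: "real \<Rightarrow> real \<Rightarrow> real \<Rightarrow> (real \<times> real) set" where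
  "left_parallelogram \<epsilon> a b = {(x\<^sub>1, x\<^sub>2). a \<le> x\<^sub>1 + x\<^sub>2 \<and> x\<^sub>1 + x\<^sub>2 \<le> b \<and> \<bar>x\<^sub>2\<bar> \<le> \<epsilon>}"

definition left_simple_candidate ::
  "real \<Rightarrow> (real \<Rightarrow> real) \<Rightarrow> (real \<Rightarrow> real) \<Rightarrow> real \<Rightarrow> real \<Rightarrow> (real \<times> real \<Rightarrow> real) \<Rightarrow> bool" where
  "left_simple_candidate \<epsilon> f\<^sub>p f\<^sub>m a b B \<longleftrightarrow>
     (\<forall>(x\<^sub>1, x\<^sub>2) \<in> left_parallelogram \<epsilon> a b.
        B (x\<^sub>1, x\<^sub>2) = (\<epsilon> + x\<^sub>2) / (2 * \<epsilon>) * f\<^sub>p (x\<^sub>1 + x\<^sub>2 - \<epsilon>) + (\<epsilon> - x\<^sub>2) / (2 * \<epsilon>) * f\<^sub>m (x\<^sub>1 + x\<^sub>2 + \<epsilon>)) \<and>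
     diagonally_concave_on (left_parallelogram \<epsilon> a b) B"


section \<open>Left herringbones\<close>

definition herringbone_field ::
  "real \<Rightarrow> (real \<Rightarrow> real) \<Rightarrow> (real \<Rightarrow> real) \<Rightarrow> real \<times> real \<Rightarrow> real \<times> real" where
  "herringbone_field \<epsilon> f\<^sub>p f\<^sub>m = (\<lambda>(x\<^sub>1, x\<^sub>2).
     let dp = deriv f\<^sub>p (x\<^sub>1 + x\<^sub>2); ddp = deriv (deriv f\<^sub>p) (x\<^sub>1 + x\<^sub>2);
         dm = deriv f\<^sub>m (x\<^sub>1 - x\<^sub>2); ddm = deriv (deriv f\<^sub>m) (x\<^sub>1 - x\<^sub>2)
     in (\<epsilon> * (dp - dm) - x\<^sub>2 * (\<epsilon> - x\<^sub>2) * ddm - x\<^sub>2 * (\<epsilon> + x\<^sub>2) * ddp,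
         x\<^sub>2 * (dm - dp) - x\<^sub>2 * (\<epsilon> - x\<^sub>2) * ddm + x\<^sub>2 * (\<epsilon> + x\<^sub>2) * ddp))"

text \<open>\<open>C\<close> is the trajectory of a solution of the autonomous system given by \<open>F\<close>, on a possibly
  unbounded open time interval \<open>I\<close>.\<close>

definition integral_curve :: "(real \<times> real \<Rightarrow> real \<times> real) \<Rightarrow> (real \<times> real) set \<Rightarrow> bool" where
  "integral_curve F C \<longleftrightarrow>
     (\<exists>I \<gamma>. open I \<and> is_interval I \<and> I \<noteq> {} \<and>
        (\<forall>t\<in>I. (\<gamma> has_vector_derivative F (\<gamma> t)) (at t)) \<and> \<gamma> ` I = C)"

text \<open>The endpoints of the spine are excluded from the integral curve: in the case of interest
  they are stationary points of the field, approached only as time tends to $\pm\infty$.\<close>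

definition left_spine ::
  "real \<Rightarrow> (real \<Rightarrow> real) \<Rightarrow> (real \<Rightarrow> real) \<Rightarrow> real \<Rightarrow> real \<Rightarrow> (real \<Rightarrow> real) \<Rightarrow> bool" where
  "left_spine \<epsilon> f\<^sub>p f\<^sub>m p q T \<longleftrightarrow>
     p < q \<and> continuous_on {p..q} T \<and> T C1_differentiable_on {p<..<q} \<and>
     (\<forall>u\<in>{p<..<q}. \<bar>T u\<bar> < \<epsilon> \<and> \<bar>deriv T u\<bar> < 1) \<and>
     integral_curve (herringbone_field \<epsilon> f\<^sub>p f\<^sub>m) ((\<lambda>u. (u - \<epsilon>, T u)) ` {p<..<q})"

definition herringbone_domain :: "real \<Rightarrow> real \<Rightarrow> real \<Rightarrow> (real \<Rightarrow> real) \<Rightarrow> (real \<times> real) set" where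
  "herringbone_domain \<epsilon> p q T =
     (\<Union>u\<in>{p..q}. closed_segment (u, T u) (u + T u - \<epsilon>, \<epsilon>) \<union>
                   closed_segment (u, T u) (u - T u - \<epsilon>, -\<epsilon>))"

definition spine_value ::
  "real \<Rightarrow> (real \<Rightarrow> real) \<Rightarrow> (real \<Rightarrow> real) \<Rightarrow> real \<Rightarrow> real \<Rightarrow> real" where
  "spine_value \<epsilon> f\<^sub>p f\<^sub>m u T =
     (\<epsilon>\<^sup>2 - T\<^sup>2) / (2 * \<epsilon> * T) *
       ((\<epsilon> + T) * deriv f\<^sub>p (u + T - \<epsilon>) - (\<epsilon> - T) * deriv f\<^sub>m (u - T - \<epsilon>)) +
     ((\<epsilon> + T) * f\<^sub>p (u + T - \<epsilon>) + (\<epsilon> - T) * f\<^sub>m (u - T - \<epsilon>)) / (2 * \<epsilon>)"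

text \<open>The spine formula is singular at $T = 0$; at isolated zeros of \<open>T\<close> the value of \<open>B\<close> is
  its limit along the spine, which is already forced by the continuity of \<open>B\<close>.\<close>

definition left_herringbone_candidate ::
  "real \<Rightarrow> (real \<Rightarrow> real) \<Rightarrow> (real \<Rightarrow> real) \<Rightarrow> real \<Rightarrow> real \<Rightarrow> (real \<Rightarrow> real) \<Rightarrow>
   (real \<times> real \<Rightarrow> real) \<Rightarrow> bool" where
  "left_herringbone_candidate \<epsilon> f\<^sub>p f\<^sub>m p q T B \<longleftrightarrow>
     left_spine \<epsilon> f\<^sub>p f\<^sub>m p q T \<and>
     C1_smooth_on (herringbone_domain \<epsilon> p q T) B \<and>
     diagonally_concave_on (herringbone_domain \<epsilon> p q T) B \<and>
     boundary_values \<epsilon> f\<^sub>p f\<^sub>m (herringbone_domain \<epsilon> p q T) B \<and>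
     (\<forall>u\<in>{p..q}. affine_on_segment B (u, T u) (u + T u - \<epsilon>, \<epsilon>) \<and>
                  affine_on_segment B (u, T u) (u - T u - \<epsilon>, -\<epsilon>)) \<and>
     (\<forall>u\<in>{p..q}. T u \<noteq> 0 \<longrightarrow> B (u, T u) = spine_value \<epsilon> f\<^sub>p f\<^sub>m u (T u))"

end

theory Submission
  imports Defs "HOL-Complex_Analysis.Great_Picard"
begin

text \<open>In the coordinates \<open>y = x\<^sub>1 + x\<^sub>2\<close>, \<open>z = x\<^sub>1 - x\<^sub>2\<close> the spine equation reads
  $(\varepsilon - T) D_- \, dz = (\varepsilon + T) D_+ \, dy$, and along its solutions the slopes of the
  upper and lower ribs have the derivatives $\mp (f_+' - f_-') / (2T)$ in \<open>y\<close> and \<open>z\<close>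
  respectively. Hence the affine pieces fit together to a $C^1$ function, whose second derivatives in
  the diagonal directions are, up to a factor 4,
  $-D_+ (x_2 - T) / (\varepsilon - T)$ above the spine and $-D_- (T - x_2) / (\varepsilon + T)$ below it.

  Since $\partial_e D_-(v, -e) = \partial_v D_-(v, -e) - D_+(v, -e) / e$, the function
  $D_-(\cdot, -\varepsilon)$ becomes negative between two roots \<open>u\<^sub>l\<close>, \<open>u\<^sub>r\<close> close to \<open>u\<^sub>0\<close> once
  $\varepsilon > \varepsilon_0$. Two multiples of $-D_-(\cdot, -\varepsilon)$ are a lower and an upper
  barrier for the height $T + \varepsilon$ of the spine above the bottom of the strip; both vanish at
  \<open>u\<^sub>l\<close> and \<open>u\<^sub>r\<close>, and a Peano solution squeezed between them is the required spine.\<close>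

section \<open>Derivatives on the line and concavity on segments\<close>

text \<open>The obstacle sits at the two ends of the spine. There \<open>D_minus\<close> and the
  height above the bottom vanish together, so the spine equation solved for the slope reads 0/0.
  Existence is therefore proved for right-hand sides that are bounded but continuous only on the
  open interval. Here the right-hand side is (X - Y) / (X + Y) with X, Y > 0: this gives the bound 1
  and also |T'| < 1, which keeps the ribs from crossing. Lifting the spine off the bottom is what
  restores concavity: at depth \<epsilon> the function \<open>D_minus\<close> is negative between
  the roots, but it grows at a rate close to \<beta> > 0 as the depth decreases, and the lower
  barrier is already high enough for it to be positive. Extended by the constant -\<epsilon>, the
  spine may have corners at its two ends. This is why monotonicity and differentiability are derived
  from derivatives known off finitely many points only.\<close>

lemma deriv_nonpos_off_finite_imp_le:
  fixes h :: "real \<Rightarrow> real"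
  assumes "finite K" "a \<le> b" "continuous_on {a..b} h"
    and "\<And>x. x \<in> {a<..<b} - K \<Longrightarrow> \<exists>D\<le>0. (h has_real_derivative D) (at x)"
  shows "h b \<le> h a"
proof -
  have der: "(h has_real_derivative deriv h x) (at x) \<and> deriv h x \<le> 0" if "x \<in> {a<..<b} - K" for x
    using assms(4)[OF that] DERIV_imp_deriv by fastforce
  let ?h' = "\<lambda>x. if x \<in> {a<..<b} - K then deriv h x else 0"
  \<comment> \<open>The increment of \<open>h\<close> is the integral of its derivative; the default
    0 at the exceptional points does not affect the integral.\<close>
  have "(?h' has_integral (h b - h a)) {a..b}"
    using assms der by (intro fundamental_theorem_of_calculus_interior_strong[of K])
      (auto simp flip: has_real_derivative_iff_has_vector_derivative)
  then have "h b - h a \<le> 0"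
    by (rule has_integral_le[OF _ has_integral_0]) (use der in auto)
  then show ?thesis by simp
qed

lemma deriv_nonneg_off_finite_imp_le:
  fixes h :: "real \<Rightarrow> real"
  assumes "finite K" "a \<le> b" "continuous_on {a..b} h"
    and "\<And>x. x \<in> {a<..<b} - K \<Longrightarrow> \<exists>D\<ge>0. (h has_real_derivative D) (at x)"
  shows "h a \<le> h b"
proof -
  have "\<exists>D\<le>0. ((\<lambda>x. - h x) has_real_derivative D) (at x)" if x: "x \<in> {a<..<b} - K" for x
  proof -
    obtain D where "D \<ge> 0" "(h has_real_derivative D) (at x)" using assms(4)[OF x] by blast
    then show ?thesis using DERIV_minus[of h D x] by (intro exI[of _ "- D"]) auto
  qed
  then show ?thesis
    using deriv_nonpos_off_finite_imp_le[of K a b "\<lambda>x. - h x"] assms(1-3)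
    by (auto intro!: continuous_intros)
qed

text \<open>Equal values at two points would make the nondecreasing function constant between them,
  with derivative 0 at some point outside the finite set.\<close>

lemma deriv_pos_off_finite_imp_strict_mono:
  fixes h :: "real \<Rightarrow> real"
  assumes K: "finite K" and cont: "continuous_on UNIV h"
    and der: "\<And>x. x \<notin> K \<Longrightarrow> \<exists>D>0. (h has_real_derivative D) (at x)"
  shows "strict_mono h"
proof -
  have le: "h a \<le> h b" if "a \<le> b" for a b
  proof (rule deriv_nonneg_off_finite_imp_le[OF K that])
    show "\<exists>D\<ge>0. (h has_real_derivative D) (at x)" if "x \<in> {a<..<b} - K" for x
      using der[of x] that by (auto intro: less_imp_le)
  qed (use cont in \<open>auto intro: continuous_on_subset\<close>)
  have "h a \<noteq> h b" if "a < b" for a b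
  proof
    assume eq: "h a = h b"
    have "infinite {a<..<b}" using that by (simp add: infinite_Ioo)
    then obtain x where x: "x \<in> {a<..<b}" "x \<notin> K"
      using K by (meson finite_subset subsetI)
    have "\<forall>\<^sub>F t in nhds x. t \<in> {a<..<b}"
      using x by (intro eventually_nhds_in_open) auto
    moreover have "h t = h a" if "t \<in> {a<..<b}" for t
      using le[of a t] le[of t b] eq that by auto
    ultimately have "\<forall>\<^sub>F t in nhds x. h t = h a" by (auto elim: eventually_mono)
    then have "(h has_real_derivative 0) (at x)"
      by (simp add: DERIV_cong_ev)
    then show False using der[OF x(2)] DERIV_unique by blast
  qed
  then show ?thesis using le by (auto simp: strict_mono_def less_le)
qed

text \<open>\<open>h\<close> is an integral of the continuous \<open>h'\<close>, so the formula for
  the derivative extends to the exceptional points. This carries the rib slopes across the corners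
  of the spine.\<close>

lemma deriv_within_of_deriv_off_finite:
  fixes h h' :: "real \<Rightarrow> real"
  assumes "finite K" "continuous_on {a..b} h" "continuous_on {a..b} h'"
    and der: "\<And>x. x \<in> {a<..<b} - K \<Longrightarrow> (h has_real_derivative h' x) (at x)"
    and x: "x \<in> {a..b}"
  shows "(h has_real_derivative h' x) (at x within {a..b})"
proof -
  have int: "(h' has_integral (h t - h a)) {a..t}" if "t \<in> {a..b}" for t
    using assms that
    by (intro fundamental_theorem_of_calculus_interior_strong[of K])
      (auto simp flip: has_real_derivative_iff_has_vector_derivative
        intro: continuous_on_subset)
  have "((\<lambda>t. h a + integral {a..t} h') has_real_derivative h' x) (at x within {a..b})"
    using integral_has_real_derivative[OF assms(3) x]
    by (auto intro!: derivative_eq_intros)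
  then show ?thesis
    by (rule has_field_derivative_transform_within[of _ _ _ _ 1])
      (use x int[THEN integral_unique] in auto)
qed

text \<open>By the mean value theorem the chord slopes on the two sides of an intermediate point are
  values of \<open>g'\<close>, and these are ordered.\<close>

lemma concave_on_closed_segment_of_antimono_deriv:
  fixes x y :: "'a :: real_vector" and F :: "'a \<Rightarrow> real" and g' :: "real \<Rightarrow> real"
  assumes cont: "continuous_on {0..1} (\<lambda>t. F (x + t *\<^sub>R (y - x)))"
    and der: "\<And>t. t \<in> {0<..<1} \<Longrightarrow> ((\<lambda>t. F (x + t *\<^sub>R (y - x))) has_real_derivative g' t) (at t)"
    and anti: "\<And>s t. 0 < s \<Longrightarrow> s \<le> t \<Longrightarrow> t < 1 \<Longrightarrow> g' t \<le> g' s"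
  shows "concave_on (closed_segment x y) F"
proof -
  define g where "g = (\<lambda>t. F (x + t *\<^sub>R (y - x)))"
  have key: "(1 - l) * g s + l * g t \<le> g ((1 - l) * s + l * t)"
    if st: "0 \<le> s" "s < t" "t \<le> 1" and l: "0 < l" "l < 1" for s t l
  proof -
    define c where "c = (1 - l) * s + l * t"
    have cs: "c - s = l * (t - s)" and tc: "t - c = (1 - l) * (t - s)"
      by (auto simp: c_def algebra_simps)
    have "0 < c - s" "0 < t - c" unfolding cs tc using that by simp_all
    then have "s < c" "c < t" by simp_all
    obtain p where p: "s < p" "p < c" "g c - g s = (c - s) * g' p"
    proof -
      have "\<exists>p\<in>{s<..<c}. g c - g s = (\<lambda>h. g' p * h) (c - s)"
      proof (rule mvt)
        show "continuous_on {s..c} g"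
          unfolding g_def by (rule continuous_on_subset[OF cont]) (use \<open>s < c\<close> \<open>c < t\<close> st in auto)
      qed (use \<open>s < c\<close> \<open>c < t\<close> st der in \<open>auto simp: g_def has_field_derivative_def\<close>)
      then obtain r where "r \<in> {s<..<c}" "g c - g s = g' r * (c - s)" by blast
      then show ?thesis using that by (auto simp: mult.commute)
    qed
    obtain q where q: "c < q" "q < t" "g t - g c = (t - c) * g' q"
    proof -
      have "\<exists>p\<in>{c<..<t}. g t - g c = (\<lambda>h. g' p * h) (t - c)"
      proof (rule mvt)
        show "continuous_on {c..t} g"
          unfolding g_def by (rule continuous_on_subset[OF cont]) (use \<open>s < c\<close> \<open>c < t\<close> st in auto)
      qed (use \<open>s < c\<close> \<open>c < t\<close> st der in \<open>auto simp: g_def has_field_derivative_def\<close>)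
      then obtain r where "r \<in> {c<..<t}" "g t - g c = g' r * (t - c)" by blast
      then show ?thesis using that by (auto simp: mult.commute)
    qed
    have "g' q \<le> g' p" using p(1,2) q(1,2) st by (intro anti) auto
    \<comment> \<open>This factor turns both derivatives into weighted increments, since
      \<open>c - s = l * (t - s)\<close> and \<open>t - c = (1 - l) * (t - s)\<close>.\<close>
    then have "l * (1 - l) * (t - s) * g' q \<le> l * (1 - l) * (t - s) * g' p"
      using l st by (intro mult_left_mono) auto
    then have "l * (g t - g c) \<le> (1 - l) * (g c - g s)"
      unfolding p(3) q(3) cs tc by (simp add: mult_ac)
    then have "(1 - l) * g s + l * g t \<le> g c" by (simp add: algebra_simps)
    then show ?thesis by (simp only: c_def)
  qed
  have key': "(1 - l) * g s + l * g t \<le> g ((1 - l) * s + l * t)"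
    if "s \<in> {0..1}" "t \<in> {0..1}" "0 < l" "l < 1" for s t l
  proof -
    consider "s < t" | "t < s" | "s = t" by linarith
    then show ?thesis
    proof cases
      case 2
      then show ?thesis using key[of t s "1 - l"] that by (simp add: add.commute)
    qed (use key[of s t l] that in \<open>auto simp: algebra_simps\<close>)
  qed
  have seg: "\<exists>s\<in>{0..1}. v = x + s *\<^sub>R (y - x)" if "v \<in> closed_segment x y" for v
    using that by (auto simp: in_segment algebra_simps)
  show ?thesis
    unfolding concave_on_iff
  proof (intro conjI ballI allI impI)
    fix v w and a b :: real
    assume v: "v \<in> closed_segment x y" and w: "w \<in> closed_segment x y"
      and ab: "0 \<le> a" "0 \<le> b" "a + b = 1"
    obtain s t where st: "s \<in> {0..1}" "t \<in> {0..1}" "v = x + s *\<^sub>R (y - x)" "w = x + t *\<^sub>R (y - x)"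
      using seg v w by metis
    have a: "a = 1 - b" using ab by simp
    have eq: "a *\<^sub>R v + b *\<^sub>R w = x + ((1 - b) * s + b * t) *\<^sub>R (y - x)"
      unfolding st a by (simp add: algebra_simps)
    show "a * F v + b * F w \<le> F (a *\<^sub>R v + b *\<^sub>R w)"
    proof (cases "b = 0 \<or> b = 1")
      case True
      then show ?thesis using a by auto
    next
      case False
      then show ?thesis
        unfolding eq using key'[OF st(1,2), of b] ab st(3,4) by (simp add: g_def a)
    qed
  qed simp
qed

text \<open>One orientation of \<open>v\<close> suffices: for \<open>c < 0\<close> the segment is
  run through backwards, which reverses the order of its points and the sign of the derivative
  together.\<close>

lemma concave_on_closed_segment_of_antimono_directional_deriv:
  fixes F :: "'a :: real_inner \<Rightarrow> real"
  assumes der: "\<And>x. x \<in> S \<Longrightarrow> (F has_derivative (\<lambda>h. G x \<bullet> h)) (at x within S)"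
    and anti: "\<And>x r. x \<in> S \<Longrightarrow> 0 \<le> r \<Longrightarrow> x + r *\<^sub>R v \<in> S \<Longrightarrow> G (x + r *\<^sub>R v) \<bullet> v \<le> G x \<bullet> v"
    and seg: "closed_segment x y \<subseteq> S" and dir: "y - x = c *\<^sub>R v"
  shows "concave_on (closed_segment x y) F"
proof (rule concave_on_closed_segment_of_antimono_deriv)
  define l where "l t = x + t *\<^sub>R (y - x)" for t
  have l_in: "l t \<in> S" if "t \<in> {0..1}" for t
  proof -
    have "l t = (1 - t) *\<^sub>R x + t *\<^sub>R y" by (simp add: l_def algebra_simps)
    then show ?thesis using seg that by (force simp: in_segment)
  qed
  have l_der: "(l has_derivative (\<lambda>h. h *\<^sub>R (y - x))) (at t within A)" for t A
    unfolding l_def[abs_def] by (auto intro!: derivative_eq_intros)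
  have Fl: "((\<lambda>t. F (l t)) has_derivative (\<lambda>h. h * (c * (G (l t) \<bullet> v)))) (at t within {0..1})"
    if "t \<in> {0..1}" for t
  proof -
    have "(F has_derivative (\<lambda>h. G (l t) \<bullet> h)) (at (l t) within l ` {0..1})"
      using der[OF l_in[OF that]] l_in by (rule_tac has_derivative_subset) auto
    from has_derivative_in_compose[OF l_der this] show ?thesis by (simp add: dir mult.assoc)
  qed
  then show "continuous_on {0..1} (\<lambda>t. F (x + t *\<^sub>R (y - x)))"
    unfolding l_def by (intro has_derivative_continuous_on)
  show "((\<lambda>t. F (x + t *\<^sub>R (y - x))) has_real_derivative c * (G (l t) \<bullet> v)) (at t)"
    if "t \<in> {0<..<1}" for t
    using Fl[of t] that at_within_interior[of t "{0..1::real}"]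
    by (auto simp: has_field_derivative_def l_def mult_ac elim!: has_derivative_eq_rhs)
  show "c * (G (l t) \<bullet> v) \<le> c * (G (l s) \<bullet> v)" if "0 < s" "s \<le> t" "t < 1" for s t
  proof (cases "c \<ge> 0")
    case True
    have "l t = l s + ((t - s) * c) *\<^sub>R v" by (simp add: l_def dir algebra_simps)
    then have "G (l t) \<bullet> v \<le> G (l s) \<bullet> v"
      using anti[of "l s" "(t - s) * c"] l_in[of s] l_in[of t] that True by simp
    then show ?thesis using True by (rule mult_left_mono)
  next
    case False
    have "l s = l t + ((t - s) * (- c)) *\<^sub>R v" by (simp add: l_def dir algebra_simps)
    then have "G (l s) \<bullet> v \<le> G (l t) \<bullet> v"
      using anti[of "l t" "(t - s) * (- c)"] l_in[of s] l_in[of t] that False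
      by (simp add: mult_nonneg_nonpos)
    then show ?thesis using False by (simp add: mult_left_mono_neg)
  qed
qed

lemma has_derivative_within_Un:
  fixes f :: "'a :: real_normed_vector \<Rightarrow> 'b :: real_normed_vector"
  assumes "(f has_derivative f') (at x within S)" "(f has_derivative f') (at x within T)"
  shows "(f has_derivative f') (at x within (S \<union> T))"
  using assms unfolding has_derivative_within by (simp add: Lim_within_Un)

text \<open>Off a closed set the filter \<open>at x within S\<close> is trivial. In a union of two
  closed pieces, a piece that misses the point thus imposes no condition.\<close>

lemma has_derivative_within_notin_closed:
  fixes f :: "'a :: real_normed_vector \<Rightarrow> 'b :: real_normed_vector"
  assumes "closed S" "x \<notin> S" "bounded_linear f'"
  shows "(f has_derivative f') (at x within S)"
proof -
  have "at x within S = bot"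
    using assms closed_limpt trivial_limit_within by blast
  then show ?thesis using assms by (simp add: has_derivative_def)
qed

text \<open>The value \<open>y\<close> lies between those of \<open>h\<close> at
  \<open>y - C\<close> and \<open>y + C\<close>, so the intermediate value theorem gives
  surjectivity. Meant for the maps from the spine parameter to the rib ends.\<close>

lemma strict_mono_near_identity:
  fixes h :: "real \<Rightarrow> real"
  assumes mono: "strict_mono h" and cont: "continuous_on UNIV h"
    and near: "\<And>x. \<bar>h x - x\<bar> \<le> C"
  shows "bij h" "continuous_on UNIV (inv h)"
proof -
  have "\<exists>x. h x = y" for y
  proof -
    have "\<exists>x\<ge>y - C. x \<le> y + C \<and> h x = y"
    proof (rule IVT')
      show "continuous_on {y - C..y + C} h" by (rule continuous_on_subset[OF cont]) simp
    qed (use near[of "y - C"] near[of "y + C"] in auto)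
    then show ?thesis by blast
  qed
  then show bij: "bij h"
    using strict_mono_imp_inj_on[OF mono] unfolding bij_def surj_def by metis
  have "isCont (inv h) y" for y
  proof -
    have "isCont (inv h) (h (inv h y))"
      by (rule isCont_inverse_function[of 1])
        (use bij cont in \<open>auto simp: bij_is_inj continuous_on_eq_continuous_at\<close>)
    then show ?thesis using bij by (simp add: bij_is_surj surj_f_inv_f)
  qed
  then show "continuous_on UNIV (inv h)"
    by (simp add: continuous_at_imp_continuous_on)
qed

lemma DERIV_inv_bij:
  fixes h :: "real \<Rightarrow> real"
  assumes "bij h" "continuous_on UNIV (inv h)" "(h has_real_derivative D) (at x)" "D \<noteq> 0"
  shows "(inv h has_real_derivative inverse D) (at (h x))"
  using assms
  by (intro DERIV_inverse_function[where f = h and a = "h x - 1" and b = "h x + 1"])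
    (auto simp: bij_is_inj bij_is_surj surj_f_inv_f continuous_on_eq_continuous_at)


section \<open>Gluing along a spine\<close>

text \<open>Along the graph the field is \<open>\<phi> u\<close> times the tangent, so an
  antiderivative \<open>\<tau>\<close> of \<open>1 / \<phi>\<close> is the time at which the
  trajectory passes over \<open>u\<close>, and its inverse \<open>h\<close> parametrises the
  trajectory. As \<open>\<phi>\<close> is negative, the graph is traversed from right to
  left.\<close>

lemma integral_curve_graph:
  fixes T T' \<phi> :: "real \<Rightarrow> real"
  assumes pq: "p < q" and T: "\<And>u. u \<in> {p<..<q} \<Longrightarrow> (T has_real_derivative T' u) (at u)"
    and \<phi>: "continuous_on {p<..<q} \<phi>" "\<And>u. u \<in> {p<..<q} \<Longrightarrow> \<phi> u < 0"
    and F: "\<And>u. u \<in> {p<..<q} \<Longrightarrow> F (u - c, T u) = \<phi> u *\<^sub>R (1, T' u)"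
  shows "integral_curve F ((\<lambda>u. (u - c, T u)) ` {p<..<q})"
proof -
  have "isCont (\<lambda>u. 1 / \<phi> u) u" if "u \<in> {p<..<q}" for u
  proof -
    have "isCont \<phi> u" using \<phi>(1) that by (simp add: continuous_on_eq_continuous_at)
    moreover have "\<phi> u \<noteq> 0" using \<phi>(2)[OF that] by simp
    ultimately show ?thesis by (intro continuous_intros)
  qed
  then obtain \<tau> where "\<forall>u. ereal p < ereal u \<longrightarrow> ereal u < ereal q \<longrightarrow> (\<tau> has_vector_derivative 1 / \<phi> u) (at u)"
    using einterval_antiderivative[of "ereal p" "ereal q" "\<lambda>u. 1 / \<phi> u"] pq by auto
  then have \<tau>: "(\<tau> has_real_derivative 1 / \<phi> u) (at u)" if "u \<in> {p<..<q}" for u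
    using that by (simp add: has_real_derivative_iff_has_vector_derivative)
  have dec: "\<tau> v < \<tau> u" if "p < u" "u < v" "v < q" for u v
  proof (rule DERIV_neg_imp_decreasing[OF that(2)])
    fix x assume "u \<le> x" "x \<le> v"
    then have "x \<in> {p<..<q}" using that by simp
    then show "\<exists>y. (\<tau> has_real_derivative y) (at x) \<and> y < 0"
      using \<tau> \<phi>(2) by (intro exI[of _ "1 / \<phi> x"]) simp
  qed
  have inj: "inj_on \<tau> {p<..<q}"
    by (rule linorder_inj_onI) (use dec in force)+
  have cont: "continuous_on {p<..<q} \<tau>"
    using \<tau> by (intro continuous_at_imp_continuous_on ballI DERIV_isCont)
  define h where "h = the_inv_into {p<..<q} \<tau>"
  have h: "h (\<tau> u) = u" if "u \<in> {p<..<q}" for u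
    unfolding h_def by (rule the_inv_into_f_f[OF inj that])
  define I where "I = \<tau> ` {p<..<q}"
  have I_open: "open I"
    unfolding I_def by (rule invariance_of_domain[OF cont _ inj]) simp
  have I_int: "is_interval I"
    unfolding I_def is_interval_connected_1
    by (intro connected_continuous_image[OF cont]) simp
  have h_deriv: "(h has_real_derivative \<phi> u) (at (\<tau> u))" if u: "u \<in> {p<..<q}" for u
  proof -
    obtain d where d: "d > 0" "ball (\<tau> u) d \<subseteq> I"
      using I_open u unfolding I_def open_contains_ball by blast
    have "(h has_real_derivative inverse (1 / \<phi> u)) (at (\<tau> u))"
    proof (rule DERIV_inverse_function[of \<tau> _ _ _ "\<tau> u - d" "\<tau> u + d"])
      show "(\<tau> has_real_derivative 1 / \<phi> u) (at (h (\<tau> u)))" using \<tau>[OF u] h[OF u] by simp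
      show "1 / \<phi> u \<noteq> 0" using \<phi>(2)[OF u] by simp
      show "\<tau> (h y) = y" if "\<tau> u - d < y" "y < \<tau> u + d" for y
      proof -
        have "y \<in> I" using that d by (auto simp: ball_def dist_real_def)
        then show ?thesis using h unfolding I_def by auto
      qed
      show "isCont h (\<tau> u)"
      proof (rule isCont_inverse_function2[of "(p + u) / 2" u "(u + q) / 2"])
        fix z assume "(p + u) / 2 \<le> z" "z \<le> (u + q) / 2"
        then have z: "z \<in> {p<..<q}" using u by auto
        show "h (\<tau> z) = z" by (rule h[OF z])
        show "isCont \<tau> z" by (rule DERIV_isCont[OF \<tau>[OF z]])
      qed (use u in auto)
    qed (use d in auto)
    then show ?thesis by simp
  qed
  define \<gamma> where "\<gamma> t = (h t - c, T (h t))" for t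
  have "(\<gamma> has_vector_derivative F (\<gamma> t)) (at t)" if "t \<in> I" for t
  proof -
    obtain u where u: "u \<in> {p<..<q}" "t = \<tau> u" using \<open>t \<in> I\<close> unfolding I_def by blast
    have ht: "h t = u" using h u by simp
    have h': "(h has_real_derivative \<phi> u) (at t)" using h_deriv u by simp
    have "((\<lambda>t. h t - c) has_vector_derivative \<phi> u) (at t)"
      using h' by (auto intro!: derivative_eq_intros
        simp flip: has_real_derivative_iff_has_vector_derivative)
    moreover have "((\<lambda>t. T (h t)) has_vector_derivative T' u * \<phi> u) (at t)"
      using DERIV_chain2[OF _ h', of T "T' u"] T[OF u(1)] ht
      by (simp add: has_real_derivative_iff_has_vector_derivative)
    ultimately have "(\<gamma> has_vector_derivative (\<phi> u, T' u * \<phi> u)) (at t)"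
      unfolding \<gamma>_def[abs_def] by (rule has_vector_derivative_Pair)
    moreover have "F (\<gamma> t) = (\<phi> u, T' u * \<phi> u)"
      using F[OF u(1)] by (simp add: \<gamma>_def ht mult.commute)
    ultimately show ?thesis by simp
  qed
  moreover have "\<gamma> ` I = (\<lambda>u. (u - c, T u)) ` {p<..<q}"
    unfolding I_def image_image \<gamma>_def by (rule image_cong) (simp_all add: h)
  moreover have "I \<noteq> {}" using pq by (simp add: I_def)
  ultimately show ?thesis
    unfolding integral_curve_def using I_open I_int by blast
qed

text \<open>Here \<open>f\<close> and \<open>g\<close> are $f_+$ and $f_-$, and the spine is prolonged by \<open>T = -\<epsilon>\<close> on both
  sides of \<open>{p..q}\<close>, where its lower ribs degenerate to points. The simple candidates are in this
  way part of the herringbone. The upper rib of \<open>u\<close> ends at \<open>(yy u, \<epsilon>)\<close> and the lower one at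
  \<open>(zz u, -\<epsilon>)\<close>; \<open>Dp u\<close> and \<open>Dm u\<close> are $D_\pm$ at \<open>(u - \<epsilon>, T u)\<close>.\<close>

locale extended_spine =
  fixes \<epsilon> p q a b :: real and T T' f f' f'' g g' g'' :: "real \<Rightarrow> real"
  assumes eps: "\<epsilon> > 0" and pq: "a \<le> p" "p < q" "q \<le> b"
    and f: "\<And>x. (f has_real_derivative f' x) (at x)" "\<And>x. (f' has_real_derivative f'' x) (at x)"
    and g: "\<And>x. (g has_real_derivative g' x) (at x)" "\<And>x. (g' has_real_derivative g'' x) (at x)"
    and T_cont: "continuous_on UNIV T"
    and T_out: "\<And>u. u \<notin> {p<..<q} \<Longrightarrow> T u = -\<epsilon>"
    and T_in: "\<And>u. u \<in> {p<..<q} \<Longrightarrow> -\<epsilon> < T u \<and> T u < 0"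
    and T_deriv: "\<And>u. u \<in> {p<..<q} \<Longrightarrow> (T has_real_derivative T' u) (at u)"
    and T'_bound: "\<And>u. u \<in> {p<..<q} \<Longrightarrow> \<bar>T' u\<bar> < 1"
begin

definition yy where "yy u = u + T u - \<epsilon>"
definition zz where "zz u = u - T u - \<epsilon>"
definition Q where "Q u = (f' (yy u) - g' (zz u)) / (2 * T u)"
definition Dp where "Dp u = Q u - f'' (yy u)"
definition Dm where "Dm u = Q u - g'' (zz u)"

end

locale herringbone_spine = extended_spine +
  assumes ode: "\<And>u. u \<in> {p<..<q} \<Longrightarrow> (\<epsilon> - T u) * Dm u * (1 - T' u) = (\<epsilon> + T u) * Dp u * (1 + T' u)"
    and D_nonneg: "\<And>u. u \<in> {a..b} \<Longrightarrow> Dp u \<ge> 0 \<and> Dm u \<ge> 0"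
begin

text \<open>Derivative of the extended spine. At \<open>p\<close> and \<open>q\<close> the value 0
  is a mere default, since \<open>T\<close> may have corners there; the lemmas on derivatives
  exclude these two points.\<close>

definition "T1 u = (if u \<in> {p<..<q} then T' u else 0)"

lemma T1_in: "u \<in> {p<..<q} \<Longrightarrow> T1 u = T' u"
  and T1_out: "u \<notin> {p<..<q} \<Longrightarrow> T1 u = 0"
  by (auto simp: T1_def)

lemma T_bounds: "-\<epsilon> \<le> T u" "T u < 0"
  using T_in[of u] T_out[of u] eps by (cases "u \<in> {p<..<q}"; auto)+

lemma T_has_deriv:
  assumes "u \<notin> {p, q}"
  shows "(T has_real_derivative T1 u) (at u)"
proof (cases "u \<in> {p<..<q}")
  case True
  then show ?thesis using T_deriv by (simp add: T1_def)
next
  case False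
  have "\<forall>\<^sub>F v in nhds u. v \<in> - {p..q}"
    using False assms by (intro eventually_nhds_in_open) auto
  then have "\<forall>\<^sub>F v in nhds u. T v = -\<epsilon>"
    by eventually_elim (auto intro: T_out)
  then show ?thesis using False by (simp add: T1_def DERIV_cong_ev del: greaterThanLessThan_iff)
qed

lemma T1_bound: "\<bar>T1 u\<bar> < 1"
  using T'_bound[of u] by (auto simp: T1_def)

section \<open>The rib ends as coordinates along the boundary\<close>

lemma yy_deriv: "u \<notin> {p, q} \<Longrightarrow> (yy has_real_derivative 1 + T1 u) (at u)"
  and zz_deriv: "u \<notin> {p, q} \<Longrightarrow> (zz has_real_derivative 1 - T1 u) (at u)"
  unfolding yy_def[abs_def] zz_def[abs_def]
  by (auto intro!: derivative_eq_intros T_has_deriv)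

lemma yy_cont: "continuous_on A yy" and zz_cont: "continuous_on A zz"
  unfolding yy_def[abs_def] zz_def[abs_def]
  by (auto intro!: continuous_intros continuous_on_subset[OF T_cont])

lemma T_cont': "continuous_on A T"
  using T_cont by (rule continuous_on_subset) simp

text \<open>Both rib ends move to the right with the spine parameter because |T'| < 1; ribs of the
  same kind do not cross.\<close>

lemma yy_mono: "strict_mono yy" and zz_mono: "strict_mono zz"
proof -
  have "1 + T1 u > 0" "1 - T1 u > 0" for u using T1_bound[of u] by linarith+
  then show "strict_mono yy" "strict_mono zz"
    using yy_deriv zz_deriv yy_cont zz_cont
    by (blast intro!: deriv_pos_off_finite_imp_strict_mono[of "{p, q}"])+
qed

lemma yy_near: "\<bar>yy u - u\<bar> \<le> 2 * \<epsilon>" and zz_near: "\<bar>zz u - u\<bar> \<le> 2 * \<epsilon>"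
  using T_bounds[of u] by (auto simp: yy_def zz_def)

lemmas yy_inv = strict_mono_near_identity[OF yy_mono yy_cont yy_near]
lemmas zz_inv = strict_mono_near_identity[OF zz_mono zz_cont zz_near]

definition "uy = inv yy"
definition "uz = inv zz"

lemma yy_uy [simp]: "yy (uy s) = s" and uy_yy [simp]: "uy (yy u) = u"
  and zz_uz [simp]: "zz (uz s) = s" and uz_zz [simp]: "uz (zz u) = u"
  using yy_inv(1) zz_inv(1) by (auto simp: uy_def uz_def bij_is_inj bij_is_surj surj_f_inv_f)

lemma uy_cont: "continuous_on A uy" and uz_cont: "continuous_on A uz"
  unfolding uy_def uz_def
  by (rule continuous_on_subset[OF yy_inv(2)] continuous_on_subset[OF zz_inv(2)]; simp)+

lemma uy_le_iff: "uy s \<le> u \<longleftrightarrow> s \<le> yy u" and le_uy_iff: "u \<le> uy s \<longleftrightarrow> yy u \<le> s"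
  and uz_le_iff: "uz s \<le> u \<longleftrightarrow> s \<le> zz u" and le_uz_iff: "u \<le> uz s \<longleftrightarrow> zz u \<le> s"
  using strict_mono_less_eq[OF yy_mono] strict_mono_less_eq[OF zz_mono]
  by (metis yy_uy zz_uz)+

lemma uz_less_iff: "uz s < u \<longleftrightarrow> s < zz u" and less_uz_iff: "u < uz s \<longleftrightarrow> zz u < s"
  using strict_mono_less[OF zz_mono] by (metis zz_uz)+

lemma uy_deriv:
  assumes "uy s \<notin> {p, q}"
  shows "(uy has_real_derivative inverse (1 + T1 (uy s))) (at s)"
proof -
  have "1 + T1 (uy s) \<noteq> 0" using T1_bound[of "uy s"] by auto
  then show ?thesis
    using DERIV_inv_bij[OF yy_inv(1,2) yy_deriv[OF assms]] by (simp add: uy_def[symmetric])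
qed

lemma uz_deriv:
  assumes "uz s \<notin> {p, q}"
  shows "(uz has_real_derivative inverse (1 - T1 (uz s))) (at s)"
proof -
  have "1 - T1 (uz s) \<noteq> 0" using T1_bound[of "uz s"] by auto
  then show ?thesis
    using DERIV_inv_bij[OF zz_inv(1,2) zz_deriv[OF assms]] by (simp add: uz_def[symmetric])
qed

lemma T_out_closed: "u \<le> p \<or> q \<le> u \<Longrightarrow> T u = -\<epsilon>"
  by (rule T_out) auto

lemma yy_out: "u \<le> p \<or> q \<le> u \<Longrightarrow> yy u = u - 2 * \<epsilon>"
  and zz_out: "u \<le> p \<or> q \<le> u \<Longrightarrow> zz u = u"
  using T_out_closed[of u] by (auto simp: yy_def zz_def)

lemma f_conts: "continuous_on A f" "continuous_on A f'" "continuous_on A g" "continuous_on A g'"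
  using f g by (auto intro!: continuous_at_imp_continuous_on DERIV_isCont)

lemma f_conts':
  assumes "continuous_on A h"
  shows "continuous_on A (\<lambda>x. f (h x))" "continuous_on A (\<lambda>x. f' (h x))"
    "continuous_on A (\<lambda>x. g (h x))" "continuous_on A (\<lambda>x. g' (h x))"
  by (rule continuous_on_compose2[OF _ assms, of UNIV], rule f_conts, simp)+

lemma T_nz [simp]: "T u \<noteq> 0" using T_bounds(2)[of u] by simp

lemma Q_cont: "continuous_on A Q"
  unfolding Q_def[abs_def]
  by (intro continuous_intros f_conts' T_cont' yy_cont zz_cont) auto

text \<open>The slopes of the upper and of the lower rib through the spine point with parameter
  \<open>u\<close> (with respect to \<open>x\<^sub>2\<close>), as forced by the prescribed value at the spine.\<close>

definition upper_slope where
  "upper_slope u = (f (yy u) - g (zz u)) / (2 * \<epsilon>)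
     - (\<epsilon> + T u) / (2 * \<epsilon>) * (2 * \<epsilon> * Q u + f' (yy u) + g' (zz u))"

definition lower_slope where
  "lower_slope u = upper_slope u + (2 * \<epsilon> * Q u + f' (yy u) + g' (zz u))"

lemma slope_conts: "continuous_on A upper_slope" "continuous_on A lower_slope"
  unfolding upper_slope_def[abs_def] lower_slope_def[abs_def]
  using eps by (auto intro!: continuous_intros f_conts' T_cont' yy_cont zz_cont Q_cont)

lemma f_yy_deriv:
  assumes "u \<notin> {p, q}"
  shows "((\<lambda>u. f (yy u)) has_real_derivative f' (yy u) * (1 + T1 u)) (at u)"
    "((\<lambda>u. f' (yy u)) has_real_derivative f'' (yy u) * (1 + T1 u)) (at u)"
    "((\<lambda>u. g (zz u)) has_real_derivative g' (zz u) * (1 - T1 u)) (at u)"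
    "((\<lambda>u. g' (zz u)) has_real_derivative g'' (zz u) * (1 - T1 u)) (at u)"
  using DERIV_chain2[OF f(1) yy_deriv[OF assms]] DERIV_chain2[OF f(2) yy_deriv[OF assms]]
    DERIV_chain2[OF g(1) zz_deriv[OF assms]] DERIV_chain2[OF g(2) zz_deriv[OF assms]] by auto

text \<open>Differentiate \<open>2 * T u * Q u = f' (yy u) - g' (zz u)\<close> and write the second
  derivatives as \<open>Q - Dp\<close> and \<open>Q - Dm\<close>; the terms with \<open>Q\<close>
  cancel.\<close>

lemma Q_deriv:
  assumes "u \<notin> {p, q}"
  shows "(Q has_real_derivative (Dm u * (1 - T1 u) - Dp u * (1 + T1 u)) / (2 * T u)) (at u)"
proof -
  let ?S = "f' (yy u) - g' (zz u)"
  have S: "?S = 2 * T u * Q u" by (simp add: Q_def)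
  show ?thesis
    unfolding Q_def[abs_def]
    by (rule derivative_eq_intros f_yy_deriv T_has_deriv assms | simp)+
      (simp add: S Dp_def Dm_def field_simps)
qed

text \<open>The spine equation eliminates \<open>Dm\<close>. Divided by \<open>1 + T1 u\<close>,
  this is the derivative of \<open>Q\<close> along the upper boundary in terms of \<open>Dp\<close>
  alone; \<open>Q'_z\<close> is the counterpart for the lower boundary and
  \<open>Dm\<close>.\<close>

lemma Q'_y:
  assumes "u \<in> {p<..<q}"
  shows "(Dm u * (1 - T1 u) - Dp u * (1 + T1 u)) / (2 * T u) = Dp u / (\<epsilon> - T u) * (1 + T1 u)"
proof -
  have nz: "\<epsilon> - T u \<noteq> 0" using T_bounds(2)[of u] eps by simp
  have "(\<epsilon> - T u) * (Dm u * (1 - T1 u) - Dp u * (1 + T1 u)) = Dp u * (1 + T1 u) * (2 * T u)"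
    using ode[OF assms] unfolding T1_in[OF assms] by (simp add: algebra_simps)
  with nz show ?thesis by (simp add: field_simps)
qed

lemma Q'_z:
  assumes "u \<in> {p<..<q}"
  shows "(Dm u * (1 - T1 u) - Dp u * (1 + T1 u)) / (2 * T u) = Dm u / (\<epsilon> + T u) * (1 - T1 u)"
proof -
  have nz: "\<epsilon> + T u \<noteq> 0" using T_in[OF assms] by simp
  have "(\<epsilon> + T u) * (Dm u * (1 - T1 u) - Dp u * (1 + T1 u)) = Dm u * (1 - T1 u) * (2 * T u)"
    using ode[OF assms] unfolding T1_in[OF assms] by (simp add: algebra_simps)
  with nz show ?thesis by (simp add: field_simps)
qed

text \<open>Along the spine the differential equation for \<open>T\<close> decouples the two slopes.\<close>

lemma upper_slope_deriv:
  assumes "u \<notin> {p, q}"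
  shows "(upper_slope has_real_derivative - Q u * (1 + T1 u)) (at u)"
proof -
  let ?Q' = "(Dm u * (1 - T1 u) - Dp u * (1 + T1 u)) / (2 * T u)"
  define J' where "J' = 2 * \<epsilon> * ?Q' + f'' (yy u) * (1 + T1 u) + g'' (zz u) * (1 - T1 u)"
  have S: "g' (zz u) = f' (yy u) - 2 * T u * Q u" by (simp add: Q_def)
  have J'_eq: "(\<epsilon> + T u) * J' = (\<epsilon> + T u) * (2 * Q u)"
  proof (cases "u \<in> {p<..<q}")
    case True
    have split: "2 * \<epsilon> * c = (\<epsilon> - T u) * c + (\<epsilon> + T u) * c" for c
      by (simp add: algebra_simps)
    have "J' = (\<epsilon> - T u) * ?Q' + (\<epsilon> + T u) * ?Q' + (f'' (yy u) * (1 + T1 u) + g'' (zz u) * (1 - T1 u))"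
      unfolding J'_def split by simp
    also have "(\<epsilon> - T u) * ?Q' = Dp u * (1 + T1 u)"
      unfolding Q'_y[OF True] using T_bounds(2)[of u] eps by (simp add: field_simps)
    also have "(\<epsilon> + T u) * ?Q' = Dm u * (1 - T1 u)"
      unfolding Q'_z[OF True] using T_in[OF True] by (simp add: field_simps)
    also have "Dp u * (1 + T1 u) + Dm u * (1 - T1 u) + (f'' (yy u) * (1 + T1 u) + g'' (zz u) * (1 - T1 u)) = 2 * Q u"
      by (simp add: Dp_def Dm_def algebra_simps)
    finally show ?thesis by simp
  qed (simp add: T_out)
  have N: "((\<lambda>u. f (yy u) - g (zz u)) has_real_derivative
      f' (yy u) * (1 + T1 u) - g' (zz u) * (1 - T1 u)) (at u)"
    by (rule derivative_intros f_yy_deriv assms)+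
  have W: "((\<lambda>u. \<epsilon> + T u) has_real_derivative T1 u) (at u)"
    using T_has_deriv[OF assms] by (auto intro!: derivative_eq_intros)
  have J: "((\<lambda>u. 2 * \<epsilon> * Q u + f' (yy u) + g' (zz u)) has_real_derivative J') (at u)"
    unfolding J'_def by (rule derivative_intros DERIV_cmult f_yy_deriv Q_deriv assms)+
  have "(upper_slope has_real_derivative
      (f' (yy u) * (1 + T1 u) - g' (zz u) * (1 - T1 u)) / (2 * \<epsilon>)
      - (T1 u / (2 * \<epsilon>) * (2 * \<epsilon> * Q u + f' (yy u) + g' (zz u)) + (\<epsilon> + T u) * J' / (2 * \<epsilon>))) (at u)"
    unfolding upper_slope_def[abs_def]
    using DERIV_diff[OF DERIV_cdivide[OF N, of "2 * \<epsilon>"] DERIV_mult[OF DERIV_cdivide[OF W, of "2 * \<epsilon>"] J]]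
    by (simp add: mult_ac)
  then show ?thesis
    unfolding J'_eq by (rule DERIV_cong) (use eps in \<open>simp add: S field_simps\<close>)
qed

lemma lower_slope_deriv:
  assumes "u \<in> {p<..<q}"
  shows "(lower_slope has_real_derivative Q u * (1 - T1 u)) (at u)"
proof -
  let ?Q' = "(Dm u * (1 - T1 u) - Dp u * (1 + T1 u)) / (2 * T u)"
  have u: "u \<notin> {p, q}" using assms by auto
  have "2 * \<epsilon> * c = (\<epsilon> - T u) * c + (\<epsilon> + T u) * c" for c
    by (simp add: algebra_simps)
  then have "2 * \<epsilon> * ?Q' = (\<epsilon> - T u) * ?Q' + (\<epsilon> + T u) * ?Q'" .
  also have "(\<epsilon> - T u) * ?Q' = Dp u * (1 + T1 u)"
    unfolding Q'_y[OF assms] using T_bounds(2)[of u] eps by (simp add: field_simps)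
  also have "(\<epsilon> + T u) * ?Q' = Dm u * (1 - T1 u)"
    unfolding Q'_z[OF assms] using T_in[OF assms] by (simp add: field_simps)
  finally have *: "2 * \<epsilon> * ?Q' = Dp u * (1 + T1 u) + Dm u * (1 - T1 u)" .
  have "(lower_slope has_real_derivative
      - Q u * (1 + T1 u) + (2 * \<epsilon> * ?Q' + f'' (yy u) * (1 + T1 u) + g'' (zz u) * (1 - T1 u))) (at u)"
    unfolding lower_slope_def[abs_def]
    by (rule derivative_eq_intros f_yy_deriv Q_deriv upper_slope_deriv u | simp)+
  then show ?thesis
    unfolding * by (rule DERIV_cong) (simp add: Dp_def Dm_def algebra_simps)
qed

text \<open>Together with \<open>spine_gap'\<close> this matches the gradients on the spine: half of
  the gap is the derivative of the glued function in the first variable, computed from above here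
  and from below there.\<close>

lemma spine_gap: "lower_slope u - upper_slope u = 2 * (f' (yy u) + Q u * (\<epsilon> - T u))"
proof -
  have S: "g' (zz u) = f' (yy u) - 2 * T u * Q u" by (simp add: Q_def)
  show ?thesis by (simp add: lower_slope_def S algebra_simps)
qed

lemma spine_gap': "lower_slope u - upper_slope u = 2 * (g' (zz u) + Q u * (\<epsilon> + T u))"
proof -
  have S: "f' (yy u) = g' (zz u) + 2 * T u * Q u" by (simp add: Q_def)
  show ?thesis by (simp add: lower_slope_def S algebra_simps)
qed

lemma spine_match:
  "f (yy u) + upper_slope u * (T u - \<epsilon>) = g (zz u) + lower_slope u * (T u + \<epsilon>)"
  using eps by (simp add: lower_slope_def upper_slope_def field_simps)

text \<open>On an upper rib \<open>yc\<close> is constant, on a lower rib \<open>zc\<close>.\<close>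

definition yc :: "real \<times> real \<Rightarrow> real" where "yc x = fst x + snd x - \<epsilon>"
definition zc :: "real \<times> real \<Rightarrow> real" where "zc x = fst x - snd x - \<epsilon>"

definition "S = left_parallelogram \<epsilon> (a - \<epsilon>) (b - \<epsilon>)"
text \<open>On a line of constant \<open>yc\<close>, the coordinate \<open>zc\<close> decreases
  upwards, so this is the part on or above the spine. The bounds on \<open>uy (yc x)\<close> in
  \<open>S_low\<close> keep out the simple parts, so that \<open>uz (zc x)\<close> stays in
  \<open>{p..q}\<close>.\<close>

definition "S_up = {x \<in> S. zc x \<le> zz (uy (yc x))}"
definition "S_low = {x \<in> S. zz (uy (yc x)) \<le> zc x \<and> p \<le> uy (yc x) \<and> uy (yc x) \<le> q}"

definition B_up :: "real \<times> real \<Rightarrow> real" where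
  "B_up x = f (yc x) + upper_slope (uy (yc x)) * (snd x - \<epsilon>)"
definition B_low :: "real \<times> real \<Rightarrow> real" where
  "B_low x = g (zc x) + lower_slope (uz (zc x)) * (snd x + \<epsilon>)"
definition B :: "real \<times> real \<Rightarrow> real" where
  "B x = (if x \<in> S_up then B_up x else B_low x)"

text \<open>The derivative of the glued function in the first variable, above the spine. The second
  component of \<open>G_up\<close> adds \<open>upper_slope\<close>, the rate of change along the
  upper rib direction (-1, 1); \<open>G_low\<close> uses the direction (1, 1) of the lower
  ribs.\<close>

definition c_up where "c_up x = f' (yc x) + Q (uy (yc x)) * (\<epsilon> - snd x)"
definition c_low where "c_low x = g' (zc x) + Q (uz (zc x)) * (\<epsilon> + snd x)"

definition G_up :: "real \<times> real \<Rightarrow> real \<times> real" where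
  "G_up x = (c_up x, c_up x + upper_slope (uy (yc x)))"
definition G_low :: "real \<times> real \<Rightarrow> real \<times> real" where
  "G_low x = (c_low x, lower_slope (uz (zc x)) - c_low x)"
definition G :: "real \<times> real \<Rightarrow> real \<times> real" where
  "G x = (if x \<in> S_up then G_up x else G_low x)"

lemma snd_yc_zc: "snd x = (yc x - zc x) / 2"
  by (simp add: yc_def zc_def)

lemma T_eq: "T u = (yy u - zz u) / 2"
  by (simp add: yy_def zz_def)

lemma yy_a: "yy a = a - 2 * \<epsilon>" and yy_b: "yy b = b - 2 * \<epsilon>"
  using pq by (auto simp: yy_out)

lemma mem_S: "x \<in> S \<longleftrightarrow> yy a \<le> yc x \<and> yc x \<le> yy b \<and> \<bar>yc x - zc x\<bar> \<le> 2 * \<epsilon>"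
  unfolding S_def left_parallelogram_def yy_a yy_b by (auto simp: yc_def zc_def)

lemma mono_le_iff [simp]: "yy u \<le> yy v \<longleftrightarrow> u \<le> v" "zz u \<le> zz v \<longleftrightarrow> u \<le> v"
  using yy_mono zz_mono by (simp_all add: strict_mono_less_eq)

lemma yy_zz: "zz u \<le> yy u + 2 * \<epsilon>" "yy u - 2 * \<epsilon> \<le> zz u"
  using T_bounds[of u] eps by (auto simp: yy_def zz_def)

text \<open>Over the simple parts the spine runs along the bottom, so every point there counts as
  lying on or above it.\<close>

lemma S_cases: "S = S_up \<union> S_low"
proof -
  have "x \<in> S_up" if "x \<in> S" "uy (yc x) < p \<or> q < uy (yc x)" for x
    using that zz_out[of "uy (yc x)"] yy_out[of "uy (yc x)"] by (auto simp: S_up_def mem_S)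
  then show ?thesis by (fastforce simp: S_up_def S_low_def)
qed

lemma S_low_uz:
  assumes "x \<in> S_low"
  shows "uz (zc x) \<in> {p..q}" "uy (yc x) \<le> uz (zc x)"
proof -
  \<comment> \<open>Within the strip \<open>zc x \<le> yc x + 2 * \<epsilon>\<close>, and at
    \<open>q\<close> the spine touches the bottom, so
    \<open>zz q = yy q + 2 * \<epsilon>\<close>.\<close>
  have "zc x \<le> zz q" using assms pq zz_out[of q] yy_out[of q]
    by (auto simp: S_low_def mem_S uy_le_iff)
  moreover have "zz p \<le> zz (uy (yc x))" "zz (uy (yc x)) \<le> zc x" using assms by (simp_all add: S_low_def)
  then have "zz p \<le> zc x" by (rule order_trans)
  ultimately show "uz (zc x) \<in> {p..q}" "uy (yc x) \<le> uz (zc x)"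
    using assms by (auto simp: S_low_def uz_le_iff le_uz_iff)
qed

section \<open>Gluing the two pieces to a C1 function\<close>

lemma coord_conts: "continuous_on A yc" "continuous_on A zc"
  unfolding yc_def[abs_def] zc_def[abs_def] by (auto intro!: continuous_intros)

lemma uy_yc_cont: "continuous_on A (\<lambda>x. uy (yc x))"
  by (rule continuous_on_compose2[OF uy_cont[of UNIV] coord_conts(1)]) simp

lemma zz_uy_yc_cont: "continuous_on A (\<lambda>x. zz (uy (yc x)))"
  by (rule continuous_on_compose2[OF zz_cont[of UNIV] uy_yc_cont]) simp

lemma closed_S: "closed S"
proof -
  have "S = {x. yy a \<le> yc x} \<inter> {x. yc x \<le> yy b} \<inter> {x. \<bar>yc x - zc x\<bar> \<le> 2 * \<epsilon>}"
    by (auto simp: mem_S)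
  then show ?thesis
    by (auto intro!: closed_Int closed_Collect_le continuous_intros coord_conts)
qed

lemma closed_S_up: "closed S_up"
proof -
  have "S_up = S \<inter> {x. zc x \<le> zz (uy (yc x))}" by (auto simp: S_up_def)
  then show ?thesis
    by (auto intro!: closed_Int closed_S closed_Collect_le coord_conts zz_uy_yc_cont)
qed

lemma closed_S_low: "closed S_low"
proof -
  have "S_low = S \<inter> {x. zz (uy (yc x)) \<le> zc x} \<inter> {x. p \<le> uy (yc x)} \<inter> {x. uy (yc x) \<le> q}"
    by (auto simp: S_low_def)
  then show ?thesis
    by (auto intro!: closed_Int closed_S closed_Collect_le coord_conts zz_uy_yc_cont uy_yc_cont)
qed

lemma S_up_low:
  assumes "x \<in> S_up" "x \<in> S_low"
  shows "uz (zc x) = uy (yc x)" "snd x = T (uy (yc x))"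
proof -
  have "zc x = zz (uy (yc x))" using assms by (auto simp: S_up_def S_low_def)
  then show "uz (zc x) = uy (yc x)" "snd x = T (uy (yc x))"
    by (auto simp: snd_yc_zc T_eq)
qed

lemma B_agree: assumes "x \<in> S_up" "x \<in> S_low" shows "B_up x = B_low x"
proof -
  have "zc x = zz (uz (zc x))" "yc x = yy (uy (yc x))" by simp_all
  then show ?thesis
    using spine_match[of "uy (yc x)"] S_up_low[OF assms] by (simp add: B_up_def B_low_def)
qed

lemma G_agree: assumes "x \<in> S_up" "x \<in> S_low" shows "G_up x = G_low x"
proof -
  have "zc x = zz (uy (yc x))" using S_up_low[OF assms] by (metis zz_uz)
  then show ?thesis
    using spine_gap[of "uy (yc x)"] spine_gap'[of "uy (yc x)"] S_up_low[OF assms]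
    by (simp add: G_up_def G_low_def c_up_def c_low_def)
qed

text \<open>The factor \<open>1 + T1\<close> of the slope derivative cancels against that of the
  inverse map. What remains is continuous even where \<open>T\<close> has a corner.\<close>

lemma upper_slope_uy_deriv:
  assumes "uy s \<notin> {p, q}"
  shows "((\<lambda>s. upper_slope (uy s)) has_real_derivative - Q (uy s)) (at s)"
proof -
  have "1 + T1 (uy s) \<noteq> 0" using T1_bound[of "uy s"] by auto
  then show ?thesis
    using DERIV_chain2[OF upper_slope_deriv[OF assms] uy_deriv[OF assms]] by (simp add: mult.assoc)
qed

lemma lower_slope_uz_deriv:
  assumes "uz s \<in> {p<..<q}"
  shows "((\<lambda>s. lower_slope (uz s)) has_real_derivative Q (uz s)) (at s)"
proof -
  have "1 - T1 (uz s) \<noteq> 0" using T1_bound[of "uz s"] by auto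
  moreover have "uz s \<notin> {p, q}" using assms by auto
  ultimately show ?thesis
    using DERIV_chain2[OF lower_slope_deriv[OF assms] uz_deriv[of s]] by (simp add: mult.assoc)
qed

lemma slope_uy_cont: "continuous_on A (\<lambda>s. upper_slope (uy s))"
  and Q_uy_cont: "continuous_on A (\<lambda>s. Q (uy s))"
  and slope_uz_cont: "continuous_on A (\<lambda>s. lower_slope (uz s))"
  and Q_uz_cont: "continuous_on A (\<lambda>s. Q (uz s))"
  by (rule continuous_on_compose2[OF slope_conts(1)[of UNIV] uy_cont]
      continuous_on_compose2[OF slope_conts(2)[of UNIV] uz_cont]
      continuous_on_compose2[OF Q_cont[of UNIV] uy_cont]
      continuous_on_compose2[OF Q_cont[of UNIV] uz_cont]; simp)+

lemma upper_slope_within: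
  assumes "s \<in> {c..d}"
  shows "((\<lambda>s. upper_slope (uy s)) has_real_derivative - Q (uy s)) (at s within {c..d})"
proof (rule deriv_within_of_deriv_off_finite[of "{yy p, yy q}"])
  show "((\<lambda>s. upper_slope (uy s)) has_real_derivative - Q (uy s)) (at s)"
    if "s \<in> {c<..<d} - {yy p, yy q}" for s
    using that by (intro upper_slope_uy_deriv) auto
qed (use assms in \<open>auto intro!: continuous_intros slope_uy_cont Q_uy_cont\<close>)

lemma lower_slope_within:
  assumes "s \<in> {zz p..zz q}"
  shows "((\<lambda>s. lower_slope (uz s)) has_real_derivative Q (uz s)) (at s within {zz p..zz q})"
proof (rule deriv_within_of_deriv_off_finite[of "{}"])
  show "((\<lambda>s. lower_slope (uz s)) has_real_derivative Q (uz s)) (at s)"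
    if "s \<in> {zz p<..<zz q} - {}" for s
    using that by (intro lower_slope_uz_deriv) (auto simp: uz_less_iff less_uz_iff)
qed (use assms in \<open>auto intro!: slope_uz_cont Q_uz_cont\<close>)

lemma B_up_deriv:
  assumes "x \<in> S_up"
  shows "(B_up has_derivative (\<lambda>h. G_up x \<bullet> h)) (at x within S_up)"
proof -
  have yc: "(yc has_derivative (\<lambda>h. fst h + snd h)) (at x within S_up)"
    unfolding yc_def[abs_def] by (auto intro!: derivative_eq_intros)
  have "((\<lambda>s. upper_slope (uy s)) has_derivative (*) (- Q (uy (yc x)))) (at (yc x) within yc ` S_up)"
    using upper_slope_within[of "yc x" "yy a" "yy b"] assms
    unfolding has_field_derivative_def
    by (rule_tac has_derivative_subset[of _ _ _ "{yy a..yy b}"]) (auto simp: S_up_def mem_S)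
  from has_derivative_in_compose[OF yc this]
  have s: "((\<lambda>x. upper_slope (uy (yc x))) has_derivative (\<lambda>h. - Q (uy (yc x)) * (fst h + snd h)))
    (at x within S_up)" .
  have "(f has_derivative (*) (f' (yc x))) (at (yc x) within yc ` S_up)"
    using f(1)[of "yc x"] unfolding has_field_derivative_def
    by (rule has_derivative_at_withinI)
  from has_derivative_in_compose[OF yc this]
  have f: "((\<lambda>x. f (yc x)) has_derivative (\<lambda>h. f' (yc x) * (fst h + snd h))) (at x within S_up)" .
  show ?thesis
    unfolding B_up_def[abs_def]
    by (rule has_derivative_eq_rhs, (rule derivative_intros f s)+)
      (simp add: fun_eq_iff G_up_def c_up_def inner_prod_def algebra_simps)
qed

lemma B_low_deriv:
  assumes "x \<in> S_low"
  shows "(B_low has_derivative (\<lambda>h. G_low x \<bullet> h)) (at x within S_low)"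
proof -
  have zc: "(zc has_derivative (\<lambda>h. fst h - snd h)) (at x within S_low)"
    unfolding zc_def[abs_def] by (auto intro!: derivative_eq_intros)
  have in_zz: "zc x \<in> {zz p..zz q}" if "x \<in> S_low" for x
    using S_low_uz(1)[OF that] by (auto simp: uz_le_iff le_uz_iff)
  have "((\<lambda>s. lower_slope (uz s)) has_derivative (*) (Q (uz (zc x)))) (at (zc x) within zc ` S_low)"
    using lower_slope_within[OF in_zz[OF assms]] in_zz
    unfolding has_field_derivative_def
    by (rule_tac has_derivative_subset[of _ _ _ "{zz p..zz q}"]) blast+
  from has_derivative_in_compose[OF zc this]
  have s: "((\<lambda>x. lower_slope (uz (zc x))) has_derivative (\<lambda>h. Q (uz (zc x)) * (fst h - snd h)))
    (at x within S_low)" .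
  have "(g has_derivative (*) (g' (zc x))) (at (zc x) within zc ` S_low)"
    using g(1)[of "zc x"] unfolding has_field_derivative_def
    by (rule has_derivative_at_withinI)
  from has_derivative_in_compose[OF zc this]
  have g: "((\<lambda>x. g (zc x)) has_derivative (\<lambda>h. g' (zc x) * (fst h - snd h))) (at x within S_low)" .
  show ?thesis
    unfolding B_low_def[abs_def]
    by (rule has_derivative_eq_rhs, (rule derivative_intros g s)+)
      (simp add: fun_eq_iff G_low_def c_low_def inner_prod_def algebra_simps)
qed

lemma B_eq_low: "x \<in> S_low \<Longrightarrow> B x = B_low x"
  using B_agree[of x] by (auto simp: B_def)

lemma G_eq_low: "x \<in> S_low \<Longrightarrow> G x = G_low x"
  using G_agree[of x] by (auto simp: G_def)

text \<open>Both pieces are closed, so differentiability may be checked within each of them; on the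
  overlap the values and the gradients agree.\<close>

lemma B_deriv:
  assumes "x \<in> S"
  shows "(B has_derivative (\<lambda>h. G x \<bullet> h)) (at x within S)"
proof -
  have "(B has_derivative (\<lambda>h. G x \<bullet> h)) (at x within S_up)"
  proof (cases "x \<in> S_up")
    case True
    then show ?thesis
      using B_up_deriv[OF True]
      by (auto simp: G_def B_def intro: has_derivative_transform)
  qed (auto intro!: has_derivative_within_notin_closed closed_S_up bounded_linear_inner_right)
  moreover have "(B has_derivative (\<lambda>h. G x \<bullet> h)) (at x within S_low)"
  proof (cases "x \<in> S_low")
    case True
    then show ?thesis
      using B_low_deriv[OF True]
      by (auto simp: G_eq_low B_eq_low intro: has_derivative_transform)
  qed (auto intro!: has_derivative_within_notin_closed closed_S_low bounded_linear_inner_right)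
  ultimately show ?thesis
    unfolding S_cases by (rule has_derivative_within_Un)
qed

lemma G_cont: "continuous_on S G"
proof -
  have "continuous_on S_up G_up"
    unfolding G_up_def[abs_def] c_up_def
    by (intro continuous_intros continuous_on_compose2[OF slope_uy_cont[of UNIV] coord_conts(1)]
        continuous_on_compose2[OF Q_uy_cont[of UNIV] coord_conts(1)] f_conts' coord_conts) auto
  moreover have "continuous_on S_low G_low"
    unfolding G_low_def[abs_def] c_low_def
    by (intro continuous_intros continuous_on_compose2[OF slope_uz_cont[of UNIV] coord_conts(2)]
        continuous_on_compose2[OF Q_uz_cont[of UNIV] coord_conts(2)] f_conts' coord_conts) auto
  ultimately have "continuous_on (S_up \<union> S_low) (\<lambda>x. if x \<in> S_up then G_up x else G_low x)"
    by (intro continuous_on_cases closed_S_up closed_S_low) (auto simp: G_agree)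
  then show ?thesis by (simp add: S_cases G_def[abs_def])
qed

lemma B_C1: "A \<subseteq> S \<Longrightarrow> C1_smooth_on A B"
  unfolding C1_smooth_on_def
  using B_deriv G_cont by (blast intro: has_derivative_subset continuous_on_subset)

section \<open>Diagonal concavity of the glued function\<close>

lemma upper_concave_rate:
  assumes u: "u \<in> {a..b} - {p, q}" and x2: "T u \<le> x" "x \<le> \<epsilon>"
  shows "(Dm u * (1 - T1 u) - Dp u * (1 + T1 u)) / (2 * T u) / (1 + T1 u) * (\<epsilon> - x) \<le> Dp u"
proof (cases "u \<in> {p<..<q}")
  case True
  \<comment> \<open>By \<open>Q'_y\<close> the left-hand side is
    \<open>Dp u * (\<epsilon> - x) / (\<epsilon> - T u)\<close>, and the last quotient is at most 1
    above the spine.\<close>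
  have "1 + T1 u > 0" using T1_bound[of u] by linarith
  moreover have "\<epsilon> - T u > 0" using T_bounds(2)[of u] eps by simp
  moreover have "Dp u \<ge> 0" using D_nonneg u by auto
  ultimately show ?thesis
    unfolding Q'_y[OF True] using x2 by (simp add: divide_le_eq mult_left_mono)
next
  case False
  \<comment> \<open>With \<open>T u = -\<epsilon>\<close> the rate of \<open>Q\<close> is
    \<open>(Dp u - Dm u) / (2 * \<epsilon>)\<close>, so the claim becomes
    \<open>\<theta> * (Dp u - Dm u) \<le> Dp u\<close> with \<theta> between 0 and 1.\<close>
  define \<theta> where "\<theta> = (\<epsilon> - x) / (2 * \<epsilon>)"
  have \<theta>: "0 \<le> \<theta>" "\<theta> \<le> 1" using x2 eps False by (auto simp: \<theta>_def T_out)
  have "\<theta> * Dp u \<le> Dp u" "0 \<le> \<theta> * Dm u"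
    using \<theta> D_nonneg u by (auto intro: mult_left_le_one_le)
  then have "(Dp u - Dm u) * \<theta> \<le> Dp u" by (simp add: algebra_simps)
  moreover have "(Dm u * (1 - T1 u) - Dp u * (1 + T1 u)) / (2 * T u) / (1 + T1 u) * (\<epsilon> - x)
      = (Dp u - Dm u) * \<theta>"
    using False eps by (simp add: \<theta>_def T_out T1_out field_simps)
  ultimately show ?thesis by simp
qed

lemma lower_concave_rate:
  assumes u: "u \<in> {p<..<q}" and x2: "x \<le> T u"
  shows "(Dm u * (1 - T1 u) - Dp u * (1 + T1 u)) / (2 * T u) / (1 - T1 u) * (\<epsilon> + x) \<le> Dm u"
proof -
  have "1 - T1 u > 0" using T1_bound[of u] by linarith
  moreover have "\<epsilon> + T u > 0" using T_in[OF u] by simp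
  moreover have "Dm u \<ge> 0" using D_nonneg u pq by auto
  ultimately show ?thesis
    unfolding Q'_z[OF u] using x2 by (simp add: divide_le_eq mult_left_mono)
qed

text \<open>The derivative of the glued function along (1, 1) above the spine, at the point with
  \<open>yc = s\<close> and \<open>zc = \<zeta>\<close>. Its own derivative in \<open>s\<close> is
  \<open>2 * (Q' * (\<epsilon> - x) - Dp u)\<close> with \<open>x = (s - \<zeta>) / 2\<close> and
  \<open>Q'\<close> the rate of \<open>Q\<close> in \<open>s\<close>;
  \<open>upper_concave_rate\<close> gives its sign. \<open>H_low\<close> is the analogue along (1,
  -1) below the spine.\<close>

definition H_up where
  "H_up \<zeta> s = 2 * (f' s + Q (uy s) * (\<epsilon> - (s - \<zeta>) / 2)) + upper_slope (uy s)"

definition H_low where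
  "H_low \<eta> s = 2 * (g' s + Q (uz s) * (\<epsilon> + (\<eta> - s) / 2)) - lower_slope (uz s)"

lemma H_up_antimono:
  assumes "s \<le> t" "\<zeta> \<le> zz (uy s)" "yy a \<le> s" "t \<le> yy b" "t - \<zeta> \<le> 2 * \<epsilon>"
  shows "H_up \<zeta> t \<le> H_up \<zeta> s"
proof (rule deriv_nonpos_off_finite_imp_le[of "{yy p, yy q}" s t "H_up \<zeta>"])
  show "continuous_on {s..t} (H_up \<zeta>)"
    unfolding H_up_def[abs_def]
    by (intro continuous_intros f_conts slope_uy_cont Q_uy_cont) auto
next
  fix r assume r: "r \<in> {s<..<t} - {yy p, yy q}"
  define u where "u = uy r"
  define Q' where "Q' = (Dm u * (1 - T1 u) - Dp u * (1 + T1 u)) / (2 * T u) / (1 + T1 u)"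
  have u: "uy r \<notin> {p, q}" using r yy_uy[of r] by (metis DiffE insert_iff singletonD)
  have Q': "((\<lambda>s. Q (uy s)) has_real_derivative Q') (at r)"
    by (rule DERIV_cong[OF DERIV_chain2[OF Q_deriv[OF u] uy_deriv[OF u]]])
      (simp only: Q'_def u_def divide_inverse)
  have lin: "((\<lambda>s. \<epsilon> - (s - \<zeta>) / 2) has_real_derivative - 1 / 2) (at r)"
    by (auto intro!: derivative_eq_intros)
  have "(H_up \<zeta> has_real_derivative
      2 * (f'' r + (Q' * (\<epsilon> - (r - \<zeta>) / 2) + (- 1 / 2) * Q (uy r))) + - Q (uy r)) (at r)"
    unfolding H_up_def[abs_def]
    by (rule DERIV_add[OF DERIV_cmult[OF DERIV_add[OF f(2) DERIV_mult[OF Q' lin]]]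
          upper_slope_uy_deriv[OF u]])
  moreover have "Q' * (\<epsilon> - (r - \<zeta>) / 2) \<le> Dp u"
    unfolding Q'_def
  proof (rule upper_concave_rate)
    show "u \<in> {a..b} - {p, q}"
      using r assms u by (auto simp: u_def uy_le_iff le_uy_iff)
    \<comment> \<open>The starting point lies on or above the spine, and with \<zeta> fixed and
      \<open>uy\<close> increasing the line stays above it.\<close>
    have "\<zeta> \<le> zz u"
      using r assms(2) by (rule_tac order_trans[of _ "zz (uy s)"]) (auto simp: u_def uy_le_iff)
    then show "T u \<le> (r - \<zeta>) / 2" by (simp add: T_eq u_def)
    show "(r - \<zeta>) / 2 \<le> \<epsilon>" using r assms by auto
  qed
  ultimately show "\<exists>D\<le>0. (H_up \<zeta> has_real_derivative D) (at r)"
    by (intro exI[of _ "2 * (f'' r + (Q' * (\<epsilon> - (r - \<zeta>) / 2) + (- 1 / 2) * Q (uy r))) + - Q (uy r)"])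
      (simp add: Dp_def u_def)
qed (use assms in auto)

lemma H_low_antimono:
  assumes "s \<le> t" "\<eta> \<le> yy (uz s)" "zz p \<le> s" "t \<le> zz q"
  shows "H_low \<eta> t \<le> H_low \<eta> s"
proof (rule deriv_nonpos_off_finite_imp_le[of "{}" s t "H_low \<eta>"])
  show "continuous_on {s..t} (H_low \<eta>)"
    unfolding H_low_def[abs_def]
    by (intro continuous_intros f_conts slope_uz_cont Q_uz_cont) auto
next
  fix r assume r: "r \<in> {s<..<t} - {}"
  define u where "u = uz r"
  define Q' where "Q' = (Dm u * (1 - T1 u) - Dp u * (1 + T1 u)) / (2 * T u) / (1 - T1 u)"
  have u_in: "uz r \<in> {p<..<q}" using r assms by (auto simp: uz_less_iff less_uz_iff)
  then have u: "uz r \<notin> {p, q}" by auto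
  have Q': "((\<lambda>s. Q (uz s)) has_real_derivative Q') (at r)"
    by (rule DERIV_cong[OF DERIV_chain2[OF Q_deriv[OF u] uz_deriv[OF u]]])
      (simp only: Q'_def u_def divide_inverse)
  have lin: "((\<lambda>s. \<epsilon> + (\<eta> - s) / 2) has_real_derivative - 1 / 2) (at r)"
    by (auto intro!: derivative_eq_intros)
  have "(H_low \<eta> has_real_derivative
      2 * (g'' r + (Q' * (\<epsilon> + (\<eta> - r) / 2) + (- 1 / 2) * Q (uz r))) - Q (uz r)) (at r)"
    unfolding H_low_def[abs_def]
    by (rule DERIV_diff[OF DERIV_cmult[OF DERIV_add[OF g(2) DERIV_mult[OF Q' lin]]]
          lower_slope_uz_deriv[OF u_in]])
  moreover have "Q' * (\<epsilon> + (\<eta> - r) / 2) \<le> Dm u"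
    unfolding Q'_def
  proof (rule lower_concave_rate)
    show "u \<in> {p<..<q}" using u_in by (simp add: u_def)
    have "\<eta> \<le> yy u"
      using r assms(2) by (rule_tac order_trans[of _ "yy (uz s)"]) (auto simp: u_def uz_le_iff)
    then show "(\<eta> - r) / 2 \<le> T u" by (simp add: T_eq u_def)
  qed
  ultimately show "\<exists>D\<le>0. (H_low \<eta> has_real_derivative D) (at r)"
    by (intro exI[of _ "2 * (g'' r + (Q' * (\<epsilon> + (\<eta> - r) / 2) + (- 1 / 2) * Q (uz r))) - Q (uz r)"])
      (simp add: Dm_def u_def)
qed (use assms in auto)

lemma H_up_spine: "H_up (zz u) (yy u) = lower_slope u"
  using spine_gap[of u] T_eq[of u] by (simp add: H_up_def)

lemma H_low_spine: "H_low (yy u) (zz u) = - upper_slope u"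
  using spine_gap'[of u] T_eq[of u] by (simp add: H_low_def)

text \<open>Below the spine the direction (1, 1) is that of the lower ribs, above it (1, -1) is that
  of the upper ribs; along ribs the derivative is the rib slope up to sign, hence constant.\<close>

lemma G_diag1: "x \<in> S_up \<Longrightarrow> G x \<bullet> (1, 1) = H_up (zc x) (yc x)"
  "x \<notin> S_up \<Longrightarrow> G x \<bullet> (1, 1) = lower_slope (uz (zc x))"
  by (simp_all add: G_def G_up_def G_low_def c_up_def H_up_def snd_yc_zc[of x] inner_prod_def)

lemma G_diag2: "x \<in> S_up \<Longrightarrow> G x \<bullet> (1, -1) = - upper_slope (uy (yc x))"
  "x \<notin> S_up \<Longrightarrow> G x \<bullet> (1, -1) = H_low (yc x) (zc x)"
  by (simp_all add: G_def G_up_def G_low_def c_low_def H_low_def snd_yc_zc[of x] inner_prod_def)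

text \<open>A line in direction (1, 1) crosses the spine at most once, from below. It first follows
  a lower rib with constant derivative, then \<open>H_up\<close> decreases, and
  \<open>H_up_spine\<close> joins the two at the crossing.\<close>

lemma G_antimono1:
  assumes x: "x \<in> S" and r: "0 \<le> r" and x': "x + r *\<^sub>R (1, 1) \<in> S"
  shows "G (x + r *\<^sub>R (1, 1)) \<bullet> (1, 1) \<le> G x \<bullet> (1, 1)"
proof -
  let ?x' = "x + r *\<^sub>R (1, 1)"
  have yc': "yc ?x' = yc x + 2 * r" and zc': "zc ?x' = zc x"
    by (simp_all add: yc_def zc_def)
  have le: "uy (yc x) \<le> uy (yc ?x')" using r yc' by (simp add: uy_le_iff)
  consider "x \<in> S_up" "?x' \<in> S_up" | "x \<in> S_up" "?x' \<notin> S_up"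
    | "x \<notin> S_up" "?x' \<in> S_up" | "x \<notin> S_up" "?x' \<notin> S_up" by blast
  then show ?thesis
  proof cases
    case 1
    then show ?thesis
      unfolding G_diag1(1)[OF 1(1)] G_diag1(1)[OF 1(2)] zc'
      by (intro H_up_antimono) (use x' yc' zc' r in \<open>auto simp: S_up_def mem_S\<close>)
  next
    \<comment> \<open>Passing from above to below along (1, 1) is impossible: \<open>zc\<close> is
      fixed while \<open>uy (yc x)\<close> grows.\<close>
    case 2
    then have "zc x \<le> zz (uy (yc x))" by (simp add: S_up_def)
    also have "\<dots> \<le> zz (uy (yc ?x'))" using le by simp
    finally show ?thesis using 2 x' zc' by (simp add: S_up_def)
  next
    case 3
    define u where "u = uz (zc x)"
    have low: "x \<in> S_low" using 3 x S_cases by blast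
    have le1: "yc x \<le> yy u" using S_low_uz(2)[OF low] by (simp add: u_def uy_le_iff)
    have "zz u \<le> zz (uy (yc ?x'))" using 3 zc' by (simp add: u_def S_up_def)
    then have le2: "yy u \<le> yc ?x'" by (simp add: le_uy_iff)
    have "yy a \<le> yy u" using le1 x unfolding mem_S by linarith
    then have "H_up (zc x) (yc ?x') \<le> H_up (zc x) (yy u)"
      by (intro H_up_antimono)
        (use le1 le2 x x' yc' zc' r in \<open>auto simp: u_def mem_S\<close>)
    also have "H_up (zc x) (yy u) = lower_slope u" using H_up_spine[of u] by (simp add: u_def)
    finally show ?thesis
      using G_diag1(2)[OF 3(1)] G_diag1(1)[OF 3(2)] zc' by (simp add: u_def)
  next
    case 4
    show ?thesis
      unfolding G_diag1(2)[OF 4(1)] G_diag1(2)[OF 4(2)] zc' by simp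
  qed
qed

text \<open>Along (1, -1) the spine is crossed downwards: first an upper rib with constant
  derivative, then a decreasing \<open>H_low\<close>, joined by \<open>H_low_spine\<close>.\<close>

lemma G_antimono2:
  assumes x: "x \<in> S" and r: "0 \<le> r" and x': "x + r *\<^sub>R (1, -1) \<in> S"
  shows "G (x + r *\<^sub>R (1, -1)) \<bullet> (1, -1) \<le> G x \<bullet> (1, -1)"
proof -
  let ?x' = "x + r *\<^sub>R (1, -1)"
  have yc': "yc ?x' = yc x" and zc': "zc ?x' = zc x + 2 * r"
    by (simp_all add: yc_def zc_def)
  define u where "u = uy (yc x)"
  have low_le: "zc y \<le> zz q \<and> zz p \<le> zz (uy (yc y)) \<and> zz (uy (yc y)) \<le> zc y"
    if "y \<in> S" "y \<notin> S_up" for y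
  proof -
    have "y \<in> S_low" using that S_cases by blast
    then show ?thesis using S_low_uz[of y] by (auto simp: S_low_def uz_le_iff)
  qed
  consider "x \<in> S_up" "?x' \<in> S_up" | "x \<in> S_up" "?x' \<notin> S_up"
    | "x \<notin> S_up" "?x' \<in> S_up" | "x \<notin> S_up" "?x' \<notin> S_up" by blast
  then show ?thesis
  proof cases
    case 1
    show ?thesis
      unfolding G_diag2(1)[OF 1(1)] G_diag2(1)[OF 1(2)] yc' by simp
  next
    case 2
    have "H_low (yc x) (zc ?x') \<le> H_low (yc x) (zz u)"
      by (rule H_low_antimono) (use low_le[OF x' 2(2)] yc' in \<open>auto simp: u_def\<close>)
    also have "\<dots> = - upper_slope u" using H_low_spine[of u] by (simp add: u_def)
    finally show ?thesis
      using G_diag2(1)[OF 2(1)] G_diag2(2)[OF 2(2)] yc' by (simp add: u_def)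
  next
    case 3
    then show ?thesis using x yc' zc' r by (auto simp: S_up_def)
  next
    case 4
    have "H_low (yc x) (zc ?x') \<le> H_low (yc x) (zc x)"
    proof (rule H_low_antimono)
      show "yc x \<le> yy (uz (zc x))"
        using low_le[OF x 4(1)] by (simp flip: uy_le_iff add: le_uz_iff)
      show "zz p \<le> zc x" using low_le[OF x 4(1)] by linarith
    qed (use low_le[OF x' 4(2)] zc' r in auto)
    then show ?thesis
      unfolding G_diag2(2)[OF 4(1)] G_diag2(2)[OF 4(2)] yc' .
  qed
qed

lemma B_concave:
  assumes "A \<subseteq> S"
  shows "diagonally_concave_on A B"
  unfolding diagonally_concave_on_def
proof (intro allI impI)
  fix x y assume "closed_segment x y \<subseteq> A" "\<exists>t. y - x = t *\<^sub>R (1, 1) \<or> y - x = t *\<^sub>R (1, - 1)"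
  moreover from this(1) have "closed_segment x y \<subseteq> S" using assms by blast
  ultimately show "concave_on (closed_segment x y) B"
    using concave_on_closed_segment_of_antimono_directional_deriv[OF B_deriv G_antimono1]
      concave_on_closed_segment_of_antimono_directional_deriv[OF B_deriv G_antimono2]
    by metis
qed

lemma B_boundary:
  assumes "A \<subseteq> S"
  shows "boundary_values \<epsilon> f g A B"
  unfolding boundary_values_def
proof (intro allI conjI impI)
  fix x assume "(x, \<epsilon>) \<in> A"
  then have "(x, \<epsilon>) \<in> S_up"
    using assms yy_zz(2)[of "uy x"] by (auto simp: S_up_def yc_def zc_def)
  then show "B (x, \<epsilon>) = f x" by (simp add: B_def B_up_def yc_def)
next
  fix x assume "(x, -\<epsilon>) \<in> A"
  then have xS: "(x, -\<epsilon>) \<in> S" using assms by blast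
  have zx: "zz (uy (yc (x, -\<epsilon>))) \<le> zc (x, -\<epsilon>)"
    using yy_zz(1)[of "uy (yc (x, -\<epsilon>))"] by (simp add: yc_def zc_def)
  show "B (x, -\<epsilon>) = g x"
  proof (cases "(x, -\<epsilon>) \<in> S_up")
    case True
    define u where "u = uy (yc (x, -\<epsilon>))"
    have z: "zz u = x" using True zx by (auto simp: S_up_def u_def zc_def)
    have y: "yy u = x - 2 * \<epsilon>" by (simp add: u_def yc_def)
    have "T u = -\<epsilon>" using T_eq[of u] z y by simp
    then show ?thesis
      using True spine_match[of u] z y by (simp add: B_def B_up_def u_def[symmetric])
        (simp add: yc_def)
  qed (simp add: B_def B_low_def zc_def)
qed

text \<open>Where \<open>T u = -\<epsilon>\<close>, the upper rib spans the whole strip and its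
  slope reduces to the difference quotient of the boundary values at its ends.\<close>

lemma B_simple:
  assumes "a - \<epsilon> \<le> c" "d \<le> p - \<epsilon> \<or> q - \<epsilon> \<le> c" "d \<le> b - \<epsilon>"
  shows "left_simple_candidate \<epsilon> f g c d B"
proof -
  have sub: "left_parallelogram \<epsilon> c d \<subseteq> S"
    using assms by (auto simp: S_def left_parallelogram_def)
  have "B (x1, x2) = (\<epsilon> + x2) / (2 * \<epsilon>) * f (x1 + x2 - \<epsilon>) + (\<epsilon> - x2) / (2 * \<epsilon>) * g (x1 + x2 + \<epsilon>)"
    if "(x1, x2) \<in> left_parallelogram \<epsilon> c d" for x1 x2
  proof -
    define u where "u = uy (yc (x1, x2))"
    have yu: "yy u = x1 + x2 - \<epsilon>" by (simp add: u_def yc_def)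
    have "x1 + x2 - \<epsilon> \<le> p - 2 * \<epsilon> \<or> q - 2 * \<epsilon> \<le> x1 + x2 - \<epsilon>"
      using assms that by (auto simp: left_parallelogram_def)
    then have "yy u \<le> yy p \<or> yy q \<le> yy u"
      using yy_out[of p] yy_out[of q] yu by auto
    then have u: "u \<le> p \<or> q \<le> u" by simp
    have zu: "zz u = x1 + x2 + \<epsilon>" using yu yy_out[OF u] zz_out[OF u] by simp
    have up: "(x1, x2) \<in> S_up"
      using sub that zu by (auto simp: S_up_def u_def[symmetric] zc_def left_parallelogram_def)
    have "upper_slope u = (f (yy u) - g (zz u)) / (2 * \<epsilon>)"
      by (simp add: upper_slope_def T_out_closed[OF u])
    then show ?thesis
      using up eps by (simp add: B_def B_up_def u_def[symmetric] yu zu)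
        (simp add: yc_def field_simps)
  qed
  then show ?thesis
    unfolding left_simple_candidate_def using B_concave[OF sub] by auto
qed

section \<open>The ribs, the herringbone domain and the values on the spine\<close>

lemma spine_coords: "yc (u, T u) = yy u" "zc (u, T u) = zz u"
  by (simp_all add: yc_def zc_def yy_def zz_def)

text \<open>In the coordinates \<open>yc\<close> and \<open>zc\<close> a rib is a slice cut off at
  the spine, which turns questions about segments into inequalities.\<close>

lemma upper_rib:
  assumes u: "u \<in> {p..q}"
  shows "closed_segment (u, T u) (u + T u - \<epsilon>, \<epsilon>) = {x \<in> S. yc x = yy u \<and> zc x \<le> zz u}"
proof (intro set_eqI iffI)
  fix x assume "x \<in> closed_segment (u, T u) (u + T u - \<epsilon>, \<epsilon>)"
  then obtain t where t: "0 \<le> t" "t \<le> 1" and x: "x = (1 - t) *\<^sub>R (u, T u) + t *\<^sub>R (u + T u - \<epsilon>, \<epsilon>)"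
    unfolding in_segment by blast
  define X where "X = t * (2 * (\<epsilon> - T u))"
  have "0 \<le> X" "X \<le> 2 * (\<epsilon> - T u)"
    using t T_bounds[of u] eps unfolding X_def by (auto intro!: mult_left_le_one_le)
  moreover have y: "yc x = yy u" and z: "zc x = zz u - X"
    by (simp_all add: x X_def yc_def zc_def yy_def zz_def algebra_simps)
  moreover have "yy a \<le> yy u" "yy u \<le> yy b" using u pq by auto
  ultimately show "x \<in> {x \<in> S. yc x = yy u \<and> zc x \<le> zz u}"
    using y z T_eq[of u] yy_zz[of u] by (auto simp: mem_S abs_le_iff field_simps)
next
  fix x assume x: "x \<in> {x \<in> S. yc x = yy u \<and> zc x \<le> zz u}"
  define t where "t = (zz u - zc x) / (2 * (\<epsilon> - T u))"
  have pos: "\<epsilon> - T u > 0" using T_bounds[of u] eps by simp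
  have "0 \<le> t" "t \<le> 1"
    using x pos T_eq[of u] by (auto simp: t_def mem_S)
  moreover have "x = (1 - t) *\<^sub>R (u, T u) + t *\<^sub>R (u + T u - \<epsilon>, \<epsilon>)"
  proof -
    have "t * (2 * (\<epsilon> - T u)) = zz u - zc x" using pos by (simp add: t_def)
    moreover have "fst x + snd x = u + T u" using x by (auto simp: yc_def yy_def)
    ultimately show ?thesis
      by (cases x) (simp add: zz_def zc_def algebra_simps)
  qed
  ultimately show "x \<in> closed_segment (u, T u) (u + T u - \<epsilon>, \<epsilon>)"
    unfolding in_segment by blast
qed

lemma lower_rib:
  assumes u: "u \<in> {p..q}"
  shows "closed_segment (u, T u) (u - T u - \<epsilon>, -\<epsilon>) = {x \<in> S. zc x = zz u \<and> yc x \<le> yy u}"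
proof (cases "T u = -\<epsilon>")
  case True
  have "{x \<in> S. zc x = zz u \<and> yc x \<le> yy u} = {(u, T u)}"
  proof (intro set_eqI iffI)
    fix x assume "x \<in> {x \<in> S. zc x = zz u \<and> yc x \<le> yy u}"
    then have "zc x = zz u" "yc x = yy u" using T_eq[of u] True by (auto simp: mem_S)
    then show "x \<in> {(u, T u)}" by (cases x) (auto simp: yc_def zc_def yy_def zz_def)
  next
    fix x assume "x \<in> {(u, T u)}"
    moreover have "yy a \<le> yy u" "yy u \<le> yy b" using u pq by auto
    ultimately show "x \<in> {x \<in> S. zc x = zz u \<and> yc x \<le> yy u}"
      using yy_zz[of u] by (auto simp: mem_S spine_coords)
  qed
  then show ?thesis by (simp add: True)
next
  case False
  then have pos: "\<epsilon> + T u > 0" using T_bounds(1)[of u] by simp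
  show ?thesis
  proof (intro set_eqI iffI)
    fix x assume "x \<in> closed_segment (u, T u) (u - T u - \<epsilon>, -\<epsilon>)"
    then obtain t where t: "0 \<le> t" "t \<le> 1" and x: "x = (1 - t) *\<^sub>R (u, T u) + t *\<^sub>R (u - T u - \<epsilon>, -\<epsilon>)"
      unfolding in_segment by blast
    define X where "X = t * (2 * (\<epsilon> + T u))"
    have "0 \<le> X" "X \<le> 2 * (\<epsilon> + T u)"
      using t pos unfolding X_def by (auto intro!: mult_left_le_one_le)
    moreover have z: "zc x = zz u" and y: "yc x = yy u - X"
      by (simp_all add: x X_def yc_def zc_def yy_def zz_def algebra_simps)
    moreover have "2 * T u = yy u - zz u" using T_eq[of u] by simp
    ultimately have "zz u - 2 * \<epsilon> \<le> yc x" "yc x \<le> yy u"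
      by (simp_all del: mono_le_iff)
    moreover have "yy u \<le> yy b" "zz p \<le> zz u" using u pq by auto
    ultimately show "x \<in> {x \<in> S. zc x = zz u \<and> yc x \<le> yy u}"
      using z yy_zz[of u] zz_out[of p] pq unfolding mem_S yy_a
      by (auto simp del: mono_le_iff)
  next
    fix x assume x: "x \<in> {x \<in> S. zc x = zz u \<and> yc x \<le> yy u}"
    define t where "t = (yy u - yc x) / (2 * (\<epsilon> + T u))"
    have "yy u - yc x \<le> 2 * (\<epsilon> + T u)" using x T_eq[of u] by (auto simp: mem_S field_simps)
    then have "0 \<le> t" "t \<le> 1"
      using x pos by (auto simp: t_def)
    moreover have "x = (1 - t) *\<^sub>R (u, T u) + t *\<^sub>R (u - T u - \<epsilon>, -\<epsilon>)"
    proof -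
      have "t * (2 * (\<epsilon> + T u)) = yy u - yc x" using pos by (simp add: t_def)
      moreover have "fst x - snd x = u - T u" using x by (auto simp: zc_def zz_def)
      ultimately show ?thesis
        by (cases x) (simp add: yy_def yc_def algebra_simps)
    qed
    ultimately show "x \<in> closed_segment (u, T u) (u - T u - \<epsilon>, -\<epsilon>)"
      unfolding in_segment by blast
  qed
qed

text \<open>A point on or above the spine lies on the upper rib with parameter
  \<open>uy (yc x)\<close>, a point below it on the lower rib with parameter
  \<open>uz (zc x)\<close>.\<close>

lemma herringbone_domain_eq: "herringbone_domain \<epsilon> p q T = left_parallelogram \<epsilon> (p - \<epsilon>) (q - \<epsilon>)"
proof -
  have mem: "x \<in> left_parallelogram \<epsilon> (p - \<epsilon>) (q - \<epsilon>) \<longleftrightarrow> x \<in> S \<and> yy p \<le> yc x \<and> yc x \<le> yy q" for x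
    using pq yy_out[of p] yy_out[of q]
    by (cases x) (auto simp: left_parallelogram_def S_def yc_def)
  have dom: "x \<in> herringbone_domain \<epsilon> p q T \<longleftrightarrow>
      (\<exists>u\<in>{p..q}. x \<in> S \<and> (yc x = yy u \<and> zc x \<le> zz u \<or> zc x = zz u \<and> yc x \<le> yy u))" for x
    unfolding herringbone_domain_def UN_iff Un_iff by (rule bex_cong) (auto simp: upper_rib lower_rib)
  have "(\<exists>u\<in>{p..q}. x \<in> S \<and> (yc x = yy u \<and> zc x \<le> zz u \<or> zc x = zz u \<and> yc x \<le> yy u)) \<longleftrightarrow>
      x \<in> S \<and> yy p \<le> yc x \<and> yc x \<le> yy q" for x
  proof
    assume "\<exists>u\<in>{p..q}. x \<in> S \<and> (yc x = yy u \<and> zc x \<le> zz u \<or> zc x = zz u \<and> yc x \<le> yy u)"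
    then obtain u where u: "u \<in> {p..q}" and x: "x \<in> S"
      and *: "yc x = yy u \<and> zc x \<le> zz u \<or> zc x = zz u \<and> yc x \<le> yy u" by blast
    have "zz p \<le> zz u" "yy p \<le> yy u" "yy u \<le> yy q" using u by auto
    moreover have "zz p = yy p + 2 * \<epsilon>" using zz_out[of p] yy_out[of p] by simp
    moreover have "zc x \<le> yc x + 2 * \<epsilon>" using x by (auto simp: mem_S abs_le_iff)
    ultimately show "x \<in> S \<and> yy p \<le> yc x \<and> yc x \<le> yy q"
      using * x by linarith
  next
    assume x: "x \<in> S \<and> yy p \<le> yc x \<and> yc x \<le> yy q"
    show "\<exists>u\<in>{p..q}. x \<in> S \<and> (yc x = yy u \<and> zc x \<le> zz u \<or> zc x = zz u \<and> yc x \<le> yy u)"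
    proof (cases "zc x \<le> zz (uy (yc x))")
      case True
      moreover have "uy (yc x) \<in> {p..q}" using x by (simp add: uy_le_iff le_uy_iff)
      ultimately show ?thesis using x by (intro bexI[of _ "uy (yc x)"]) simp_all
    next
      case False
      then have "x \<in> S_low" using x by (auto simp: S_low_def uy_le_iff le_uy_iff)
      from S_low_uz[OF this] show ?thesis
        using x by (intro bexI[of _ "uz (zc x)"]) (simp_all add: uy_le_iff)
    qed
  qed
  then show ?thesis by (intro set_eqI) (simp only: dom mem)
qed

lemma affine_on_segmentI:
  assumes "\<And>z. z \<in> closed_segment x y \<Longrightarrow> F z = \<alpha> + \<beta> * snd z"
  shows "affine_on_segment F x y"
  unfolding affine_on_segment_def
proof
  fix t :: real assume "t \<in> {0..1}"
  then have "(1 - t) *\<^sub>R x + t *\<^sub>R y \<in> closed_segment x y" unfolding in_segment by auto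
  then show "F ((1 - t) *\<^sub>R x + t *\<^sub>R y) = (1 - t) * F x + t * F y"
    by (simp add: assms algebra_simps)
qed

lemma upper_rib_affine:
  assumes "u \<in> {p..q}"
  shows "affine_on_segment B (u, T u) (u + T u - \<epsilon>, \<epsilon>)"
proof (rule affine_on_segmentI)
  fix x assume "x \<in> closed_segment (u, T u) (u + T u - \<epsilon>, \<epsilon>)"
  then show "B x = (f (yy u) - upper_slope u * \<epsilon>) + upper_slope u * snd x"
    unfolding upper_rib[OF assms] by (auto simp: B_def B_up_def S_up_def algebra_simps)
qed

lemma lower_rib_affine:
  assumes "u \<in> {p..q}"
  shows "affine_on_segment B (u, T u) (u - T u - \<epsilon>, -\<epsilon>)"
proof (rule affine_on_segmentI)
  fix x assume x0: "x \<in> closed_segment (u, T u) (u - T u - \<epsilon>, -\<epsilon>)"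
  have x: "x \<in> S" "zc x = zz u" "yc x \<le> yy u" using x0 unfolding lower_rib[OF assms] by auto
  have "zz p \<le> zz u" using assms by simp
  then have "yy p \<le> yc x" using x zz_out[of p] yy_out[of p] by (auto simp: mem_S)
  moreover have "zz (uy (yc x)) \<le> zz u" using x(3) by (simp add: uy_le_iff)
  moreover have "yy u \<le> yy q" using assms by simp
  with x(3) have "uy (yc x) \<le> q" unfolding uy_le_iff by (rule order_trans)
  ultimately have "x \<in> S_low" using x by (auto simp: S_low_def le_uy_iff)
  then show "B x = (g (zz u) + lower_slope u * \<epsilon>) + lower_slope u * snd x"
    using x by (simp add: B_eq_low B_low_def algebra_simps)
qed

lemma B_spine_value:
  assumes u: "u \<in> {p..q}"
  shows "B (u, T u) = spine_value \<epsilon> f g u (T u)"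
proof -
  have "(u, T u) \<in> closed_segment (u, T u) (u + T u - \<epsilon>, \<epsilon>)" by simp
  then have "B (u, T u) = f (yy u) + upper_slope u * (T u - \<epsilon>)"
    unfolding upper_rib[OF u] by (auto simp: B_def B_up_def S_up_def spine_coords)
  moreover have "deriv f x = f' x" "deriv g x = g' x" for x
    using f g by (auto intro: DERIV_imp_deriv)
  \<comment> \<open>\<open>J\<close> is the gap between the two slopes. The bracket in the spine
    formula equals \<open>T u * J\<close>, which cancels the singular factor.\<close>
  moreover define J where "J = 2 * \<epsilon> * Q u + f' (yy u) + g' (zz u)"
  moreover have "(\<epsilon> + T u) * f' (yy u) - (\<epsilon> - T u) * g' (zz u) = T u * J"
    by (simp add: J_def Q_def field_simps)
  moreover have "(\<epsilon>\<^sup>2 - (T u)\<^sup>2) / (2 * \<epsilon> * T u) * (T u * J) = (\<epsilon>\<^sup>2 - (T u)\<^sup>2) / (2 * \<epsilon>) * J"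
    by simp
  ultimately have sv: "spine_value \<epsilon> f g u (T u) = (\<epsilon>\<^sup>2 - (T u)\<^sup>2) / (2 * \<epsilon>) * J
      + ((\<epsilon> + T u) * f (yy u) + (\<epsilon> - T u) * g (zz u)) / (2 * \<epsilon>)"
    and bv: "B (u, T u) = f (yy u) + ((f (yy u) - g (zz u)) / (2 * \<epsilon>) - (\<epsilon> + T u) / (2 * \<epsilon>) * J) * (T u - \<epsilon>)"
    unfolding spine_value_def upper_slope_def J_def[symmetric] yy_def[symmetric] zz_def[symmetric]
    by simp_all
  show ?thesis
    unfolding sv bv using eps by (simp add: field_simps power2_eq_square)
qed

lemma f_deriv_eq: "deriv f x = f' x" "deriv f' x = f'' x" "deriv g x = g' x" "deriv g' x = g'' x"
  using f g by (auto intro: DERIV_imp_deriv)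

lemma deriv_fun_eq: "deriv f = f'" "deriv g = g'"
  using f_deriv_eq by auto

text \<open>After \<open>f'' = Q - Dp\<close> and \<open>g'' = Q - Dm\<close> all terms with
  \<open>Q\<close> cancel. What is left are the two sides of the spine equation without the factors
  \<open>1 - T'\<close> and \<open>1 + T'\<close>, so the field is parallel to
  \<open>(1, T')\<close>.\<close>

lemma spine_speed: "herringbone_field \<epsilon> f g (u - \<epsilon>, T u) =
    (T u * ((\<epsilon> - T u) * Dm u + (\<epsilon> + T u) * Dp u), T u * ((\<epsilon> - T u) * Dm u - (\<epsilon> + T u) * Dp u))"
proof -
  have args: "u - \<epsilon> + T u = yy u" "u - \<epsilon> - T u = zz u" by (simp_all add: yy_def zz_def)
  have "g' (zz u) = f' (yy u) - 2 * T u * Q u" by (simp add: Q_def)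
  moreover have "f'' (yy u) = Q u - Dp u" "g'' (zz u) = Q u - Dm u" by (simp_all add: Dp_def Dm_def)
  ultimately show ?thesis
    unfolding herringbone_field_def Let_def prod.case args deriv_fun_eq f_deriv_eq
    by (simp only: prod.inject) (simp only: algebra_simps, simp)
qed

text \<open>Strict positivity of \<open>Dp\<close> on the open spine excludes stationary points of
  the field there. It allows the spine equation to be solved for \<open>T'\<close>, which is then
  continuous.\<close>

theorem herringbone_candidate:
  assumes Dp_pos: "\<And>u. u \<in> {p<..<q} \<Longrightarrow> Dp u > 0"
    and cont: "continuous_on UNIV f''" "continuous_on UNIV g''"
  shows "left_herringbone_candidate \<epsilon> f g p q T B"
proof -
  \<comment> \<open>\<open>T u * N u\<close> is the horizontal speed of the field along the spine,
    negative because \<open>T\<close> is.\<close>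
  define N where "N u = (\<epsilon> - T u) * Dm u + (\<epsilon> + T u) * Dp u" for u
  have N_pos: "N u > 0" if u: "u \<in> {p<..<q}" for u
  proof -
    have "(\<epsilon> - T u) * Dm u \<ge> 0" using T_bounds[of u] eps D_nonneg[of u] u pq by simp
    moreover have "(\<epsilon> + T u) * Dp u > 0" using T_in[OF u] Dp_pos[OF u] by simp
    ultimately show ?thesis by (simp add: N_def)
  qed
  have D_cont: "continuous_on A Dp" "continuous_on A Dm" for A
    unfolding Dp_def[abs_def] Dm_def[abs_def]
    by (intro continuous_on_diff Q_cont continuous_on_compose2[OF cont(1) yy_cont]
        continuous_on_compose2[OF cont(2) zz_cont]; simp)+
  have N_cont: "continuous_on A N" for A
    unfolding N_def[abs_def] by (intro continuous_intros D_cont T_cont')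
  have T'_eq: "T' u = ((\<epsilon> - T u) * Dm u - (\<epsilon> + T u) * Dp u) / N u" if u: "u \<in> {p<..<q}" for u
    using ode[OF u] N_pos[OF u] by (simp add: N_def field_simps)
  have "continuous_on {p<..<q} (\<lambda>u. ((\<epsilon> - T u) * Dm u - (\<epsilon> + T u) * Dp u) / N u)"
    by (intro continuous_intros D_cont T_cont' N_cont) (use N_pos in force)
  then have T'_cont: "continuous_on {p<..<q} T'"
    by (rule continuous_on_eq) (simp add: T'_eq)
  have C1: "T C1_differentiable_on {p<..<q}"
    unfolding C1_differentiable_on_def
  proof (intro exI conjI ballI)
    show "(T has_vector_derivative T' u) (at u)" if "u \<in> {p<..<q}" for u
      using T_deriv[OF that] by (simp only: has_real_derivative_iff_has_vector_derivative)
  qed (rule T'_cont)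
  have dT: "deriv T u = T' u" if "u \<in> {p<..<q}" for u
    using T_deriv[OF that] by (rule DERIV_imp_deriv)
  have curve: "integral_curve (herringbone_field \<epsilon> f g) ((\<lambda>u. (u - \<epsilon>, T u)) ` {p<..<q})"
  proof (rule integral_curve_graph[where \<phi> = "\<lambda>u. T u * N u" and T' = T'])
    show "T u * N u < 0" if "u \<in> {p<..<q}" for u
      using T_bounds(2) N_pos[OF that] by (simp add: mult_neg_pos)
    show "herringbone_field \<epsilon> f g (u - \<epsilon>, T u) = (T u * N u) *\<^sub>R (1, T' u)" if "u \<in> {p<..<q}" for u
      unfolding spine_speed T'_eq[OF that] using N_pos[OF that] by (simp add: N_def)
  qed (use pq T_deriv in \<open>auto intro!: continuous_intros T_cont' N_cont\<close>)
  have spine: "left_spine \<epsilon> f g p q T"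
    unfolding left_spine_def
  proof (intro conjI ballI)
    fix u assume u: "u \<in> {p<..<q}"
    show "\<bar>T u\<bar> < \<epsilon>" using T_in[OF u] by (simp add: abs_less_iff)
    show "\<bar>deriv T u\<bar> < 1" unfolding dT[OF u] by (rule T'_bound[OF u])
  qed (use pq C1 curve T_cont' in blast)+
  have sub: "left_parallelogram \<epsilon> (p - \<epsilon>) (q - \<epsilon>) \<subseteq> S"
    using pq by (auto simp: S_def left_parallelogram_def)
  show ?thesis
    unfolding left_herringbone_candidate_def herringbone_domain_eq
    using spine B_C1[OF sub] B_concave[OF sub] B_boundary[OF sub]
      upper_rib_affine lower_rib_affine B_spine_value by blast
qed

end


section \<open>Peano solutions between barriers\<close>

text \<open>The right-hand side of the spine equation is bounded but need not have limits at the
  ends; the two endpoints are null.\<close>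

lemma integrable_bounded_continuous_Ioo:
  fixes \<phi> :: "real \<Rightarrow> real"
  assumes cont: "continuous_on {a<..<b} \<phi>" and bound: "\<And>t. t \<in> {a<..<b} \<Longrightarrow> \<bar>\<phi> t\<bar> \<le> M"
    and sub: "{l..r} \<subseteq> {a..b}"
  shows "\<phi> integrable_on {l..r}"
proof -
  have "\<phi> integrable_on {a<..<b}"
  proof (rule measurable_bounded_by_integrable_imp_integrable)
    show "\<phi> \<in> borel_measurable (lebesgue_on {a<..<b})"
      by (rule continuous_imp_measurable_on_sets_lebesgue[OF cont]) simp
    show "(\<lambda>_. M) integrable_on {a<..<b}"
      using integrable_on_Icc_iff_Ioo[of "\<lambda>_. M" a b] by (simp add: integrable_const_ivl)
  qed (use bound in auto)
  then have "\<phi> integrable_on {a..b}" by (simp add: integrable_on_Icc_iff_Ioo)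
  then show ?thesis using sub by (rule integrable_on_subinterval)
qed

lemma integral_bound_Ioo:
  fixes \<phi> :: "real \<Rightarrow> real"
  assumes "\<phi> integrable_on {l..r}" "\<And>t. t \<in> {l..r} \<Longrightarrow> \<bar>\<phi> t\<bar> \<le> M" "l \<le> r"
  shows "\<bar>integral {l..r} \<phi>\<bar> \<le> M * (r - l)"
  using integral_norm_bound_integral[of \<phi> "{l..r}" "\<lambda>_. M"] assms
  by (simp add: integrable_const_ivl mult.commute)

text \<open>Equations with a delay \<open>h\<close> are solved by finitely many iterations; their solutions
  are equicontinuous, and letting \<open>h\<close> tend to 0 yields a solution of the equation proper.\<close>

lemma delay_equation_solution:
  fixes F :: "real \<Rightarrow> real \<Rightarrow> real"
  assumes ab: "a < b" and h: "h > 0" and M: "\<And>t x. \<bar>F t x\<bar> \<le> M"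
    and int: "\<And>x l r. continuous_on {a..b} x \<Longrightarrow> {l..r} \<subseteq> {a..b} \<Longrightarrow> (\<lambda>t. F t (x t)) integrable_on {l..r}"
  shows "\<exists>x. continuous_on {a..b} x \<and>
    (\<forall>t\<in>{a..b}. x t = c - integral {min b (t + h)..b} (\<lambda>s. F s (x s)))"
proof -
  \<comment> \<open>The value of \<open>\<Phi> x\<close> at \<open>t\<close> involves
    \<open>x\<close> only on \<open>[t + h, b]\<close>, so the iterates settle from the right end, a
    step of length \<open>h\<close> at a time.\<close>
  define \<Phi> where "\<Phi> x t = c - integral {min b (t + h)..b} (\<lambda>s. F s (x s))" for x :: "real \<Rightarrow> real" and t
  have cont: "continuous_on {a..b} (\<Phi> x)" if x: "continuous_on {a..b} x" for x
  proof -
    have "continuous_on {a..b} (\<lambda>r. integral {r..b} (\<lambda>s. F s (x s)))"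
      by (rule indefinite_integral_continuous_1') (rule int[OF x], simp)
    then have "continuous_on {a..b} (\<lambda>t. integral {min b (t + h)..b} (\<lambda>s. F s (x s)))"
      by (rule continuous_on_compose2) (use h ab in \<open>auto intro!: continuous_intros\<close>)
    then show ?thesis unfolding \<Phi>_def by (intro continuous_intros)
  qed
  define X where "X k = (\<Phi> ^^ k) (\<lambda>_. c)" for k
  have X_Suc: "X (Suc k) = \<Phi> (X k)" for k by (simp add: X_def)
  have X_cont: "continuous_on {a..b} (X k)" for k
    by (induction k) (auto simp: X_Suc cont, simp add: X_def)
  have stable: "X (Suc k) t = X k t" if "t \<in> {a..b}" "b - real k * h \<le> t" for k t
    using that
  proof (induction k arbitrary: t)
    case 0
    then show ?case using h by (simp add: X_def \<Phi>_def)
  next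
    case (Suc k)
    have "integral {min b (t + h)..b} (\<lambda>s. F s (X (Suc k) s)) = integral {min b (t + h)..b} (\<lambda>s. F s (X k s))"
    proof (rule integral_cong)
      fix s assume s: "s \<in> {min b (t + h)..b}"
      have "X (Suc k) s = X k s"
        using s Suc.prems h by (intro Suc.IH) (auto simp: algebra_simps min_def split: if_splits)
      then show "F s (X (Suc k) s) = F s (X k s)" by simp
    qed
    then show ?case unfolding X_Suc \<Phi>_def by simp
  qed
  obtain N :: nat where N: "b - a < real N * h" using h reals_Archimedean3 by blast
  have "X N t = \<Phi> (X N) t" if "t \<in> {a..b}" for t
    using stable[OF that, of N] N that by (simp add: X_Suc)
  then show ?thesis using X_cont[of N] unfolding \<Phi>_def by blast
qed

theorem peano_backward:
  fixes F :: "real \<Rightarrow> real \<Rightarrow> real"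
  assumes ab: "a < b" and cont: "continuous_on ({a<..<b} \<times> UNIV) (\<lambda>(t, x). F t x)"
    and bound: "\<And>t x. t \<in> {a<..<b} \<Longrightarrow> \<bar>F t x\<bar> \<le> M"
  obtains x where "continuous_on {a..b} x" "x b = c"
    "\<And>t. t \<in> {a<..<b} \<Longrightarrow> (x has_real_derivative F t (x t)) (at t)"
proof -
  \<comment> \<open>Redefining the field as 0 outside the open interval makes the bound global;
    integrals over subintervals do not notice the endpoints.\<close>
  define F' where "F' t x = (if t \<in> {a<..<b} then F t x else 0)" for t x
  have M0: "0 \<le> M" using bound[of "(a + b) / 2" 0] ab by auto
  have F'_bound: "\<bar>F' t x\<bar> \<le> M" for t x using bound M0 by (simp add: F'_def)
  have F'_cont: "continuous_on {a<..<b} (\<lambda>t. F' t (x t))" if "continuous_on {a..b} x" for x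
  proof -
    have "continuous_on {a<..<b} (\<lambda>t. (t, x t))"
      by (intro continuous_on_Pair continuous_on_id continuous_on_subset[OF that]) auto
    then have "continuous_on {a<..<b} (\<lambda>t. (\<lambda>(t, x). F t x) (t, x t))"
      by (rule continuous_on_compose2[OF cont]) auto
    then have "continuous_on {a<..<b} (\<lambda>t. F t (x t))" by simp
    then show ?thesis by (rule continuous_on_eq) (simp add: F'_def)
  qed
  have int: "(\<lambda>t. F' t (x t)) integrable_on {l..r}"
    if "continuous_on {a..b} x" "{l..r} \<subseteq> {a..b}" for x l r
    using F'_bound by (intro integrable_bounded_continuous_Ioo[OF F'_cont _ that(2), of x M] that)
  define h where "h n = 1 / real (Suc n)" for n
  have h: "h n > 0" for n by (simp add: h_def)
  have "\<forall>n. \<exists>x. continuous_on {a..b} x \<and>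
    (\<forall>t\<in>{a..b}. x t = c - integral {min b (t + h n)..b} (\<lambda>s. F' s (x s)))"
  proof
    fix n
    show "\<exists>x. continuous_on {a..b} x \<and>
      (\<forall>t\<in>{a..b}. x t = c - integral {min b (t + h n)..b} (\<lambda>s. F' s (x s)))"
      by (rule delay_equation_solution[OF ab h F'_bound int])
  qed
  from choice[OF this] obtain x where x_cont: "\<And>n. continuous_on {a..b} (x n)"
    and x: "\<And>n t. t \<in> {a..b} \<Longrightarrow> x n t = c - integral {min b (t + h n)..b} (\<lambda>s. F' s (x n s))"
    by blast
  have diff: "x n s - x n t = integral {min b (s + h n)..min b (t + h n)} (\<lambda>r. - F' r (x n r))"
    if st: "s \<in> {a..b}" "t \<in> {a..b}" "s \<le> t" for n s t
  proof -
    have "integral {min b (s + h n)..min b (t + h n)} (\<lambda>r. F' r (x n r)) + integral {min b (t + h n)..b} (\<lambda>r. F' r (x n r))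
       = integral {min b (s + h n)..b} (\<lambda>r. F' r (x n r))"
      using st h[of n] by (intro Henstock_Kurzweil_Integration.integral_combine int x_cont) auto
    then show ?thesis by (simp add: x[OF st(1)] x[OF st(2)])
  qed
  \<comment> \<open>All approximations share the Lipschitz constant \<open>M\<close>, whatever the
    delay, and the value \<open>c\<close> at \<open>b\<close>. This gives the equicontinuity and the
    uniform bound for Arzela-Ascoli.\<close>
  have lip1: "\<bar>x n s - x n t\<bar> \<le> M * \<bar>s - t\<bar>" if st: "s \<in> {a..b}" "t \<in> {a..b}" "s \<le> t" for n s t
  proof -
    have "\<bar>x n s - x n t\<bar> \<le> M * (min b (t + h n) - min b (s + h n))"
      unfolding diff[OF st] using st h[of n] F'_bound
      by (intro integral_bound_Ioo integrable_neg int x_cont) auto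
    also have "\<dots> \<le> M * \<bar>s - t\<bar>" using M0 st by (intro mult_left_mono) auto
    finally show ?thesis .
  qed
  have lip: "\<bar>x n s - x n t\<bar> \<le> M * \<bar>s - t\<bar>" if "s \<in> {a..b}" "t \<in> {a..b}" for n s t
    using lip1[of s t n] lip1[of t s n] that by (cases "s \<le> t") (auto simp: abs_minus_commute)
  have xb: "x n b = c" for n using x[of b n] h[of n] ab by simp
  obtain g k where g: "continuous_on {a..b} g" and k: "strict_mono (k :: nat \<Rightarrow> nat)"
    and lim: "\<And>e. 0 < e \<Longrightarrow> \<exists>N. \<forall>n t. n \<ge> N \<and> t \<in> {a..b} \<longrightarrow> norm (x (k n) t - g t) < e"
  proof (rule Arzela_Ascoli[of "{a..b}" x "\<bar>c\<bar> + M * (b - a)"])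
    show "norm (x n t) \<le> \<bar>c\<bar> + M * (b - a)" if "t \<in> {a..b}" for n t
    proof -
      have "M * \<bar>t - b\<bar> \<le> M * (b - a)" using that M0 by (intro mult_left_mono) auto
      then show ?thesis using lip[of t b n] that ab xb[of n] by auto
    qed
    show "\<exists>d>0. \<forall>n s. s \<in> {a..b} \<and> norm (t - s) < d \<longrightarrow> norm (x n t - x n s) < e"
      if "t \<in> {a..b}" "0 < e" for t e
    proof (intro exI conjI allI impI)
      show "0 < e / (M + 1)" using M0 that by simp
      fix n s assume s: "s \<in> {a..b} \<and> norm (t - s) < e / (M + 1)"
      then have "(M + 1) * \<bar>t - s\<bar> < e" using M0 by (simp add: field_simps)
      moreover have "M * \<bar>t - s\<bar> \<le> (M + 1) * \<bar>t - s\<bar>" by (intro mult_right_mono) auto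
      ultimately show "norm (x n t - x n s) < e" using lip[of t s n] s that by auto
    qed
  qed (use that in auto)
  have ptw: "(\<lambda>n. x (k n) t) \<longlonglongrightarrow> g t" if "t \<in> {a..b}" for t
    unfolding LIMSEQ_iff using lim that by blast
  have geq: "g t = c - integral {t..b} (\<lambda>s. F' s (g s))" if t: "t \<in> {a..b}" for t
  proof -
    have "(\<lambda>n. integral {t..b} (\<lambda>s. F' s (x (k n) s))) \<longlonglongrightarrow> integral {t..b} (\<lambda>s. F' s (g s))"
    proof (rule dominated_convergence[where h = "\<lambda>_. M"])
      show "(\<lambda>n. F' s (x (k n) s)) \<longlonglongrightarrow> F' s (g s)" if s: "s \<in> {t..b}" for s
      proof (cases "s \<in> {a<..<b}")
        case True
        have "continuous_on ({a<..<b} \<times> UNIV) (\<lambda>(t, x). F t x)" by (rule cont)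
        moreover have "open ({a<..<b} \<times> (UNIV :: real set))" by (intro open_Times) auto
        ultimately have "isCont (\<lambda>(t, x). F t x) (s, g s)"
          using True by (auto simp: continuous_on_eq_continuous_at)
        moreover have "(\<lambda>n. (s, x (k n) s)) \<longlonglongrightarrow> (s, g s)"
          using ptw[of s] s t by (intro tendsto_Pair tendsto_const) auto
        ultimately have "(\<lambda>n. (\<lambda>(t, x). F t x) (s, x (k n) s)) \<longlonglongrightarrow> (\<lambda>(t, x). F t x) (s, g s)"
          by (rule isCont_tendsto_compose)
        then show ?thesis using True by (simp add: F'_def)
      qed (auto simp: F'_def)
    qed (use t x_cont F'_bound in \<open>auto intro!: int integrable_const_ivl\<close>)
    \<comment> \<open>Dropping the delay changes the integral by the part over an interval of length
      at most \<open>h (k n)\<close>.\<close>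
    moreover have "(\<lambda>n. x (k n) t - c + integral {t..b} (\<lambda>s. F' s (x (k n) s))) \<longlonglongrightarrow> 0"
    proof (rule Lim_null_comparison)
      show "(\<lambda>n. M * h (k n)) \<longlonglongrightarrow> 0"
      proof -
        have "h \<longlonglongrightarrow> 0"
          using LIMSEQ_inverse_real_of_nat by (simp add: h_def[abs_def] inverse_eq_divide)
        from LIMSEQ_subseq_LIMSEQ[OF this k] have "(\<lambda>n. h (k n)) \<longlonglongrightarrow> 0"
          by (simp add: o_def)
        then show ?thesis by (rule tendsto_mult_right_zero)
      qed
      have "norm (x n t - c + integral {t..b} (\<lambda>s. F' s (x n s))) \<le> M * h n" for n
      proof -
        have "integral {t..min b (t + h n)} (\<lambda>s. F' s (x n s)) + integral {min b (t + h n)..b} (\<lambda>s. F' s (x n s))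
           = integral {t..b} (\<lambda>s. F' s (x n s))"
          using t h[of n] by (intro Henstock_Kurzweil_Integration.integral_combine int x_cont) auto
        then have "x n t - c + integral {t..b} (\<lambda>s. F' s (x n s)) = integral {t..min b (t + h n)} (\<lambda>s. F' s (x n s))"
          by (simp add: x[OF t])
        also have "\<bar>\<dots>\<bar> \<le> M * (min b (t + h n) - t)"
          using t h[of n] F'_bound by (intro integral_bound_Ioo int x_cont) auto
        also have "\<dots> \<le> M * h n" using M0 by (intro mult_left_mono) auto
        finally show ?thesis by simp
      qed
      then show "\<forall>\<^sub>F n in sequentially. norm (x (k n) t - c + integral {t..b} (\<lambda>s. F' s (x (k n) s))) \<le> M * h (k n)"
        by simp
    qed
    ultimately have "(\<lambda>n. (x (k n) t - c + integral {t..b} (\<lambda>s. F' s (x (k n) s)))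
        - integral {t..b} (\<lambda>s. F' s (x (k n) s))) \<longlonglongrightarrow> 0 - integral {t..b} (\<lambda>s. F' s (g s))"
      by (intro tendsto_diff)
    then have "(\<lambda>n. x (k n) t - c) \<longlonglongrightarrow> - integral {t..b} (\<lambda>s. F' s (g s))" by simp
    moreover have "(\<lambda>n. x (k n) t - c) \<longlonglongrightarrow> g t - c" using ptw[OF t] by (intro tendsto_intros)
    ultimately have "g t - c = - integral {t..b} (\<lambda>s. F' s (g s))" by (rule LIMSEQ_unique[rotated])
    then show ?thesis by simp
  qed
  show ?thesis
  proof (rule that[OF g])
    show "g b = c" using geq[of b] ab by simp
    fix t assume t: "t \<in> {a<..<b}"
    \<comment> \<open>The integral equation is differentiated on a compact interval around
      \<open>t\<close> inside the open one, where the integrand is continuous.\<close>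
    define d where "d = (a + t) / 2"
    define e where "e = (t + b) / 2"
    have de: "a < d" "d < t" "t < e" "e < b" using t by (auto simp: d_def e_def)
    have eq: "g d + integral {d..s} (\<lambda>s. F' s (g s)) = g s" if "s \<in> {d..e}" for s
    proof -
      have "integral {d..s} (\<lambda>s. F' s (g s)) + integral {s..b} (\<lambda>s. F' s (g s)) = integral {d..b} (\<lambda>s. F' s (g s))"
        using that de by (intro Henstock_Kurzweil_Integration.integral_combine int g) auto
      then show ?thesis using geq[of d] geq[of s] that de by simp
    qed
    have "continuous_on {d..e} (\<lambda>s. F' s (g s))"
      using F'_cont[OF g] by (rule continuous_on_subset) (use de in auto)
    from integral_has_real_derivative[OF this, of t] de
    have "((\<lambda>s. g d + integral {d..s} (\<lambda>s. F' s (g s))) has_real_derivative F' t (g t)) (at t within {d..e})"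
      by (auto intro!: derivative_eq_intros)
    then have "(g has_real_derivative F' t (g t)) (at t within {d..e})"
      by (rule has_field_derivative_transform_within[of _ _ _ _ 1]) (use eq de in auto)
    moreover have "at t within {d..e} = at t" using de by (intro at_within_interior) auto
    ultimately show "(g has_real_derivative F t (g t)) (at t)" using t by (simp add: F'_def)
  qed
qed

text \<open>From a point with \<open>D t > 0\<close>, \<open>D\<close> does not decrease up to the
  first point on the right where it is nonpositive; such a point exists because of
  \<open>D b \<le> 0\<close>. This is the comparison principle for equations solved from the
  right.\<close>

lemma nonpos_if_deriv_nonneg_where_pos:
  fixes D :: "real \<Rightarrow> real"
  assumes cont: "continuous_on {a..b} D" and Db: "D b \<le> 0"
    and der: "\<And>t. t \<in> {a<..<b} \<Longrightarrow> D t > 0 \<Longrightarrow> \<exists>d\<ge>0. (D has_real_derivative d) (at t)"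
    and t: "t \<in> {a..b}"
  shows "D t \<le> 0"
proof (rule ccontr)
  assume pos: "\<not> D t \<le> 0"
  define A where "A = {s \<in> {t..b}. D s \<le> 0}"
  have "closed A"
    unfolding A_def using t
    by (intro continuous_on_closed_Collect_le continuous_on_subset[OF cont] continuous_on_const) auto
  moreover have "b \<in> A" using Db t by (auto simp: A_def)
  moreover have bdd: "bdd_below A" by (auto simp: A_def intro: bdd_belowI[of _ t])
  ultimately have InfA: "Inf A \<in> A" by (intro closed_contains_Inf) auto
  have "D t \<le> D (Inf A)"
  proof (rule deriv_nonneg_off_finite_imp_le[of "{}" t "Inf A" D])
    show "\<exists>d\<ge>0. (D has_real_derivative d) (at s)" if s: "s \<in> {t<..<Inf A} - {}" for s
    proof (rule der)
      have "s \<notin> A" using s cInf_lower[OF _ bdd, of s] by fastforce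
      moreover have "t < s" "s < b" using s InfA by (simp_all add: A_def)
      ultimately show "D s > 0" unfolding A_def by simp
      show "s \<in> {a<..<b}" using \<open>t < s\<close> \<open>s < b\<close> t by simp
    qed
    show "continuous_on {t..Inf A} D"
      by (rule continuous_on_subset[OF cont]) (use InfA t in \<open>auto simp: A_def\<close>)
    show "t \<le> Inf A" using InfA by (simp add: A_def)
  qed simp
  moreover have "D (Inf A) \<le> 0" using InfA by (simp add: A_def)
  ultimately show False using pos by simp
qed

text \<open>The equation is solved backwards from the common value at \<open>b\<close>, so the
  differential inequalities are opposite to those for forward barriers: an excess over \<beta> could
  not decrease to the right, yet it has to be 0 at \<open>b\<close>.\<close>

theorem solution_between_barriers:
  fixes F :: "real \<Rightarrow> real \<Rightarrow> real" and \<alpha> \<beta> \<alpha>' \<beta>' :: "real \<Rightarrow> real"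
  assumes ab: "a < b" and cont: "continuous_on {a..b} \<alpha>" "continuous_on {a..b} \<beta>"
    and der: "\<And>t. t \<in> {a<..<b} \<Longrightarrow> (\<alpha> has_real_derivative \<alpha>' t) (at t)"
      "\<And>t. t \<in> {a<..<b} \<Longrightarrow> (\<beta> has_real_derivative \<beta>' t) (at t)"
    and le: "\<And>t. t \<in> {a..b} \<Longrightarrow> \<alpha> t \<le> \<beta> t" and eq: "\<alpha> b = \<beta> b"
    and F_cont: "continuous_on {(t, x). a < t \<and> t < b \<and> \<alpha> t \<le> x \<and> x \<le> \<beta> t} (\<lambda>(t, x). F t x)"
    and bound: "\<And>t x. t \<in> {a<..<b} \<Longrightarrow> \<alpha> t \<le> x \<Longrightarrow> x \<le> \<beta> t \<Longrightarrow> \<bar>F t x\<bar> \<le> M"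
    and lower: "\<And>t. t \<in> {a<..<b} \<Longrightarrow> F t (\<alpha> t) \<le> \<alpha>' t"
    and upper: "\<And>t. t \<in> {a<..<b} \<Longrightarrow> \<beta>' t \<le> F t (\<beta> t)"
  obtains x where "continuous_on {a..b} x" "\<And>t. t \<in> {a..b} \<Longrightarrow> \<alpha> t \<le> x t \<and> x t \<le> \<beta> t"
    "\<And>t. t \<in> {a<..<b} \<Longrightarrow> (x has_real_derivative F t (x t)) (at t)"
proof -
  \<comment> \<open>Clamping into the region gives a field defined and bounded for all
    \<open>x\<close>. The solution turns out to stay in the region, where nothing was
    changed.\<close>
  define cl where "cl t x = max (\<alpha> t) (min (\<beta> t) x)" for t x
  have cl: "\<alpha> t \<le> cl t x \<and> cl t x \<le> \<beta> t" if "t \<in> {a..b}" for t x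
    using le[OF that] by (auto simp: cl_def)
  let ?R = "{a<..<b} \<times> (UNIV :: real set)"
  have "continuous_on ?R (\<lambda>p. \<alpha> (fst p))" "continuous_on ?R (\<lambda>p. \<beta> (fst p))"
    by (rule continuous_on_compose2[OF cont(1) continuous_on_fst[OF continuous_on_id]]
        continuous_on_compose2[OF cont(2) continuous_on_fst[OF continuous_on_id]]; force)+
  then have "continuous_on ?R (\<lambda>p. (fst p, cl (fst p) (snd p)))"
    unfolding cl_def
    by (intro continuous_on_Pair continuous_on_max continuous_on_min continuous_on_fst
        continuous_on_snd continuous_on_id)
  then have "continuous_on ?R (\<lambda>p. (\<lambda>(t, x). F t x) (fst p, cl (fst p) (snd p)))"
  proof (rule continuous_on_compose2[OF F_cont])
    show "(\<lambda>p. (fst p, cl (fst p) (snd p))) ` ?R \<subseteq> {(t, x). a < t \<and> t < b \<and> \<alpha> t \<le> x \<and> x \<le> \<beta> t}"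
      using cl by (auto simp del: max.bounded_iff)
  qed
  then have clF: "continuous_on ?R (\<lambda>(t, x). F t (cl t x))"
    by (simp add: case_prod_unfold)
  obtain x where x: "continuous_on {a..b} x" "x b = \<alpha> b"
    and x': "\<And>t. t \<in> {a<..<b} \<Longrightarrow> (x has_real_derivative F t (cl t (x t))) (at t)"
  proof (rule peano_backward[OF ab clF, of M "\<alpha> b"])
    show "\<bar>F t (cl t x)\<bar> \<le> M" if "t \<in> {a<..<b}" for t x
      using that cl[of t x] by (intro bound) auto
  qed (use that in auto)
  have up: "x t \<le> \<beta> t" if "t \<in> {a..b}" for t
  proof -
    have "(\<lambda>t. x t - \<beta> t) t \<le> 0"
    proof (rule nonpos_if_deriv_nonneg_where_pos[OF _ _ _ that])
      fix s assume s: "s \<in> {a<..<b}" and pos: "x s - \<beta> s > 0"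
      have "cl s (x s) = \<beta> s" using pos le[of s] s by (auto simp: cl_def)
      then show "\<exists>d\<ge>0. ((\<lambda>t. x t - \<beta> t) has_real_derivative d) (at s)"
        using DERIV_diff[OF x'[OF s] der(2)[OF s]] upper[OF s]
        by (intro exI[of _ "F s (\<beta> s) - \<beta>' s"]) auto
    qed (use x eq cont in \<open>auto intro!: continuous_intros\<close>)
    then show ?thesis by simp
  qed
  have low: "\<alpha> t \<le> x t" if "t \<in> {a..b}" for t
  proof -
    have "(\<lambda>t. \<alpha> t - x t) t \<le> 0"
    proof (rule nonpos_if_deriv_nonneg_where_pos[OF _ _ _ that])
      fix s assume s: "s \<in> {a<..<b}" and pos: "\<alpha> s - x s > 0"
      have "cl s (x s) = \<alpha> s" using pos le[of s] s by (auto simp: cl_def)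
      then show "\<exists>d\<ge>0. ((\<lambda>t. \<alpha> t - x t) has_real_derivative d) (at s)"
        using DERIV_diff[OF der(1)[OF s] x'[OF s]] lower[OF s]
        by (intro exI[of _ "\<alpha>' s - F s (\<alpha> s)"]) auto
    qed (use x eq cont in \<open>auto intro!: continuous_intros\<close>)
    then show ?thesis by simp
  qed
  show ?thesis
  proof (rule that[OF x(1)])
    show "(x has_real_derivative F t (x t)) (at t)" if "t \<in> {a<..<b}" for t
      using x'[OF that] low[of t] up[of t] that by (simp add: cl_def)
  qed (use low up in auto)
qed


section \<open>The spine after the bifurcation\<close>

text \<open>Here \<open>d v e\<close> and \<open>dp v e\<close> model \<open>D_minus\<close> and
  \<open>D_plus\<close> at \<open>(v, -e)\<close>, and \<open>d1\<close>, \<open>d2\<close> are the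
  first two derivatives of \<open>d\<close> in \<open>v\<close>. Assumption \<open>de\<close> is the
  relation that lets \<open>D_plus\<close> govern the change of \<open>D_minus\<close> with the
  depth.\<close>

locale tangency =
  fixes d dp d1 d2 :: "real \<Rightarrow> real \<Rightarrow> real" and u\<^sub>0 u\<^sub>1 u\<^sub>2 e\<^sub>0 :: real
  assumes e0: "e\<^sub>0 > 0" and u: "u\<^sub>1 < u\<^sub>0" "u\<^sub>0 < u\<^sub>2"
    and dv: "\<And>v e. e > 0 \<Longrightarrow> ((\<lambda>v. d v e) has_real_derivative d1 v e) (at v)"
    and d1v: "\<And>v e. e > 0 \<Longrightarrow> ((\<lambda>v. d1 v e) has_real_derivative d2 v e) (at v)"
    and de: "\<And>v e. e > 0 \<Longrightarrow> (d v has_real_derivative d1 v e - dp v e / e) (at e)"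
    and conts: "continuous_on (UNIV \<times> {0<..}) (\<lambda>x. d (fst x) (snd x))"
      "continuous_on (UNIV \<times> {0<..}) (\<lambda>x. dp (fst x) (snd x))"
      "continuous_on (UNIV \<times> {0<..}) (\<lambda>x. d1 (fst x) (snd x))"
      "continuous_on (UNIV \<times> {0<..}) (\<lambda>x. d2 (fst x) (snd x))"
    and d_pos: "\<And>v. v \<in> {u\<^sub>1..u\<^sub>2} - {u\<^sub>0} \<Longrightarrow> d v e\<^sub>0 > 0"
    and dp_pos: "\<And>v. v \<in> {u\<^sub>1..u\<^sub>2} \<Longrightarrow> dp v e\<^sub>0 > 0"
    and root: "d u\<^sub>0 e\<^sub>0 = 0" "d1 u\<^sub>0 e\<^sub>0 = 0" "d2 u\<^sub>0 e\<^sub>0 \<noteq> 0"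
begin

lemma open_half: "open (UNIV \<times> {0<..} :: (real \<times> real) set)"
  by (intro open_Times) auto

text \<open>A negative value would make \<open>d1\<close>, and hence \<open>d\<close>, negative just
  to the right of the tangency, against \<open>d_pos\<close>.\<close>

lemma d2_pos: "d2 u\<^sub>0 e\<^sub>0 > 0"
proof (rule ccontr)
  assume "\<not> d2 u\<^sub>0 e\<^sub>0 > 0"
  then have "d2 u\<^sub>0 e\<^sub>0 < 0" using root(3) by simp
  from DERIV_neg_dec_right[OF d1v[OF e0] this] obtain s where s: "s > 0"
    and "\<forall>h>0. h < s \<longrightarrow> d1 (u\<^sub>0 + h) e\<^sub>0 < d1 u\<^sub>0 e\<^sub>0"
    by blast
  then have neg: "d1 (u\<^sub>0 + h) e\<^sub>0 < 0" if "0 < h" "h < s" for h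
    using that by (simp add: root(2))
  define t where "t = min (s / 2) (u\<^sub>2 - u\<^sub>0)"
  have t: "0 < t" "t < s" "u\<^sub>0 + t \<le> u\<^sub>2" using s u unfolding t_def by linarith+
  have "d (u\<^sub>0 + t) e\<^sub>0 < d u\<^sub>0 e\<^sub>0"
  proof (rule DERIV_neg_imp_decreasing_open[of "u\<^sub>0" "u\<^sub>0 + t" "\<lambda>v. d v e\<^sub>0"])
    show "\<exists>y. ((\<lambda>v. d v e\<^sub>0) has_real_derivative y) (at x) \<and> y < 0"
      if "u\<^sub>0 < x" "x < u\<^sub>0 + t" for x
    proof (intro exI conjI)
      show "((\<lambda>v. d v e\<^sub>0) has_real_derivative d1 x e\<^sub>0) (at x)" by (rule dv[OF e0])
      have "0 < x - u\<^sub>0" "x - u\<^sub>0 < s" using that t by linarith+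
      from neg[OF this] show "d1 x e\<^sub>0 < 0" by simp
    qed
    show "continuous_on {u\<^sub>0..u\<^sub>0 + t} (\<lambda>v. d v e\<^sub>0)"
      by (intro continuous_at_imp_continuous_on ballI DERIV_isCont[OF dv[OF e0]])
  qed (use t in simp)
  moreover have "d (u\<^sub>0 + t) e\<^sub>0 > 0" using t u by (intro d_pos) simp
  ultimately show False using root(1) by simp
qed

definition D\<^sub>0 where "D\<^sub>0 = dp u\<^sub>0 e\<^sub>0"
text \<open>By \<open>de\<close> and \<open>d1 u\<^sub>0 e\<^sub>0 = 0\<close>, this is minus the
  derivative of \<open>d\<close> in \<open>e\<close> at the tangency.\<close>

definition \<beta> where "\<beta> = D\<^sub>0 / e\<^sub>0"

lemma D0_pos: "D\<^sub>0 > 0" using dp_pos[of u\<^sub>0] u by (simp add: D\<^sub>0_def)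
lemma beta_pos: "\<beta> > 0" using D0_pos e0 by (simp add: \<beta>_def)
lemma D0_eq: "D\<^sub>0 = \<beta> * e\<^sub>0" using e0 by (simp add: \<beta>_def)

text \<open>A tolerance of one per cent in each quantity leaves room in the barrier estimates for
  the multiples 3/2 and 3; positivity of \<open>d2\<close> gives convexity in
  \<open>v\<close>.\<close>

definition near where
  "near r \<longleftrightarrow> 0 < r \<and> r \<le> e\<^sub>0 / 100 \<and> u\<^sub>1 < u\<^sub>0 - r \<and> u\<^sub>0 + r < u\<^sub>2 \<and>
    (\<forall>v e. \<bar>v - u\<^sub>0\<bar> \<le> r \<longrightarrow> \<bar>e - e\<^sub>0\<bar> \<le> r \<longrightarrow> d2 v e > 0 \<and>
      99 / 100 * D\<^sub>0 \<le> dp v e \<and> dp v e \<le> 101 / 100 * D\<^sub>0 \<and> \<bar>d1 v e\<bar> \<le> \<beta> / 100)"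

lemma near_exists: "\<exists>r. near r"
proof -
  define P where "P x \<longleftrightarrow> d2 (fst x) (snd x) > 0 \<and> 99 / 100 * D\<^sub>0 \<le> dp (fst x) (snd x) \<and>
      dp (fst x) (snd x) \<le> 101 / 100 * D\<^sub>0 \<and> \<bar>d1 (fst x) (snd x)\<bar> \<le> \<beta> / 100" for x
  have mem: "(u\<^sub>0, e\<^sub>0) \<in> UNIV \<times> {0<..}" using e0 by simp
  have lim: "((\<lambda>x. h (fst x) (snd x)) \<longlongrightarrow> h u\<^sub>0 e\<^sub>0) (nhds (u\<^sub>0, e\<^sub>0))"
    if "continuous_on (UNIV \<times> {0<..}) (\<lambda>x. h (fst x) (snd x))" for h :: "real \<Rightarrow> real \<Rightarrow> real"
  proof -
    have "isCont (\<lambda>x. h (fst x) (snd x)) (u\<^sub>0, e\<^sub>0)"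
      using that mem unfolding continuous_on_eq_continuous_at[OF open_half] by blast
    from iffD1[OF tendsto_at_iff_tendsto_nhds isContD[OF this]] show ?thesis
      unfolding fst_conv snd_conv .
  qed
  have "\<forall>\<^sub>F x in nhds (u\<^sub>0, e\<^sub>0). 0 < d2 (fst x) (snd x)"
    using order_tendstoD(1)[OF lim[OF conts(4)] d2_pos] .
  moreover have "\<forall>\<^sub>F x in nhds (u\<^sub>0, e\<^sub>0). 99 / 100 * D\<^sub>0 < dp (fst x) (snd x)"
    using order_tendstoD(1)[OF lim[OF conts(2)], of "99 / 100 * D\<^sub>0"] D0_pos by (simp add: D\<^sub>0_def)
  moreover have "\<forall>\<^sub>F x in nhds (u\<^sub>0, e\<^sub>0). dp (fst x) (snd x) < 101 / 100 * D\<^sub>0"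
    using order_tendstoD(2)[OF lim[OF conts(2)], of "101 / 100 * D\<^sub>0"] D0_pos by (simp add: D\<^sub>0_def)
  moreover have "\<forall>\<^sub>F x in nhds (u\<^sub>0, e\<^sub>0). - (\<beta> / 100) < d1 (fst x) (snd x)"
    using order_tendstoD(1)[OF lim[OF conts(3)], of "- (\<beta> / 100)"] beta_pos root by simp
  moreover have "\<forall>\<^sub>F x in nhds (u\<^sub>0, e\<^sub>0). d1 (fst x) (snd x) < \<beta> / 100"
    using order_tendstoD(2)[OF lim[OF conts(3)], of "\<beta> / 100"] beta_pos root by simp
  ultimately have "\<forall>\<^sub>F x in nhds (u\<^sub>0, e\<^sub>0). P x"
    unfolding P_def by eventually_elim (simp add: abs_le_iff)
  then obtain \<delta> where \<delta>: "\<delta> > 0" and *: "\<forall>x. dist x (u\<^sub>0, e\<^sub>0) < \<delta> \<longrightarrow> P x"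
    unfolding eventually_nhds_metric by (elim exE conjE)
  define s where "s = min (min \<delta> e\<^sub>0) (min (u\<^sub>0 - u\<^sub>1) (u\<^sub>2 - u\<^sub>0))"
  define r where "r = s / 100"
  have "0 < s" "s \<le> \<delta>" "s \<le> e\<^sub>0" "s \<le> u\<^sub>0 - u\<^sub>1" "s \<le> u\<^sub>2 - u\<^sub>0"
    using \<delta> e0 u by (simp_all add: s_def min.coboundedI1 min.coboundedI2)
  then have r: "0 < r" "r \<le> e\<^sub>0 / 100" "u\<^sub>1 < u\<^sub>0 - r" "u\<^sub>0 + r < u\<^sub>2" "2 * r < \<delta>"
    unfolding r_def by linarith+
  have "dist (v, e) (u\<^sub>0, e\<^sub>0) < \<delta>" if "\<bar>v - u\<^sub>0\<bar> \<le> r" "\<bar>e - e\<^sub>0\<bar> \<le> r" for v e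
  proof -
    have "dist (v, e) (u\<^sub>0, e\<^sub>0) \<le> \<bar>v - u\<^sub>0\<bar> + \<bar>e - e\<^sub>0\<bar>"
      using sqrt_sum_squares_le_sum_abs[of "\<bar>v - u\<^sub>0\<bar>" "\<bar>e - e\<^sub>0\<bar>"]
      unfolding dist_Pair_Pair dist_real_def by simp
    then show ?thesis using that r(5) by linarith
  qed
  then have "P (v, e)" if "\<bar>v - u\<^sub>0\<bar> \<le> r" "\<bar>e - e\<^sub>0\<bar> \<le> r" for v e
    using that * by blast
  then have "near r" unfolding near_def P_def fst_conv snd_conv using r(1-4) by blast
  then show ?thesis ..
qed

text \<open>Compactness, through the tube lemma. The coordinates are swapped in \<open>W\<close>
  because the lemma thickens the point factor of \<open>{e\<^sub>0} \<times> K\<close>.\<close>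

lemma tube_pos:
  fixes h :: "real \<Rightarrow> real \<Rightarrow> real"
  assumes K: "compact K" and h: "continuous_on (UNIV \<times> {0<..}) (\<lambda>x. h (fst x) (snd x))"
    and pos: "\<And>v. v \<in> K \<Longrightarrow> h v e\<^sub>0 > 0"
  shows "\<exists>\<delta>>0. \<forall>e. \<bar>e - e\<^sub>0\<bar> < \<delta> \<longrightarrow> (\<forall>v\<in>K. h v e > 0)"
proof -
  define W where "W = {x. 0 < fst x \<and> h (snd x) (fst x) > 0}"
  have "continuous_on ({0<..} \<times> UNIV) (\<lambda>x. h (fst (prod.swap x)) (snd (prod.swap x)))"
    by (rule continuous_on_compose2[OF h continuous_on_swap]) auto
  then have "open (({0<..} \<times> UNIV) \<inter> (\<lambda>x. h (fst (prod.swap x)) (snd (prod.swap x))) -` {0<..})"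
    by (intro continuous_open_preimage open_Times) auto
  moreover have "({0<..} \<times> UNIV) \<inter> (\<lambda>x. h (fst (prod.swap x)) (snd (prod.swap x))) -` {0<..} = W"
    by (auto simp: W_def)
  ultimately have "open W" by simp
  moreover have "{e\<^sub>0} \<times> K \<subseteq> W" using pos e0 by (auto simp: W_def)
  ultimately obtain X where X: "e\<^sub>0 \<in> X" "open X" "X \<times> K \<subseteq> W"
    using Elementary_Topology.tube_lemma[OF K, of W e\<^sub>0] by (metis open_prod_elim)
  then obtain \<delta> where \<delta>: "\<delta> > 0" "ball e\<^sub>0 \<delta> \<subseteq> X" unfolding open_contains_ball by blast
  have "h v e > 0" if "\<bar>e - e\<^sub>0\<bar> < \<delta>" "v \<in> K" for e v
  proof -
    have "e \<in> X" using that \<delta> by (auto simp: ball_def dist_real_def abs_minus_commute)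
    then have "(e, v) \<in> W" using X that by blast
    then show ?thesis by (simp add: W_def)
  qed
  then show ?thesis using \<delta> by blast
qed

text \<open>By \<open>de\<close> the rate of decrease in \<open>e\<close> is
  \<open>dp v x / x - d1 v x\<close>. The quotient lies between 98 and 103 per cent of \<beta>, as
  99/101 > 98/100 and 101/99 < 103/100, and \<open>d1\<close> contributes at most one per cent
  more.\<close>

lemma e_slope:
  assumes r: "near r" and v: "\<bar>v - u\<^sub>0\<bar> \<le> r" and e: "e\<^sub>0 - r \<le> e" "e < e'" "e' \<le> e\<^sub>0 + r"
  shows "97 / 100 * \<beta> * (e' - e) \<le> d v e - d v e'" "d v e - d v e' \<le> 104 / 100 * \<beta> * (e' - e)"
proof -
  have e_pos: "x > 0" if "e \<le> x" for x using e(1) r e0 that by (auto simp: near_def)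
  obtain x where x: "e < x" "x < e'" and eq: "d v e' - d v e = (e' - e) * (d1 v x - dp v x / x)"
    using MVT2[OF e(2), of "d v" "\<lambda>x. d1 v x - dp v x / x"] de e_pos by blast
  have near_x: "99 / 100 * D\<^sub>0 \<le> dp v x" "dp v x \<le> 101 / 100 * D\<^sub>0" "\<bar>d1 v x\<bar> \<le> \<beta> / 100"
    using r v e x unfolding near_def by auto
  have "r \<le> e\<^sub>0 / 100" using r by (simp only: near_def)
  then have "99 / 100 * e\<^sub>0 \<le> x" "x \<le> 101 / 100 * e\<^sub>0" using e x by linarith+
  then have "\<beta> * (99 / 100 * e\<^sub>0) \<le> \<beta> * x" "\<beta> * x \<le> \<beta> * (101 / 100 * e\<^sub>0)"
    using beta_pos by (simp_all only: mult_le_cancel_left_pos)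
  moreover have "\<beta> * e\<^sub>0 > 0" using beta_pos e0 by simp
  ultimately have "98 / 100 * \<beta> * x \<le> dp v x" "dp v x \<le> 103 / 100 * \<beta> * x"
    using near_x(1,2) unfolding D0_eq mult.left_commute[of \<beta>] by linarith+
  then have "98 / 100 * \<beta> \<le> dp v x / x" "dp v x / x \<le> 103 / 100 * \<beta>"
    using e_pos[of x] x by (simp_all only: pos_le_divide_eq pos_divide_le_eq less_imp_le)
  then have "97 / 100 * \<beta> \<le> - (d1 v x - dp v x / x)" "- (d1 v x - dp v x / x) \<le> 104 / 100 * \<beta>"
    using near_x(3) unfolding abs_le_iff by linarith+
  moreover have "d v e - d v e' = (- (d1 v x - dp v x / x)) * (e' - e)"
    using eq by (simp only: mult.commute[of "e' - e"] minus_mult_left[symmetric])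
  moreover have "0 \<le> e' - e" using e(2) by simp
  ultimately show "97 / 100 * \<beta> * (e' - e) \<le> d v e - d v e'" "d v e - d v e' \<le> 104 / 100 * \<beta> * (e' - e)"
    by (simp_all only: mult_right_mono)
qed

text \<open>The spine equation solved for the derivative of the height \<open>w\<close>, in the
  variable \<open>v = u - e\<close> and with \<open>T = w - e\<close>. Then
  \<open>e - T = 2 * e - w\<close>, \<open>e + T = w\<close>, and both D-functions are taken at
  depth \<open>e - w\<close>.\<close>

definition spine_field where
  "spine_field e v w = ((2 * e - w) * d v (e - w) - w * dp v (e - w)) / ((2 * e - w) * d v (e - w) + w * dp v (e - w))"

context
  fixes r e assumes r: "near r" and e: "e\<^sub>0 < e" "e \<le> e\<^sub>0 + r / 4"
begin

lemma near_bounds: "0 < r" "r \<le> e\<^sub>0 / 100" "u\<^sub>1 < u\<^sub>0 - r" "u\<^sub>0 + r < u\<^sub>2"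
  using r unfolding near_def by blast+

lemma depth_small:
  assumes v: "\<bar>v - u\<^sub>0\<bar> \<le> r"
  shows "- d v e \<le> 104 / 100 * \<beta> * (e - e\<^sub>0)"
proof -
  have "v \<in> {u\<^sub>1..u\<^sub>2}" using v near_bounds(3,4) unfolding abs_le_iff atLeastAtMost_iff by linarith
  then have "d v e\<^sub>0 \<ge> 0" using d_pos[of v] root(1) by (cases "v = u\<^sub>0") (simp_all add: less_imp_le)
  moreover have "d v e\<^sub>0 - d v e \<le> 104 / 100 * \<beta> * (e - e\<^sub>0)"
    by (rule e_slope(2)[OF r v _ e(1)]) (use e near_bounds in linarith)+
  ultimately show ?thesis by linarith
qed

text \<open>To first order \<open>d v (e - w)\<close> is \<open>d v e + \<beta> * w\<close>, so that with \<open>\<beta> * w = k * (- d v e)\<close> the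
  field is about \<open>(k - 2) / (3 * k - 2)\<close>, whereas the barriers are nearly flat. The barriers
  \<open>k = 3/2\<close> and \<open>k = 3\<close> therefore enclose a solution.\<close>

lemma barrier_region:
  assumes v: "\<bar>v - u\<^sub>0\<bar> \<le> r" and neg: "d v e < 0"
    and w: "3 / 2 * (- d v e) \<le> \<beta> * w" "\<beta> * w \<le> 3 * (- d v e)"
  shows "0 < w" "e\<^sub>0 - r \<le> e - w" "e - w < e" "45 / 100 * (- d v e) \<le> d v (e - w)"
    "97 / 100 * (\<beta> * w) + d v e \<le> d v (e - w)" "d v (e - w) \<le> 104 / 100 * (\<beta> * w) + d v e"
    "99 / 100 * (\<beta> * w) * e\<^sub>0 \<le> w * dp v (e - w)" "w * dp v (e - w) \<le> 101 / 100 * (\<beta> * w) * e\<^sub>0"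
    "199 / 100 * e\<^sub>0 \<le> 2 * e - w" "2 * e - w \<le> 202 / 100 * e\<^sub>0"
proof -
  have "0 < \<beta> * w" using neg w by linarith
  then show w_pos: "0 < w" by (simp only: zero_less_mult_pos[OF _ beta_pos])
  have "\<beta> * w \<le> 312 / 100 * (\<beta> * (e - e\<^sub>0))"
    using w(2) depth_small[OF v] unfolding mult.assoc by linarith
  then have "\<beta> * w \<le> \<beta> * (312 / 100 * (e - e\<^sub>0))" by (simp only: mult.left_commute)
  then have w_le: "w \<le> 312 / 100 * (e - e\<^sub>0)" by (simp only: mult_le_cancel_left_pos[OF beta_pos])
  \<comment> \<open>Since \<open>e - e\<^sub>0 \<le> r / 4\<close>, the drop below
    \<open>e\<^sub>0\<close> is at most 2.12 quarters of \<open>r\<close>; this is the reason for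
    the quarter.\<close>
  show lo: "e\<^sub>0 - r \<le> e - w" using w_le e near_bounds unfolding right_diff_distrib by linarith
  show "e - w < e" using w_pos by linarith
  have hi: "e \<le> e\<^sub>0 + r" using e near_bounds by linarith
  have ew: "e - (e - w) = w" by simp
  have sl: "97 / 100 * (\<beta> * w) \<le> d v (e - w) - d v e" "d v (e - w) - d v e \<le> 104 / 100 * (\<beta> * w)"
    using e_slope[OF r v lo \<open>e - w < e\<close> hi] unfolding ew mult.assoc by blast+
  show a: "97 / 100 * (\<beta> * w) + d v e \<le> d v (e - w)" "d v (e - w) \<le> 104 / 100 * (\<beta> * w) + d v e"
    using sl by linarith+
  \<comment> \<open>From 97/100 * 3/2 - 1 = 0.455.\<close>
  show "45 / 100 * (- d v e) \<le> d v (e - w)" using a(1) w neg by linarith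
  have "\<bar>e - w - e\<^sub>0\<bar> \<le> r" using lo hi w_pos unfolding abs_le_iff by linarith
  then have "99 / 100 * D\<^sub>0 \<le> dp v (e - w)" "dp v (e - w) \<le> 101 / 100 * D\<^sub>0"
    using r v unfolding near_def by blast+
  then have "w * (99 / 100 * D\<^sub>0) \<le> w * dp v (e - w)" "w * dp v (e - w) \<le> w * (101 / 100 * D\<^sub>0)"
    using w_pos by (simp_all only: mult_left_mono less_imp_le)
  then show "99 / 100 * (\<beta> * w) * e\<^sub>0 \<le> w * dp v (e - w)" "w * dp v (e - w) \<le> 101 / 100 * (\<beta> * w) * e\<^sub>0"
    unfolding D0_eq by (simp_all only: mult_ac)
  show "199 / 100 * e\<^sub>0 \<le> 2 * e - w" "2 * e - w \<le> 202 / 100 * e\<^sub>0"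
    using lo e near_bounds w_pos by linarith+
qed

lemma barrier_signs:
  assumes v: "\<bar>v - u\<^sub>0\<bar> \<le> r" and neg: "d v e < 0"
    and w: "3 / 2 * (- d v e) \<le> \<beta> * w" "\<beta> * w \<le> 3 * (- d v e)"
  shows "0 < (2 * e - w) * d v (e - w)" "0 < w * dp v (e - w)" "d v (e - w) > 0" "dp v (e - w) > 0"
proof -
  note R = barrier_region[OF assms]
  show "d v (e - w) > 0" using R(4) neg by simp
  moreover have "2 * e - w > 0" using R(9) e0 by linarith
  ultimately show "0 < (2 * e - w) * d v (e - w)" by simp
  have "0 < 99 / 100 * (\<beta> * w) * e\<^sub>0" using R(1) beta_pos e0 by simp
  then show pos: "0 < w * dp v (e - w)" using R(7) by linarith
  then show "dp v (e - w) > 0" using R(1) by (simp add: zero_less_mult_iff)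
qed

text \<open>The bound -15/1000 is the steepest descent of the barrier with factor 3/2, whose slope
  is \<open>- 3 / 2 * d1 v e / \<beta>\<close> with the last quotient at most 1/100 in absolute
  value.\<close>

lemma lower_barrier:
  assumes v: "\<bar>v - u\<^sub>0\<bar> \<le> r" and neg: "d v e < 0" and w: "\<beta> * w = 3 / 2 * (- d v e)"
  shows "spine_field e v w \<le> - 15 / 1000"
proof -
  have w': "3 / 2 * (- d v e) \<le> \<beta> * w" "\<beta> * w \<le> 3 * (- d v e)" using w neg by simp_all
  note R = barrier_region[OF v neg w'] and P = barrier_signs[OF v neg w']
  define X Y Z where "X = (2 * e - w) * d v (e - w)" and "Y = w * dp v (e - w)" and "Z = e\<^sub>0 * (- d v e)"
  have Z: "Z > 0" using e0 neg by (simp add: Z_def mult_pos_neg)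
  \<comment> \<open>The factor 56/100 is 104/100 * 3/2 - 1.\<close>
  have "X \<le> (202 / 100 * e\<^sub>0) * (56 / 100 * (- d v e))"
    unfolding X_def using R(6,10) P(3) w e0 by (intro mult_mono) auto
  then have X: "X \<le> 202 / 100 * (56 / 100) * Z" by (simp add: Z_def)
  have Y: "Y \<ge> 99 / 100 * (3 / 2) * Z" using R(7) unfolding w Y_def Z_def by (simp add: mult_ac)
  have "X - Y \<le> - 15 / 1000 * (X + Y)" unfolding distrib_left using X Y Z by linarith
  moreover have "X + Y > 0" using P by (simp add: X_def Y_def)
  ultimately show ?thesis
    unfolding spine_field_def X_def[symmetric] Y_def[symmetric] by (simp only: pos_divide_le_eq)
qed

text \<open>In the same way 3/100 bounds the slope of the barrier with factor 3.\<close>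

lemma upper_barrier:
  assumes v: "\<bar>v - u\<^sub>0\<bar> \<le> r" and neg: "d v e < 0" and w: "\<beta> * w = 3 * (- d v e)"
  shows "3 / 100 \<le> spine_field e v w"
proof -
  have w': "3 / 2 * (- d v e) \<le> \<beta> * w" "\<beta> * w \<le> 3 * (- d v e)" using w neg by simp_all
  note R = barrier_region[OF v neg w'] and P = barrier_signs[OF v neg w']
  define X Y Z where "X = (2 * e - w) * d v (e - w)" and "Y = w * dp v (e - w)" and "Z = e\<^sub>0 * (- d v e)"
  have Z: "Z > 0" using e0 neg by (simp add: Z_def mult_pos_neg)
  \<comment> \<open>The factor 191/100 is 97/100 * 3 - 1.\<close>
  have "(199 / 100 * e\<^sub>0) * (191 / 100 * (- d v e)) \<le> X"
    unfolding X_def using R(5,9) P(3) w e0 neg by (intro mult_mono) auto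
  then have X: "199 / 100 * (191 / 100) * Z \<le> X" by (simp add: Z_def)
  have Y: "Y \<le> 101 / 100 * 3 * Z" using R(8) unfolding w Y_def Z_def by (simp add: mult_ac)
  have "3 / 100 * (X + Y) \<le> X - Y" unfolding distrib_left using X Y Z by linarith
  moreover have "X + Y > 0" using P by (simp add: X_def Y_def)
  ultimately show ?thesis
    unfolding spine_field_def X_def[symmetric] Y_def[symmetric] by (simp only: pos_le_divide_eq)
qed

text \<open>Both barriers are multiples of \<open>- d v e\<close> and vanish at the roots. This
  supplies the starting value at \<open>ur\<close>, and the squeeze gives the value at
  \<open>ul\<close>.\<close>

lemma spine_in_section:
  assumes lr: "u\<^sub>0 - r \<le> ul" "ul < ur" "ur \<le> u\<^sub>0 + r"
    and roots: "d ul e = 0" "d ur e = 0"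
    and neg: "\<And>v. v \<in> {ul<..<ur} \<Longrightarrow> d v e < 0"
  shows "\<exists>w. continuous_on {ul..ur} w \<and> w ul = 0 \<and> w ur = 0 \<and>
    (\<forall>v\<in>{ul<..<ur}. 0 < w v \<and> w v < e \<and> d v (e - w v) > 0 \<and> dp v (e - w v) > 0 \<and>
      (w has_real_derivative spine_field e v (w v)) (at v))"
proof -
  have e_pos: "e > 0" using e e0 by linarith
  have v_near: "\<bar>v - u\<^sub>0\<bar> \<le> r" if "v \<in> {ul..ur}" for v
    using that lr unfolding abs_le_iff atLeastAtMost_iff by linarith
  define lo hi where "lo v = 3 / 2 * (- d v e) / \<beta>" and "hi v = 3 * (- d v e) / \<beta>" for v
  have beta_lo: "\<beta> * lo v = 3 / 2 * (- d v e)" and beta_hi: "\<beta> * hi v = 3 * (- d v e)" for v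
    using beta_pos by (simp_all add: lo_def hi_def)
  have between: "lo v \<le> w \<longleftrightarrow> 3 / 2 * (- d v e) \<le> \<beta> * w" "w \<le> hi v \<longleftrightarrow> \<beta> * w \<le> 3 * (- d v e)" for v w
    unfolding beta_lo[symmetric] beta_hi[symmetric] by (simp_all only: mult_le_cancel_left_pos[OF beta_pos])
  have lo_der: "(lo has_real_derivative - 3 / 2 * d1 v e / \<beta>) (at v)" for v
    unfolding lo_def[abs_def]
    by (rule DERIV_cong[OF DERIV_cdivide[OF DERIV_cmult[OF DERIV_minus[OF dv[OF e_pos]]]]]) simp
  have hi_der: "(hi has_real_derivative - 3 * d1 v e / \<beta>) (at v)" for v
    unfolding hi_def[abs_def]
    by (rule DERIV_cong[OF DERIV_cdivide[OF DERIV_cmult[OF DERIV_minus[OF dv[OF e_pos]]]]]) simp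
  have d1_small: "\<bar>d1 v e / \<beta>\<bar> \<le> 1 / 100" if "v \<in> {ul..ur}" for v
  proof -
    have "\<bar>e - e\<^sub>0\<bar> \<le> r" unfolding abs_le_iff using e near_bounds by linarith
    then have "\<bar>d1 v e\<bar> \<le> \<beta> / 100" using r v_near[OF that] unfolding near_def by blast
    then show ?thesis using beta_pos by (simp add: abs_divide pos_divide_le_eq)
  qed
  define R where "R = {(v, w). ul < v \<and> v < ur \<and> lo v \<le> w \<and> w \<le> hi v}"
  have R_signs: "e\<^sub>0 - r \<le> e - w \<and> 0 < (2 * e - w) * d v (e - w) \<and> 0 < w * dp v (e - w) \<and> 0 < w \<and>
      d v (e - w) > 0 \<and> dp v (e - w) > 0"
    if "ul < v" "v < ur" "lo v \<le> w" "w \<le> hi v" for v w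
  proof -
    have v: "v \<in> {ul..ur}" "v \<in> {ul<..<ur}" using that by simp_all
    note w = that(3,4)[unfolded between]
    show ?thesis
      using barrier_region(1,2)[OF v_near[OF v(1)] neg[OF v(2)] w]
        barrier_signs[OF v_near[OF v(1)] neg[OF v(2)] w] by blast
  qed
  have pos_arg: "0 < e - w" if "e\<^sub>0 - r \<le> e - w" for w using that near_bounds e0 by linarith
  have contR: "continuous_on R (\<lambda>x. h (fst x) (e - snd x))"
    if h: "continuous_on (UNIV \<times> {0<..}) (\<lambda>x. h (fst x) (snd x))" for h :: "real \<Rightarrow> real \<Rightarrow> real"
  proof -
    have "continuous_on R (\<lambda>x. (\<lambda>y. h (fst y) (snd y)) (fst x, e - snd x))"
    proof (rule continuous_on_compose2[OF h])
      show "continuous_on R (\<lambda>x. (fst x, e - snd x))" by (intro continuous_intros)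
      show "(\<lambda>x. (fst x, e - snd x)) ` R \<subseteq> UNIV \<times> {0<..}"
        using R_signs pos_arg by (auto simp: R_def)
    qed
    then show ?thesis by simp
  qed
  have F_cont: "continuous_on R (\<lambda>(v, w). spine_field e v w)"
  proof -
    have "continuous_on R (\<lambda>x. spine_field e (fst x) (snd x))"
      unfolding spine_field_def
    proof (intro continuous_intros contR conts ballI)
      fix x assume "x \<in> R"
      then have "0 < (2 * e - snd x) * d (fst x) (e - snd x)" "0 < snd x * dp (fst x) (e - snd x)"
        using R_signs[of "fst x" "snd x"] by (auto simp: R_def)
      then show "(2 * e - snd x) * d (fst x) (e - snd x) + snd x * dp (fst x) (e - snd x) \<noteq> 0"
        by linarith
    qed
    then show ?thesis by (simp add: case_prod_unfold)
  qed
  have lo_le_hi: "lo v \<le> hi v" if "v \<in> {ul..ur}" for v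
  proof -
    have "d v e \<le> 0" using neg[of v] roots that by (cases "v = ul \<or> v = ur") force+
    then have "\<beta> * lo v \<le> \<beta> * hi v" unfolding beta_lo beta_hi by simp
    then show ?thesis by (simp only: mult_le_cancel_left_pos[OF beta_pos])
  qed
  have lohi_root: "lo ul = 0" "hi ul = 0" "lo ur = 0" "hi ur = 0" using roots by (simp_all add: lo_def hi_def)
  obtain w where w: "continuous_on {ul..ur} w" "\<And>t. t \<in> {ul..ur} \<Longrightarrow> lo t \<le> w t \<and> w t \<le> hi t"
    "\<And>t. t \<in> {ul<..<ur} \<Longrightarrow> (w has_real_derivative spine_field e t (w t)) (at t)"
  proof (rule solution_between_barriers[OF lr(2) _ _ lo_der hi_der, of "spine_field e" 1])
    show "continuous_on {ul..ur} lo" "continuous_on {ul..ur} hi"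
      by (intro continuous_at_imp_continuous_on ballI DERIV_isCont[OF lo_der] DERIV_isCont[OF hi_der])+
    show "continuous_on {(t, x). ul < t \<and> t < ur \<and> lo t \<le> x \<and> x \<le> hi t} (\<lambda>(t, x). spine_field e t x)"
      using F_cont unfolding R_def .
    show "\<bar>spine_field e t x\<bar> \<le> 1" if t: "t \<in> {ul<..<ur}" "lo t \<le> x" "x \<le> hi t" for t x
    proof -
      have *: "\<bar>(X - Y) / (X + Y)\<bar> \<le> 1" if "0 < X" "0 < Y" for X Y :: real
        using that by (simp add: abs_le_iff divide_le_eq)
      show ?thesis
        unfolding spine_field_def using R_signs[of t x] t by (intro *) simp_all
    qed
    show "spine_field e t (lo t) \<le> - 3 / 2 * d1 t e / \<beta>" if t: "t \<in> {ul<..<ur}" for t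
    proof -
      have t': "t \<in> {ul..ur}" using t by simp
      have "spine_field e t (lo t) \<le> - 15 / 1000"
        by (rule lower_barrier[OF v_near[OF t'] neg[OF t] beta_lo])
      also have "\<dots> \<le> - 3 / 2 * (d1 t e / \<beta>)" using d1_small[OF t'] unfolding abs_le_iff by linarith
      finally show ?thesis by simp
    qed
    show "- 3 * d1 t e / \<beta> \<le> spine_field e t (hi t)" if t: "t \<in> {ul<..<ur}" for t
    proof -
      have t': "t \<in> {ul..ur}" using t by simp
      have "- 3 * (d1 t e / \<beta>) \<le> 3 / 100" using d1_small[OF t'] unfolding abs_le_iff by linarith
      also have "\<dots> \<le> spine_field e t (hi t)"
        by (rule upper_barrier[OF v_near[OF t'] neg[OF t] beta_hi])
      finally show ?thesis by simp
    qed
  qed (use that lo_le_hi lohi_root in simp_all)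
  have "0 < w v \<and> w v < e \<and> d v (e - w v) > 0 \<and> dp v (e - w v) > 0" if v: "v \<in> {ul<..<ur}" for v
  proof -
    have "lo v \<le> w v" "w v \<le> hi v" using w(2)[of v] v by simp_all
    then have "e\<^sub>0 - r \<le> e - w v \<and> 0 < w v \<and> d v (e - w v) > 0 \<and> dp v (e - w v) > 0"
      using R_signs[of v "w v"] v by simp
    then show ?thesis using pos_arg[of "w v"] by simp
  qed
  moreover have "w ul = 0" "w ur = 0" using w(2)[of ul] w(2)[of ur] lr(2) lohi_root by simp_all
  ultimately show ?thesis using w(1,3) by blast
qed

end

lemma convex_section:
  assumes r: "near r" and e: "\<bar>e - e\<^sub>0\<bar> \<le> r"
  shows "convex_on {u\<^sub>0 - r..u\<^sub>0 + r} (\<lambda>v. d v e)"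
proof (rule convex_on_realI[where f' = "\<lambda>v. d1 v e"])
  have r0: "0 < r" "r \<le> e\<^sub>0 / 100" using r unfolding near_def by blast+
  then have e_pos: "e > 0" using e e0 unfolding abs_le_iff by linarith
  show "((\<lambda>v. d v e) has_real_derivative d1 v e) (at v)" for v by (rule dv[OF e_pos])
  fix x y assume xy: "x \<in> {u\<^sub>0 - r..u\<^sub>0 + r}" "y \<in> {u\<^sub>0 - r..u\<^sub>0 + r}" "x \<le> y"
  show "d1 x e \<le> d1 y e"
  proof (rule DERIV_nonneg_imp_nondecreasing[OF xy(3)])
    fix v assume "x \<le> v" "v \<le> y"
    then have "\<bar>v - u\<^sub>0\<bar> \<le> r" using xy unfolding abs_le_iff atLeastAtMost_iff by linarith
    then have "d2 v e > 0" using r e unfolding near_def by blast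
    then show "\<exists>D. ((\<lambda>v. d1 v e) has_real_derivative D) (at v) \<and> D \<ge> 0"
      using d1v[OF e_pos] by (intro exI[of _ "d2 v e"]) simp
  qed
qed simp

text \<open>The graph lies below its chord. The minimum and maximum admit either order of
  \<open>x\<close> and \<open>z\<close>, since the lemma is applied on both sides of the
  tangency.\<close>

lemma convex_neg_between:
  fixes h :: "real \<Rightarrow> real"
  assumes conv: "convex_on I h" and mem: "x \<in> I" "z \<in> I"
    and h: "h x \<le> 0" "h z < 0" and v: "v \<in> {min x z<..<max x z}"
  shows "h v < 0"
proof -
  define t where "t = (v - x) / (z - x)"
  have t: "0 < t" "t < 1"
    using v by (auto simp: t_def min_def max_def divide_simps split: if_splits)
  have "z \<noteq> x" using v by auto
  then have "t * (z - x) = v - x" by (simp add: t_def)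
  then have veq: "(1 - t) *\<^sub>R x + t *\<^sub>R z = v" by (simp add: algebra_simps)
  have "h ((1 - t) *\<^sub>R x + t *\<^sub>R z) \<le> (1 - t) * h x + t * h z"
    using convex_onD[OF conv, of t x z] t mem by simp
  moreover have "(1 - t) * h x \<le> 0" "t * h z < 0"
    using t h by (auto intro: mult_nonneg_nonpos mult_pos_neg)
  ultimately show ?thesis unfolding veq by linarith
qed

theorem bifurcation:
  "\<exists>e\<^sub>1>e\<^sub>0. \<forall>e\<in>{e\<^sub>0<..<e\<^sub>1}. \<exists>ul ur. u\<^sub>1 < ul \<and> ul < ur \<and> ur < u\<^sub>2 \<and> d ul e = 0 \<and> d ur e = 0 \<and>
    (\<forall>v\<in>{u\<^sub>1..u\<^sub>2}. 0 \<le> dp v e) \<and> (\<forall>v\<in>{u\<^sub>1..ul} \<union> {ur..u\<^sub>2}. 0 \<le> d v e) \<and>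
    (\<exists>w. continuous_on {ul..ur} w \<and> w ul = 0 \<and> w ur = 0 \<and>
    (\<forall>v\<in>{ul<..<ur}. 0 < w v \<and> w v < e \<and> d v (e - w v) > 0 \<and> dp v (e - w v) > 0 \<and>
      (w has_real_derivative spine_field e v (w v)) (at v)))"
proof -
  obtain r where r: "near r" using near_exists by blast
  have rr: "0 < r" "r \<le> e\<^sub>0 / 100" "u\<^sub>1 < u\<^sub>0 - r" "u\<^sub>0 + r < u\<^sub>2"
    using r unfolding near_def by blast+
  \<comment> \<open>Away from \<open>u\<^sub>0\<close>, \<open>d\<close> stays positive by
    compactness; the remaining window is treated by convexity.\<close>
  define K where "K = {u\<^sub>1..u\<^sub>0 - r} \<union> {u\<^sub>0 + r..u\<^sub>2}"
  have K: "compact K" unfolding K_def by (intro compact_Un compact_Icc)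
  have "d v e\<^sub>0 > 0" if "v \<in> K" for v
    using that rr u by (intro d_pos) (auto simp: K_def)
  from tube_pos[OF K conts(1) this] obtain \<delta>1 where \<delta>1: "\<delta>1 > 0"
    and dK: "\<And>e v. \<bar>e - e\<^sub>0\<bar> < \<delta>1 \<Longrightarrow> v \<in> K \<Longrightarrow> d v e > 0" by blast
  from tube_pos[OF compact_Icc conts(2) dp_pos] obtain \<delta>2 where \<delta>2: "\<delta>2 > 0"
    and dpK: "\<And>e v. \<bar>e - e\<^sub>0\<bar> < \<delta>2 \<Longrightarrow> v \<in> {u\<^sub>1..u\<^sub>2} \<Longrightarrow> dp v e > 0" by blast
  define e1 where "e1 = e\<^sub>0 + min (min \<delta>1 \<delta>2) (r / 4)"
  have "e1 > e\<^sub>0" using \<delta>1 \<delta>2 rr by (simp add: e1_def)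
  moreover have "\<exists>ul ur. u\<^sub>1 < ul \<and> ul < ur \<and> ur < u\<^sub>2 \<and> d ul e = 0 \<and> d ur e = 0 \<and>
    (\<forall>v\<in>{u\<^sub>1..u\<^sub>2}. 0 \<le> dp v e) \<and> (\<forall>v\<in>{u\<^sub>1..ul} \<union> {ur..u\<^sub>2}. 0 \<le> d v e) \<and>
    (\<exists>w. continuous_on {ul..ur} w \<and> w ul = 0 \<and> w ur = 0 \<and>
    (\<forall>v\<in>{ul<..<ur}. 0 < w v \<and> w v < e \<and> d v (e - w v) > 0 \<and> dp v (e - w v) > 0 \<and>
      (w has_real_derivative spine_field e v (w v)) (at v)))"
    if "e \<in> {e\<^sub>0<..<e1}" for e
  proof -
    have "e\<^sub>0 < e" "e < e1" using that by simp_all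
    moreover have "e1 \<le> e\<^sub>0 + \<delta>1" "e1 \<le> e\<^sub>0 + \<delta>2" "e1 \<le> e\<^sub>0 + r / 4" by (simp_all add: e1_def)
    ultimately have e: "e\<^sub>0 < e" "e \<le> e\<^sub>0 + r / 4" and e\<delta>: "\<bar>e - e\<^sub>0\<bar> < \<delta>1" "\<bar>e - e\<^sub>0\<bar> < \<delta>2"
      unfolding abs_less_iff by linarith+
    have er: "\<bar>e - e\<^sub>0\<bar> \<le> r" unfolding abs_le_iff using e rr by linarith
    have e_pos: "e > 0" using e e0 by linarith
    let ?\<phi> = "\<lambda>v. d v e"
    have cont: "continuous_on A ?\<phi>" for A
      by (intro continuous_at_imp_continuous_on ballI DERIV_isCont[OF dv[OF e_pos]])
    have "97 / 100 * \<beta> * (e - e\<^sub>0) \<le> d u\<^sub>0 e\<^sub>0 - d u\<^sub>0 e"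
      by (rule e_slope(1)[OF r _ _ e(1)]) (use e rr in simp_all)
    moreover have "0 < 97 / 100 * \<beta> * (e - e\<^sub>0)" using beta_pos e by simp
    ultimately have mid: "d u\<^sub>0 e < 0" using root(1) by linarith
    have ends: "d (u\<^sub>0 - r) e > 0" "d (u\<^sub>0 + r) e > 0"
      using rr by (auto intro!: dK[OF e\<delta>(1)] simp: K_def)
    obtain ul where ul: "u\<^sub>0 - r \<le> ul" "ul \<le> u\<^sub>0" "d ul e = 0"
      using IVT2'[of ?\<phi> u\<^sub>0 0 "u\<^sub>0 - r"] ends mid rr cont by auto
    obtain ur where ur: "u\<^sub>0 \<le> ur" "ur \<le> u\<^sub>0 + r" "d ur e = 0"
      using IVT'[of ?\<phi> u\<^sub>0 0 "u\<^sub>0 + r"] ends mid rr cont by auto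
    have "ul \<noteq> u\<^sub>0" "ur \<noteq> u\<^sub>0" using mid ul(3) ur(3) by auto
    then have lt: "ul < u\<^sub>0" "u\<^sub>0 < ur" using ul ur by simp_all
    note conv = convex_section[OF r er]
    have I: "ul \<in> {u\<^sub>0 - r..u\<^sub>0 + r}" "ur \<in> {u\<^sub>0 - r..u\<^sub>0 + r}" "u\<^sub>0 \<in> {u\<^sub>0 - r..u\<^sub>0 + r}"
      using ul ur lt rr unfolding atLeastAtMost_iff by linarith+
    have neg: "d v e < 0" if "v \<in> {ul<..<ur}" for v
    proof -
      consider "v < u\<^sub>0" | "v = u\<^sub>0" | "u\<^sub>0 < v" by linarith
      then show ?thesis
      proof cases
        case 1
        then show ?thesis
          using convex_neg_between[OF conv I(1,3), of v] ul mid that lt by simp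
      next
        case 3
        then show ?thesis
          using convex_neg_between[OF conv I(2,3), of v] ur mid that lt by simp
      qed (simp add: mid)
    qed
    have nonneg: "0 \<le> d v e" if v: "v \<in> {u\<^sub>1..ul} \<union> {ur..u\<^sub>2}" for v
    \<comment> \<open>A negative value beyond a root, together with the negative value at
      \<open>u\<^sub>0\<close>, would by convexity make \<open>d\<close> negative at the root
      itself.\<close>
    proof (rule ccontr)
      assume n: "\<not> 0 \<le> d v e"
      then have "v \<notin> K" using dK[OF e\<delta>(1), of v] by force
      then have vI: "v \<in> {u\<^sub>0 - r..u\<^sub>0 + r}" using v ul ur rr lt unfolding K_def by auto
      have "v \<noteq> ul" "v \<noteq> ur" using n ul(3) ur(3) by auto
      then consider "v < ul" | "ur < v" using v by auto
      then show False
      proof cases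
        case 1
        then show False
          using convex_neg_between[OF conv vI I(3), of ul] n mid lt ul(3) by simp
      next
        case 2
        then show False
          using convex_neg_between[OF conv vI I(3), of ur] n mid lt ur(3) by simp
      qed
    qed
    have "ul < ur" using lt by linarith
    from spine_in_section[OF r e ul(1) this ur(2) ul(3) ur(3) neg]
    show ?thesis
      using ul ur rr \<open>ul < ur\<close> nonneg dpK[OF e\<delta>(2)]
      by (rule_tac exI[of _ ul], rule_tac exI[of _ ur], intro conjI ballI) (auto intro: less_imp_le)
  qed
  ultimately show ?thesis by blast
qed

end


section \<open>The foliation\<close>

lemma herringbone_foliation_from_section:
  fixes f g f' f'' g' g'' w :: "real \<Rightarrow> real" and d dp :: "real \<Rightarrow> real \<Rightarrow> real"
  assumes eps: "\<epsilon> > 0" and lr: "u\<^sub>1 < ul" "ul < ur" "ur < u\<^sub>2"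
    and f: "\<And>x. (f has_real_derivative f' x) (at x)" "\<And>x. (f' has_real_derivative f'' x) (at x)"
    and g: "\<And>x. (g has_real_derivative g' x) (at x)" "\<And>x. (g' has_real_derivative g'' x) (at x)"
    and cont: "continuous_on UNIV f''" "continuous_on UNIV g''"
    and d: "\<And>v e. d v e = (g' (v + e) - f' (v - e)) / (2 * e) - g'' (v + e)"
    and dp: "\<And>v e. dp v e = (g' (v + e) - f' (v - e)) / (2 * e) - f'' (v - e)"
    and dp_nonneg: "\<And>v. v \<in> {u\<^sub>1..u\<^sub>2} \<Longrightarrow> 0 \<le> dp v \<epsilon>"
    and d_nonneg: "\<And>v. v \<in> {u\<^sub>1..ul} \<union> {ur..u\<^sub>2} \<Longrightarrow> 0 \<le> d v \<epsilon>"
    and w: "continuous_on {ul..ur} w" "w ul = 0" "w ur = 0"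
    and w_in: "\<And>v. v \<in> {ul<..<ur} \<Longrightarrow> 0 < w v \<and> w v < \<epsilon> \<and> d v (\<epsilon> - w v) > 0 \<and> dp v (\<epsilon> - w v) > 0"
    and w_deriv: "\<And>v. v \<in> {ul<..<ur} \<Longrightarrow> (w has_real_derivative
       ((2 * \<epsilon> - w v) * d v (\<epsilon> - w v) - w v * dp v (\<epsilon> - w v)) /
       ((2 * \<epsilon> - w v) * d v (\<epsilon> - w v) + w v * dp v (\<epsilon> - w v))) (at v)"
  shows "\<exists>B T.
         C1_smooth_on (left_parallelogram \<epsilon> u\<^sub>1 u\<^sub>2) B \<and>
         diagonally_concave_on (left_parallelogram \<epsilon> u\<^sub>1 u\<^sub>2) B \<and>
         boundary_values \<epsilon> f g (left_parallelogram \<epsilon> u\<^sub>1 u\<^sub>2) B \<and>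
         left_simple_candidate \<epsilon> f g u\<^sub>1 ul B \<and>
         left_simple_candidate \<epsilon> f g ur u\<^sub>2 B \<and>
         left_herringbone_candidate \<epsilon> f g (ul + \<epsilon>) (ur + \<epsilon>) T B \<and>
         T (ul + \<epsilon>) = -\<epsilon> \<and> T (ur + \<epsilon>) = -\<epsilon> \<and>
         (\<forall>u\<in>{ul + \<epsilon>..ur + \<epsilon>}. T u \<noteq> 0) \<and>
         herringbone_domain \<epsilon> (ul + \<epsilon>) (ur + \<epsilon>) T = left_parallelogram \<epsilon> ul ur"
proof -
  define p q a b where "p = ul + \<epsilon>" and "q = ur + \<epsilon>" and "a = u\<^sub>1 + \<epsilon>" and "b = u\<^sub>2 + \<epsilon>"
  define X where "X v = (2 * \<epsilon> - w v) * d v (\<epsilon> - w v)" for v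
  define Y where "Y v = w v * dp v (\<epsilon> - w v)" for v
  have XY: "0 < X v" "0 < Y v" if "v \<in> {ul<..<ur}" for v
  proof -
    have "2 * \<epsilon> - w v > 0" using w_in[OF that] eps by linarith
    then show "0 < X v" "0 < Y v" using w_in[OF that] by (simp_all add: X_def Y_def)
  qed
  \<comment> \<open>Clamping \<open>u - \<epsilon>\<close> into \<open>{ul..ur}\<close> extends the
    height by its end values 0, that is, the spine by -\<epsilon>.\<close>
  define T where "T u = w (max ul (min ur (u - \<epsilon>))) - \<epsilon>" for u
  define T' where "T' u = (X (u - \<epsilon>) - Y (u - \<epsilon>)) / (X (u - \<epsilon>) + Y (u - \<epsilon>))" for u
  have T_section: "T u = w (u - \<epsilon>) - \<epsilon>" if "u \<in> {p..q}" for u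
    using that by (simp add: T_def p_def q_def)
  have T_outside: "T u = -\<epsilon>" if "u \<notin> {p<..<q}" for u
  proof -
    have "u \<le> p \<or> q \<le> u" using that by auto
    then have "max ul (min ur (u - \<epsilon>)) = ul \<or> max ul (min ur (u - \<epsilon>)) = ur"
      using lr by (auto simp: p_def q_def)
    then show ?thesis using w by (auto simp: T_def)
  qed
  have sec: "u - \<epsilon> \<in> {ul<..<ur}" if "u \<in> {p<..<q}" for u
    using that by (auto simp: p_def q_def)
  interpret extended_spine \<epsilon> p q a b T T' f f' f'' g g' g''
  proof
    show "a \<le> p" "p < q" "q \<le> b" using lr by (simp_all add: p_def q_def a_def b_def)
    show "continuous_on UNIV T"
      unfolding T_def
    proof (intro continuous_on_diff continuous_on_const continuous_on_compose2[OF w(1)])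
      show "continuous_on UNIV (\<lambda>u. max ul (min ur (u - \<epsilon>)))"
        by (intro continuous_on_max continuous_on_min continuous_on_diff continuous_on_const continuous_on_id)
    qed (use lr in auto)
    show "T u = -\<epsilon>" if "u \<notin> {p<..<q}" for u by (rule T_outside[OF that])
    fix u assume u: "u \<in> {p<..<q}"
    then have Tu: "T u = w (u - \<epsilon>) - \<epsilon>" by (intro T_section) simp
    show "-\<epsilon> < T u \<and> T u < 0" unfolding Tu using w_in[OF sec[OF u]] by simp
    have W: "(w has_real_derivative T' u) (at (u - \<epsilon>))"
      using w_deriv[OF sec[OF u]] unfolding T'_def X_def Y_def .
    have "((\<lambda>u. u - \<epsilon>) has_real_derivative 1) (at u)" by (auto intro!: derivative_eq_intros)
    from DERIV_diff[OF DERIV_chain2[OF W this] DERIV_const, of \<epsilon>]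
    have "((\<lambda>u. w (u - \<epsilon>) - \<epsilon>) has_real_derivative T' u) (at u)"
      by (simp only: mult_1_right diff_0_right)
    then show "(T has_real_derivative T' u) (at u)"
      by (rule has_field_derivative_transform_within_open[of _ _ _ "{p<..<q}"])
        (use u T_section in auto)
    have "\<bar>(x - y) / (x + y)\<bar> < 1" if "0 < x" "0 < y" for x y :: real
      using that by (simp add: abs_divide divide_less_eq abs_less_iff)
    then show "\<bar>T' u\<bar> < 1"
      unfolding T'_def using XY[OF sec[OF u]] by blast
  qed (use eps f g in auto)
  have DmDp: "Dm u = d (u - \<epsilon>) (- T u)" "Dp u = dp (u - \<epsilon>) (- T u)" for u
  proof -
    \<comment> \<open>The D-functions are evaluated at first coordinate
      \<open>u - \<epsilon>\<close> and depth \<open>- T u\<close>, and the rib ends are the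
      arguments of \<open>f'\<close> and \<open>g'\<close> there.\<close>
    have args: "yy u = u - \<epsilon> - - T u" "zz u = u - \<epsilon> + - T u" by (simp_all add: yy_def zz_def)
    have neg: "(y - x) / (2 * - t) = (x - y) / (2 * t)" for x y t :: real
      unfolding mult_minus_right divide_minus_right minus_divide_left minus_diff_eq by (rule refl)
    show "Dm u = d (u - \<epsilon>) (- T u)" "Dp u = dp (u - \<epsilon>) (- T u)"
      unfolding Dm_def Dp_def Q_def d dp args[symmetric] unfolding neg by (rule refl)+
  qed
  have D_in: "Dm u = d (u - \<epsilon>) (\<epsilon> - w (u - \<epsilon>))" "Dp u = dp (u - \<epsilon>) (\<epsilon> - w (u - \<epsilon>))" "T u = w (u - \<epsilon>) - \<epsilon>"
    if "u \<in> {p<..<q}" for u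
  proof -
    have "u \<in> {p..q}" using that by simp
    then show T: "T u = w (u - \<epsilon>) - \<epsilon>" by (rule T_section)
    show "Dm u = d (u - \<epsilon>) (\<epsilon> - w (u - \<epsilon>))" "Dp u = dp (u - \<epsilon>) (\<epsilon> - w (u - \<epsilon>))"
      unfolding DmDp T minus_diff_eq by (rule refl)+
  qed
  interpret herringbone_spine \<epsilon> p q a b T T' f f' f'' g g' g''
  proof
    fix u assume u: "u \<in> {p<..<q}"
    let ?X = "X (u - \<epsilon>)" and ?Y = "Y (u - \<epsilon>)"
    have pos: "?X + ?Y \<noteq> 0" using XY[OF sec[OF u]] by simp
    have "(\<epsilon> - T u) * Dm u = ?X" "(\<epsilon> + T u) * Dp u = ?Y"
      unfolding D_in[OF u] X_def Y_def by simp_all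
    moreover have "?X * (1 - T' u) = ?Y * (1 + T' u)"
      using pos by (simp add: T'_def field_simps)
    ultimately show "(\<epsilon> - T u) * Dm u * (1 - T' u) = (\<epsilon> + T u) * Dp u * (1 + T' u)" by simp
  next
    fix u assume u: "u \<in> {a..b}"
    show "0 \<le> Dp u \<and> 0 \<le> Dm u"
    proof (cases "u \<in> {p<..<q}")
      case True
      then show ?thesis unfolding D_in[OF True] using w_in[OF sec[OF True]] by simp
    next
      case False
      have v: "u - \<epsilon> \<in> {u\<^sub>1..u\<^sub>2}" "u - \<epsilon> \<in> {u\<^sub>1..ul} \<union> {ur..u\<^sub>2}"
        using u False by (auto simp: a_def b_def p_def q_def)
      show ?thesis
        unfolding DmDp T_outside[OF False] using dp_nonneg[OF v(1)] d_nonneg[OF v(2)] by simp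
    qed
  qed
  have edges: "p - \<epsilon> = ul" "q - \<epsilon> = ur" "a - \<epsilon> = u\<^sub>1" "b - \<epsilon> = u\<^sub>2"
    by (simp_all add: p_def q_def a_def b_def)
  have S: "left_parallelogram \<epsilon> u\<^sub>1 u\<^sub>2 \<subseteq> S" by (simp add: S_def edges)
  have "Dp u > 0" if "u \<in> {p<..<q}" for u
    unfolding D_in[OF that] using w_in[OF sec[OF that]] by simp
  from herringbone_candidate[OF this cont]
  have cand: "left_herringbone_candidate \<epsilon> f g (ul + \<epsilon>) (ur + \<epsilon>) T B"
    unfolding p_def q_def by simp
  have dom: "herringbone_domain \<epsilon> (ul + \<epsilon>) (ur + \<epsilon>) T = left_parallelogram \<epsilon> ul ur"
    using herringbone_domain_eq unfolding edges unfolding p_def q_def .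
  have simple: "left_simple_candidate \<epsilon> f g u\<^sub>1 ul B" "left_simple_candidate \<epsilon> f g ur u\<^sub>2 B"
    by (rule B_simple; use lr in \<open>simp add: edges\<close>)+
  have ends: "T (ul + \<epsilon>) = -\<epsilon>" "T (ur + \<epsilon>) = -\<epsilon>"
    by (rule T_outside; simp add: p_def q_def)+
  show ?thesis
    using B_C1[OF S] B_concave[OF S] B_boundary[OF S] simple cand dom ends T_nz by blast
qed

lemma of_class_C_deriv:
  assumes "of_class_C k f" "j < k"
  shows "((deriv ^^ j) f has_real_derivative (deriv ^^ Suc j) f x) (at x)"
  using assms unfolding of_class_C_def
  by (simp add: DERIV_deriv_iff_real_differentiable)

lemma D_minus_below_axis: "e \<noteq> 0 \<Longrightarrow> D_minus f\<^sub>p f\<^sub>m (v, - e) =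
    (deriv f\<^sub>m (v + e) - deriv f\<^sub>p (v - e)) / (2 * e) - deriv (deriv f\<^sub>m) (v + e)"
  by (simp add: D_minus_def field_simps)

lemma D_plus_below_axis: "e \<noteq> 0 \<Longrightarrow> D_plus f\<^sub>p f\<^sub>m (v, - e) =
    (deriv f\<^sub>m (v + e) - deriv f\<^sub>p (v - e)) / (2 * e) - deriv (deriv f\<^sub>p) (v - e)"
  by (simp add: D_plus_def field_simps)

theorem theorem8p4:
  fixes f\<^sub>p f\<^sub>m :: "real \<Rightarrow> real" and u\<^sub>0 u\<^sub>1 u\<^sub>2 \<epsilon>\<^sub>m \<epsilon>\<^sub>0 :: real
  assumes "of_class_C 4 f\<^sub>p" and "of_class_C 4 f\<^sub>m"
    and "u\<^sub>1 < u\<^sub>0" and "u\<^sub>0 < u\<^sub>2" and "0 \<le> \<epsilon>\<^sub>m" and "\<epsilon>\<^sub>m < \<epsilon>\<^sub>0"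
    and "\<And>u \<epsilon>. u \<in> {u\<^sub>1..u\<^sub>2} \<Longrightarrow> \<epsilon> \<in> {\<epsilon>\<^sub>m<..<\<epsilon>\<^sub>0} \<Longrightarrow>
           D_plus f\<^sub>p f\<^sub>m (u, -\<epsilon>) > 0 \<and> D_minus f\<^sub>p f\<^sub>m (u, -\<epsilon>) > 0"
    and "root_of_order 1 (\<lambda>\<epsilon>. D_minus f\<^sub>p f\<^sub>m (u\<^sub>0, -\<epsilon>)) \<epsilon>\<^sub>0"
    and "\<And>u. u \<in> {u\<^sub>1..u\<^sub>2} - {u\<^sub>0} \<Longrightarrow> D_minus f\<^sub>p f\<^sub>m (u, -\<epsilon>\<^sub>0) > 0"
    and "\<And>u. u \<in> {u\<^sub>1..u\<^sub>2} \<Longrightarrow> D_plus f\<^sub>p f\<^sub>m (u, -\<epsilon>\<^sub>0) > 0"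
    and "root_of_order 2 (\<lambda>u. D_minus f\<^sub>p f\<^sub>m (u, -\<epsilon>\<^sub>0)) u\<^sub>0"
  shows "\<exists>\<epsilon>\<^sub>p>\<epsilon>\<^sub>0. \<forall>\<epsilon>\<in>{\<epsilon>\<^sub>0<..<\<epsilon>\<^sub>p}.
    \<exists>u\<^sub>l u\<^sub>r. u\<^sub>1 < u\<^sub>l \<and> u\<^sub>l < u\<^sub>r \<and> u\<^sub>r < u\<^sub>2 \<and>
      D_minus f\<^sub>p f\<^sub>m (u\<^sub>l, -\<epsilon>) = 0 \<and> D_minus f\<^sub>p f\<^sub>m (u\<^sub>r, -\<epsilon>) = 0 \<and>
      (\<exists>B T.
         C1_smooth_on (left_parallelogram \<epsilon> u\<^sub>1 u\<^sub>2) B \<and>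
         diagonally_concave_on (left_parallelogram \<epsilon> u\<^sub>1 u\<^sub>2) B \<and>
         boundary_values \<epsilon> f\<^sub>p f\<^sub>m (left_parallelogram \<epsilon> u\<^sub>1 u\<^sub>2) B \<and>
         left_simple_candidate \<epsilon> f\<^sub>p f\<^sub>m u\<^sub>1 u\<^sub>l B \<and>
         left_simple_candidate \<epsilon> f\<^sub>p f\<^sub>m u\<^sub>r u\<^sub>2 B \<and>
         left_herringbone_candidate \<epsilon> f\<^sub>p f\<^sub>m (u\<^sub>l + \<epsilon>) (u\<^sub>r + \<epsilon>) T B \<and>
         T (u\<^sub>l + \<epsilon>) = -\<epsilon> \<and> T (u\<^sub>r + \<epsilon>) = -\<epsilon> \<and>
         (\<forall>u\<in>{u\<^sub>l + \<epsilon>..u\<^sub>r + \<epsilon>}. T u \<noteq> 0) \<and>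
         herringbone_domain \<epsilon> (u\<^sub>l + \<epsilon>) (u\<^sub>r + \<epsilon>) T = left_parallelogram \<epsilon> u\<^sub>l u\<^sub>r)"
proof -
  define P M where "P j = (deriv ^^ j) f\<^sub>p" and "M j = (deriv ^^ j) f\<^sub>m" for j
  have P: "(P j has_real_derivative P (Suc j) x) (at x)"
    and M: "(M j has_real_derivative M (Suc j) x) (at x)" if "j < 4" for j x
    unfolding P_def M_def using of_class_C_deriv assms(1,2) that by blast+
  have P0: "P 0 = f\<^sub>p" "M 0 = f\<^sub>m" by (simp_all add: P_def M_def)
  have PM: "deriv f\<^sub>p = P 1" "deriv (P 1) = P 2" "deriv f\<^sub>m = M 1" "deriv (M 1) = M 2"
    by (simp_all add: P_def M_def numeral_2_eq_2)
  have PM_UNIV: "continuous_on UNIV (P j) \<and> continuous_on UNIV (M j)" if "j \<le> 4" for j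
  proof (cases "j = 4")
    case True
    then show ?thesis using assms(1,2) by (simp add: of_class_C_def P_def M_def)
  next
    case False
    then have j: "j < 4" using that by simp
    show ?thesis
      by (intro conjI continuous_at_imp_continuous_on ballI DERIV_isCont[OF P[OF j]] DERIV_isCont[OF M[OF j]])
  qed
  have PM_cont: "continuous_on A (P j)" "continuous_on A (M j)" if "j \<le> 4" for j A
    by (rule continuous_on_subset[OF conjunct1[OF PM_UNIV[OF that]] subset_UNIV]
        continuous_on_subset[OF conjunct2[OF PM_UNIV[OF that]] subset_UNIV])+
  define d where "d v e = (M 1 (v + e) - P 1 (v - e)) / (2 * e) - M 2 (v + e)" for v e
  define dp where "dp v e = (M 1 (v + e) - P 1 (v - e)) / (2 * e) - P 2 (v - e)" for v e
  define d1 where "d1 v e = (M 2 (v + e) - P 2 (v - e)) / (2 * e) - M 3 (v + e)" for v e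
  \<comment> \<open>The fourth derivative of \<open>f\<^sub>m\<close> enters here; its continuity
    keeps \<open>d2\<close> positive near the tangency.\<close>
  define d2 where "d2 v e = (M 3 (v + e) - P 3 (v - e)) / (2 * e) - M 4 (v + e)" for v e
  have D: "D_minus f\<^sub>p f\<^sub>m (v, - e) = d v e" "D_plus f\<^sub>p f\<^sub>m (v, - e) = dp v e" if "e > 0" for v e
  proof -
    have "e \<noteq> 0" using that by simp
    show "D_minus f\<^sub>p f\<^sub>m (v, - e) = d v e" "D_plus f\<^sub>p f\<^sub>m (v, - e) = dp v e"
      unfolding d_def dp_def D_minus_below_axis[OF \<open>e \<noteq> 0\<close>] D_plus_below_axis[OF \<open>e \<noteq> 0\<close>] PM by (rule refl)+
  qed
  have e0: "\<epsilon>\<^sub>0 > 0" using assms(5,6) by linarith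
  have Mv: "((\<lambda>v. M j (v + e)) has_real_derivative M (Suc j) (v + e)) (at v)"
    and Pv: "((\<lambda>v. P j (v - e)) has_real_derivative P (Suc j) (v - e)) (at v)" if "j < 4" for j v e
  proof -
    have "((\<lambda>v. v + e) has_real_derivative 1) (at v)" "((\<lambda>v. v - e) has_real_derivative 1) (at v)"
      by (auto intro!: derivative_eq_intros)
    from DERIV_chain2[OF M[OF that] this(1)] DERIV_chain2[OF P[OF that] this(2)]
    show "((\<lambda>v. M j (v + e)) has_real_derivative M (Suc j) (v + e)) (at v)"
      "((\<lambda>v. P j (v - e)) has_real_derivative P (Suc j) (v - e)) (at v)"
      by (simp_all only: mult_1_right)
  qed
  have Me: "((\<lambda>e. M j (v + e)) has_real_derivative M (Suc j) (v + e)) (at e)"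
    and Pe: "((\<lambda>e. P j (v - e)) has_real_derivative - P (Suc j) (v - e)) (at e)" if "j < 4" for j v e
  proof -
    have "((\<lambda>e. v + e) has_real_derivative 1) (at e)" "((\<lambda>e. v - e) has_real_derivative - 1) (at e)"
      by (auto intro!: derivative_eq_intros)
    from DERIV_chain2[OF M[OF that] this(1)] DERIV_chain2[OF P[OF that] this(2)]
    show "((\<lambda>e. M j (v + e)) has_real_derivative M (Suc j) (v + e)) (at e)"
      "((\<lambda>e. P j (v - e)) has_real_derivative - P (Suc j) (v - e)) (at e)"
      by (simp_all only: mult_1_right mult_minus_right)
  qed
  have sucs: "Suc 1 = 2" "Suc 2 = 3" "Suc 3 = 4" by simp_all
  have lt: "(1::nat) < 4" "(2::nat) < 4" "(3::nat) < 4" by simp_all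
  note der1 = Mv[OF lt(1), unfolded sucs] Pv[OF lt(1), unfolded sucs] Me[OF lt(1), unfolded sucs] Pe[OF lt(1), unfolded sucs]
  note der2 = Mv[OF lt(2), unfolded sucs] Pv[OF lt(2), unfolded sucs] Me[OF lt(2), unfolded sucs]
  note der3 = Mv[OF lt(3), unfolded sucs]
  have dv: "((\<lambda>v. d v e) has_real_derivative d1 v e) (at v)" for v e
    unfolding d_def d1_def
    by (rule DERIV_diff[OF DERIV_cdivide[OF DERIV_diff[OF der1(1,2)]] der2(1)])
  have d1v: "((\<lambda>v. d1 v e) has_real_derivative d2 v e) (at v)" for v e
    unfolding d1_def d2_def
    by (rule DERIV_diff[OF DERIV_cdivide[OF DERIV_diff[OF der2(1,2)]] der3(1)])
  \<comment> \<open>The algebra behind the derivative of \<open>d\<close> in \<open>e\<close>: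
    \<open>x\<close>, \<open>y\<close>, \<open>m\<close> stand for \<open>M 2\<close>,
    \<open>P 2\<close>, \<open>M 3\<close>, and \<open>c\<close> for the difference of the first
    derivatives.\<close>
  have quotient: "((x - - y) * (2 * e) - c * 2) / (2 * e * (2 * e)) - m = (x - y) / (2 * e) - m - (c / (2 * e) - y) / e"
    if "e \<noteq> 0" for x y c e m :: real
    using that by (simp add: divide_simps) (simp add: algebra_simps)
  have coord: "continuous_on A (\<lambda>x. h (fst x + snd x))" "continuous_on A (\<lambda>x. h (fst x - snd x))"
    if "continuous_on UNIV h" for h :: "real \<Rightarrow> real" and A :: "(real \<times> real) set"
    by (rule continuous_on_compose2[OF that]; auto intro!: continuous_intros)+
  interpret tang: tangency d dp d1 d2 u\<^sub>0 u\<^sub>1 u\<^sub>2 \<epsilon>\<^sub>0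
  proof
    show "(d v has_real_derivative d1 v e - dp v e / e) (at e)" if "e > 0" for v e
    proof -
      have "((\<lambda>e. (M 1 (v + e) - P 1 (v - e)) / (2 * e) - M 2 (v + e)) has_real_derivative
          ((M 2 (v + e) - - P 2 (v - e)) * (2 * e) - (M 1 (v + e) - P 1 (v - e)) * 2) / (2 * e * (2 * e))
          - M 3 (v + e)) (at e)"
        by (rule DERIV_diff[OF DERIV_divide[OF DERIV_diff[OF der1(3,4)] DERIV_cmult_Id] der2(3)])
          (use that in simp)
      moreover have "e \<noteq> 0" using that by simp
      ultimately show ?thesis unfolding d_def d1_def dp_def quotient[OF \<open>e \<noteq> 0\<close>] by blast
    qed
    show "continuous_on (UNIV \<times> {0<..}) (\<lambda>x. d (fst x) (snd x))"
      "continuous_on (UNIV \<times> {0<..}) (\<lambda>x. dp (fst x) (snd x))"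
      "continuous_on (UNIV \<times> {0<..}) (\<lambda>x. d1 (fst x) (snd x))"
      "continuous_on (UNIV \<times> {0<..}) (\<lambda>x. d2 (fst x) (snd x))"
      unfolding d_def dp_def d1_def d2_def
      by (intro continuous_on_diff continuous_on_divide coord PM_cont continuous_on_mult
          continuous_on_const continuous_on_snd continuous_on_id; force)+
    have fn: "(\<lambda>u. D_minus f\<^sub>p f\<^sub>m (u, -\<epsilon>\<^sub>0)) = (\<lambda>v. d v \<epsilon>\<^sub>0)" by (simp only: D(1)[OF e0])
    have dd: "deriv (\<lambda>v. d v \<epsilon>\<^sub>0) = (\<lambda>v. d1 v \<epsilon>\<^sub>0)" "deriv (\<lambda>v. d1 v \<epsilon>\<^sub>0) = (\<lambda>v. d2 v \<epsilon>\<^sub>0)"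
      using DERIV_imp_deriv[OF dv] DERIV_imp_deriv[OF d1v] by auto
    have "\<forall>j<2. (deriv ^^ j) (\<lambda>v. d v \<epsilon>\<^sub>0) u\<^sub>0 = 0" "(deriv ^^ 2) (\<lambda>v. d v \<epsilon>\<^sub>0) u\<^sub>0 \<noteq> 0"
      using assms(11) unfolding root_of_order_def fn by blast+
    from this(1)[rule_format, of 0] this(1)[rule_format, of 1] this(2)
    show "d u\<^sub>0 \<epsilon>\<^sub>0 = 0" "d1 u\<^sub>0 \<epsilon>\<^sub>0 = 0" "d2 u\<^sub>0 \<epsilon>\<^sub>0 \<noteq> 0"
      by (simp_all add: numeral_2_eq_2 dd)
    show "d v \<epsilon>\<^sub>0 > 0" if "v \<in> {u\<^sub>1..u\<^sub>2} - {u\<^sub>0}" for v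
      using assms(9)[OF that] unfolding D(1)[OF e0] .
    show "dp v \<epsilon>\<^sub>0 > 0" if "v \<in> {u\<^sub>1..u\<^sub>2}" for v
      using assms(10)[OF that] unfolding D(2)[OF e0] .
  qed (use e0 assms(3,4) dv d1v in blast)+
  show ?thesis
  proof (rule ex_forward[OF tang.bifurcation], elim conjE, intro conjI ballI)
    fix \<epsilon>\<^sub>p \<epsilon>
    assume all: "\<forall>e\<in>{\<epsilon>\<^sub>0<..<\<epsilon>\<^sub>p}. \<exists>ul ur. u\<^sub>1 < ul \<and> ul < ur \<and> ur < u\<^sub>2 \<and> d ul e = 0 \<and> d ur e = 0 \<and>
      (\<forall>v\<in>{u\<^sub>1..u\<^sub>2}. 0 \<le> dp v e) \<and> (\<forall>v\<in>{u\<^sub>1..ul} \<union> {ur..u\<^sub>2}. 0 \<le> d v e) \<and>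
      (\<exists>w. continuous_on {ul..ur} w \<and> w ul = 0 \<and> w ur = 0 \<and>
      (\<forall>v\<in>{ul<..<ur}. 0 < w v \<and> w v < e \<and> d v (e - w v) > 0 \<and> dp v (e - w v) > 0 \<and>
        (w has_real_derivative tang.spine_field e v (w v)) (at v)))"
      and \<epsilon>: "\<epsilon> \<in> {\<epsilon>\<^sub>0<..<\<epsilon>\<^sub>p}"
    have e: "\<epsilon> > 0" using \<epsilon> e0 by simp
    obtain ul ur w where lr: "u\<^sub>1 < ul" "ul < ur" "ur < u\<^sub>2" and roots: "d ul \<epsilon> = 0" "d ur \<epsilon> = 0"
      and nn: "\<And>v. v \<in> {u\<^sub>1..u\<^sub>2} \<Longrightarrow> 0 \<le> dp v \<epsilon>" "\<And>v. v \<in> {u\<^sub>1..ul} \<union> {ur..u\<^sub>2} \<Longrightarrow> 0 \<le> d v \<epsilon>"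
      and w: "continuous_on {ul..ur} w" "w ul = 0" "w ur = 0"
      and w_in: "\<And>v. v \<in> {ul<..<ur} \<Longrightarrow> 0 < w v \<and> w v < \<epsilon> \<and> d v (\<epsilon> - w v) > 0 \<and> dp v (\<epsilon> - w v) > 0"
      and w_deriv: "\<And>v. v \<in> {ul<..<ur} \<Longrightarrow> (w has_real_derivative tang.spine_field \<epsilon> v (w v)) (at v)"
      using all[rule_format, OF \<epsilon>] by blast
    have f: "(f\<^sub>p has_real_derivative P 1 x) (at x)" "(P 1 has_real_derivative P 2 x) (at x)"
      "(f\<^sub>m has_real_derivative M 1 x) (at x)" "(M 1 has_real_derivative M 2 x) (at x)" for x
      using P[of 0] P[of 1] M[of 0] M[of 1] unfolding sucs P0 by simp_all
    have c2: "continuous_on UNIV (P 2)" "continuous_on UNIV (M 2)" by (rule PM_cont, simp)+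
    have fol: "\<exists>B T.
         C1_smooth_on (left_parallelogram \<epsilon> u\<^sub>1 u\<^sub>2) B \<and>
         diagonally_concave_on (left_parallelogram \<epsilon> u\<^sub>1 u\<^sub>2) B \<and>
         boundary_values \<epsilon> f\<^sub>p f\<^sub>m (left_parallelogram \<epsilon> u\<^sub>1 u\<^sub>2) B \<and>
         left_simple_candidate \<epsilon> f\<^sub>p f\<^sub>m u\<^sub>1 ul B \<and>
         left_simple_candidate \<epsilon> f\<^sub>p f\<^sub>m ur u\<^sub>2 B \<and>
         left_herringbone_candidate \<epsilon> f\<^sub>p f\<^sub>m (ul + \<epsilon>) (ur + \<epsilon>) T B \<and>
         T (ul + \<epsilon>) = -\<epsilon> \<and> T (ur + \<epsilon>) = -\<epsilon> \<and>
         (\<forall>u\<in>{ul + \<epsilon>..ur + \<epsilon>}. T u \<noteq> 0) \<and>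
         herringbone_domain \<epsilon> (ul + \<epsilon>) (ur + \<epsilon>) T = left_parallelogram \<epsilon> ul ur"
    proof (rule herringbone_foliation_from_section[of \<epsilon> u\<^sub>1 ul ur u\<^sub>2 f\<^sub>p "P 1" "P 2" f\<^sub>m "M 1" "M 2" d dp w])
      show "(w has_real_derivative
         ((2 * \<epsilon> - w v) * d v (\<epsilon> - w v) - w v * dp v (\<epsilon> - w v)) /
         ((2 * \<epsilon> - w v) * d v (\<epsilon> - w v) + w v * dp v (\<epsilon> - w v))) (at v)"
        if "v \<in> {ul<..<ur}" for v
        using w_deriv[OF that] unfolding tang.spine_field_def .
    qed (rule e lr f c2 nn w w_in d_def dp_def; assumption)+
    show "\<exists>u\<^sub>l u\<^sub>r. u\<^sub>1 < u\<^sub>l \<and> u\<^sub>l < u\<^sub>r \<and> u\<^sub>r < u\<^sub>2 \<and>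
      D_minus f\<^sub>p f\<^sub>m (u\<^sub>l, -\<epsilon>) = 0 \<and> D_minus f\<^sub>p f\<^sub>m (u\<^sub>r, -\<epsilon>) = 0 \<and>
      (\<exists>B T.
         C1_smooth_on (left_parallelogram \<epsilon> u\<^sub>1 u\<^sub>2) B \<and>
         diagonally_concave_on (left_parallelogram \<epsilon> u\<^sub>1 u\<^sub>2) B \<and>
         boundary_values \<epsilon> f\<^sub>p f\<^sub>m (left_parallelogram \<epsilon> u\<^sub>1 u\<^sub>2) B \<and>
         left_simple_candidate \<epsilon> f\<^sub>p f\<^sub>m u\<^sub>1 u\<^sub>l B \<and>
         left_simple_candidate \<epsilon> f\<^sub>p f\<^sub>m u\<^sub>r u\<^sub>2 B \<and>
         left_herringbone_candidate \<epsilon> f\<^sub>p f\<^sub>m (u\<^sub>l + \<epsilon>) (u\<^sub>r + \<epsilon>) T B \<and>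
         T (u\<^sub>l + \<epsilon>) = -\<epsilon> \<and> T (u\<^sub>r + \<epsilon>) = -\<epsilon> \<and>
         (\<forall>u\<in>{u\<^sub>l + \<epsilon>..u\<^sub>r + \<epsilon>}. T u \<noteq> 0) \<and>
         herringbone_domain \<epsilon> (u\<^sub>l + \<epsilon>) (u\<^sub>r + \<epsilon>) T = left_parallelogram \<epsilon> u\<^sub>l u\<^sub>r)"
    proof (rule exI[of _ ul], rule exI[of _ ur], intro conjI)
      show "D_minus f\<^sub>p f\<^sub>m (ul, -\<epsilon>) = 0" "D_minus f\<^sub>p f\<^sub>m (ur, -\<epsilon>) = 0"
        unfolding D(1)[OF e] by (rule roots)+
    qed (rule lr fol)+
  qed assumption
qed

end
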